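(* The mapping $N:\mathcal G\times\mathfrak F\to\mathfrak F$ given by $N(\phi,\phi',H)=\phi'\circ H\circ\phi^{-1}$ is a free and proper left action, where properness means that the map $\mathcal G\times\mathfrak F\to\mathfrak F\times\mathfrak F$, $(\phi,\phi',H)\mapsto(H,\phi'\circ H\circ\phi^{-1})$, is a proper map.
   Context: Fix $\varepsilon\in\{+1,-1\}$. Let $\mathbb H^2=\{(z,w)\in\mathbb C^2:\operatorname{Im} w=|z|^2\}$ and $\mathbb H^3_\varepsilon=\{(z_1',z_2',w')\in\mathbb C^3:\operatorname{Im} w'=|z_1'|^2+\varepsilon|z_2'|^2\}$. Class $\mathcal F$: the set of germs at $0\in\mathbb C^2$ of holomorphic maps $H=(f_1,f_2,g)$ into $\mathbb C^3$ such that $H(0)=0$, $H(U\cap\mathbb H^2)\subset\mathbb H^3_\varepsilon$ for some neighborhood $U$ of $0$, $f_{1z}(0)f_{2z^2}(0)-f_{2z}(0)f_{1z^2}(0)\neq 0$ and $g_w(0)>0$. Subscripts denote partial derivatives. Topology on $\mathcal F$ and its subsets: for $H=(f,g)\in\mathcal F$, $f=(f_1,f_2)$, let $j_0(H)=(f_z(0),H_w(0),f_{z^2}(0),H_{zw}(0),H_{w^2}(0),f_{z^2w}(0))\in\mathbb C^{15}$. The map $j_0$ is injective on $\mathcal F$, and $\mathcal F$ carries the topology induced from $\mathbb C^{15}$ via $j_0$. Isotropy group $\mathcal G$: the direct product of the groups (under composition) of germs at $0$ of the following two kinds of maps. With $\gamma=(\lambda,r,u,c)\in\Gamma=\mathbb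 R^+\times\mathbb R\times\{|u|=1\}\times\mathbb C$, $$\sigma_\gamma(z,w)=\frac{(\lambda u(z+cw),\lambda^2w)}{1-2i\bar c z+(r-i|c|^2)w};$$ with $\gamma'=(\lambda',r',u',a',c')$, $\lambda'\in\mathbb R^+$, $r'\in\mathbb R$, $|u'|=1$, $a'=(a_1',a_2')\in\mathbb C^2$ with $|a_1'|^2+\varepsilon|a_2'|^2=1$, $c'=(c_1',c_2')\in\mathbb C^2$, and $U'=\begin{pmatrix}u'a_1'&-\varepsilon u'a_2'\\ \bar a_2'&\bar a_1'\end{pmatrix}$, $$\sigma'_{\gamma'}(z',w')=\frac{(\lambda'U'\,{}^t(z'+c'w'),{\lambda'}^2w')}{1-2i(\bar c_1'z_1'+\varepsilon\bar c_2'z_2')+(r'-i(|c_1'|^2+\varepsilon|c_2'|^2))w'}.$$ These are isotropies at $0$ of $\mathbb H^2$ and $\mathbb H^3_\varepsilon$ respectively. $\mathcal G$ is topologized by its parameters $(\gamma,\gamma')$ (equivalently by $2$-jets at $0$). Sets $\mathfrak N$ and $\mathfrak F$: for $s\ge0$ put $$G_{2,s}^{\varepsilon}(z,w)=\frac{\bigl(4z-4\varepsilon sz^2+i(\varepsilon-s^2)zw+sw^2,\;4z^2+s^2w^2,\;w(4-4\varepsilon sz-i(\varepsilon+s^2)w)\bigr)}{4-4\varepsilon sz-i(\varepsilon+s^2)w-2iszw-\varepsilon s^2w^2},$$ and $G_{3,s}^\varepsilon=(P_1,P_2,P_3)/Q$ with $P_1=256\varepsilon z+96izw+64\varepsilon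 sw^2+64z^3+64i\varepsilon sz^2w-3(3\varepsilon-16s^2)zw^2+4isw^3$, $P_2=256\varepsilon z^2-16w^2+256sz^3+16iz^2w-16\varepsilon szw^2-i\varepsilon w^3$, $P_3=w(256\varepsilon-32iw+64z^2-64i\varepsilon szw-(\varepsilon+16s^2)w^2)$, $Q=256\varepsilon-32iw+64z^2-192i\varepsilon szw-(17\varepsilon+144s^2)w^2+32i\varepsilon z^2w+24szw^2+iw^3$. Let $\mathfrak N=\{G_{2,s}^\varepsilon,G_{3,s}^\varepsilon:s>0\}\subset\mathcal F$ and let $\mathfrak F=\{\phi'\circ H\circ\phi^{-1}:H\in\mathfrak N,(\phi,\phi')\in\mathcal G\}\subset\mathcal F$. *)

theory Defs
  imports "HOL-Analysis.Analysis" "HOL-Algebra.Group_Action"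
begin

definition complex_differentiable_at ::
    "(complex^'n \<Rightarrow> complex^'m) \<Rightarrow> complex^'n \<Rightarrow> bool" where
  "complex_differentiable_at f x \<longleftrightarrow>
     (\<exists>D. (f has_derivative D) (at x) \<and> (\<forall>c v. D (c *s v) = c *s D v))"

definition pointed_holomorphic :: "(complex^'n \<Rightarrow> complex^'m) \<Rightarrow> bool" where
  "pointed_holomorphic f \<longleftrightarrow>
     (\<forall>\<^sub>F x in nhds 0. complex_differentiable_at f x) \<and> f 0 = 0"

definition germ_rel ::
    "(complex^'n \<Rightarrow> complex^'m) \<Rightarrow> (complex^'n \<Rightarrow> complex^'m) \<Rightarrow> bool" where
  "germ_rel f g \<longleftrightarrow>
     pointed_holomorphic f \<and> pointed_holomorphic g \<and> (\<forall>\<^sub>F x in nhds 0. f x = g x)"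

lemma pointed_holomorphic_zero: "pointed_holomorphic (\<lambda>x. 0)"
  unfolding pointed_holomorphic_def complex_differentiable_at_def
  by (auto intro!: always_eventually exI[of _ "\<lambda>x. 0"])

text \<open>The relation is reflexive only on maps holomorphic near the origin that fix the origin, so
  the quotient type consists of the germs at the origin of exactly these maps, and composition of
  germs is everywhere defined. A germ given by a formula \<open>f\<close> is \<open>abs_germ f\<close>; this is meaningful
  once \<open>germ_rel f f\<close> is known, which is proved below for each formula used.\<close>

quotient_type (overloaded) ('n, 'm) germ =
  "complex^'n::finite \<Rightarrow> complex^'m::finite" / partial: germ_rel
proof (rule part_equivpI)
  show "\<exists>f :: complex^'n \<Rightarrow> complex^'m. germ_rel f f"
    using pointed_holomorphic_zero by (auto simp: germ_rel_def)
  show "symp (germ_rel :: (complex^'n \<Rightarrow> complex^'m) \<Rightarrow> _)"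
    by (auto simp: germ_rel_def symp_def elim: eventually_mono)
  show "transp (germ_rel :: (complex^'n \<Rightarrow> complex^'m) \<Rightarrow> _)"
    unfolding germ_rel_def transp_def by (auto elim: eventually_elim2)
qed

lemma complex_differentiable_at_comp:
  assumes "complex_differentiable_at g x" "complex_differentiable_at f (g x)"
  shows "complex_differentiable_at (f \<circ> g) x"
proof -
  obtain D where D: "(g has_derivative D) (at x)" "\<And>c v. D (c *s v) = c *s D v"
    using assms(1) by (auto simp: complex_differentiable_at_def)
  obtain E where E: "(f has_derivative E) (at (g x))" "\<And>c v. E (c *s v) = c *s E v"
    using assms(2) by (auto simp: complex_differentiable_at_def)
  have "(f \<circ> g has_derivative E \<circ> D) (at x)"
    using D(1) E(1) by (rule diff_chain_at)
  then show ?thesis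
    unfolding complex_differentiable_at_def using D(2) E(2) by (auto intro!: exI[of _ "E \<circ> D"])
qed

lemma pointed_holomorphic_tendsto:
  assumes "pointed_holomorphic g"
  shows "filterlim g (nhds 0) (nhds 0)"
proof -
  have "complex_differentiable_at g 0"
    using assms eventually_nhds_x_imp_x by (auto simp: pointed_holomorphic_def)
  then have "isCont g 0"
    by (auto simp: complex_differentiable_at_def dest: has_derivative_continuous)
  then show ?thesis
    using assms by (auto simp: pointed_holomorphic_def isCont_def tendsto_at_iff_tendsto_nhds)
qed

lemma pointed_holomorphic_comp:
  assumes "pointed_holomorphic f" "pointed_holomorphic g"
  shows "pointed_holomorphic (f \<circ> g)"
proof -
  have "\<forall>\<^sub>F x in nhds 0. complex_differentiable_at f (g x)"
    using assms(1) pointed_holomorphic_tendsto[OF assms(2)]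
    by (auto simp: pointed_holomorphic_def filterlim_iff)
  moreover have "\<forall>\<^sub>F x in nhds 0. complex_differentiable_at g x"
    using assms(2) by (simp add: pointed_holomorphic_def)
  ultimately have "\<forall>\<^sub>F x in nhds 0. complex_differentiable_at (f \<circ> g) x"
    by eventually_elim (rule complex_differentiable_at_comp)
  then show ?thesis
    using assms by (auto simp: pointed_holomorphic_def)
qed

lift_definition germ_comp :: "('m::finite, 'k::finite) germ \<Rightarrow> ('n::finite, 'm) germ \<Rightarrow> ('n, 'k) germ"
  is "\<lambda>f g. f \<circ> g"
proof -
  fix f f' :: "complex^'m \<Rightarrow> complex^'k" and g g' :: "complex^'n \<Rightarrow> complex^'m"
  assume f: "germ_rel f f'" and g: "germ_rel g g'"
  have "\<forall>\<^sub>F x in nhds 0. f (g x) = f' (g x)"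
    using f pointed_holomorphic_tendsto[of g] g by (auto simp: germ_rel_def filterlim_iff)
  moreover have "\<forall>\<^sub>F x in nhds 0. g x = g' x"
    using g by (simp add: germ_rel_def)
  ultimately have "\<forall>\<^sub>F x in nhds 0. (f \<circ> g) x = (f' \<circ> g') x"
    by eventually_elim simp
  then show "germ_rel (f \<circ> g) (f' \<circ> g')"
    using f g pointed_holomorphic_comp[of f g] pointed_holomorphic_comp[of f' g']
    by (simp add: germ_rel_def)
qed

lift_definition germ_id :: "('n::finite, 'n) germ" is "\<lambda>x. x"
  unfolding germ_rel_def pointed_holomorphic_def complex_differentiable_at_def
  by (auto intro!: always_eventually exI[of _ "\<lambda>x. x"])

text \<open>\<open>complex_partial i f x\<close> is the complex partial derivative of the scalar function \<open>f\<close> in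
  the \<open>i\<close>-th coordinate; \<open>germ_partial H k [i1, ..., ir]\<close> is the iterated partial derivative at
  the origin of the \<open>k\<close>-th component of \<open>H\<close>, taken successively in \<open>i1, ..., ir\<close>.\<close>

definition complex_partial :: "'n \<Rightarrow> (complex^'n \<Rightarrow> complex) \<Rightarrow> complex^'n \<Rightarrow> complex" where
  "complex_partial i f x = deriv (\<lambda>t. f (x + axis i t)) 0"

lemma eventually_complex_partial_eq:
  assumes "\<forall>\<^sub>F x in nhds (0::complex^'n). f x = g x"
  shows "\<forall>\<^sub>F x in nhds 0. complex_partial i f x = complex_partial i g x"
proof -
  have "\<forall>\<^sub>F y in nhds (0::complex^'n). \<forall>\<^sub>F x in nhds y. f x = g x"
    using assms by (simp add: eventually_eventually)
  then show ?thesis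
  proof eventually_elim
    case (elim y)
    have "((\<lambda>t. y + axis i t) \<longlongrightarrow> y) (nhds 0)"
    proof -
      have "((\<lambda>t::complex. \<chi> j. (y + axis i t) $ j) \<longlongrightarrow> (\<chi> j. y $ j)) (nhds 0)"
      proof (rule tendsto_vec_lambda)
        fix j
        have "((\<lambda>t. t) \<longlongrightarrow> (0::complex)) (nhds 0)"
          by (rule filterlim_ident)
        then have "((\<lambda>t. y $ j + t) \<longlongrightarrow> y $ j + 0) (nhds (0::complex))"
          by (intro tendsto_intros)
        then show "((\<lambda>t. (y + axis i t) $ j) \<longlongrightarrow> y $ j) (nhds 0)"
          by (cases "i = j") (auto simp: axis_def)
      qed
      then show ?thesis by (simp only: vec_lambda_eta)
    qed
    then have "\<forall>\<^sub>F t in nhds 0. f (y + axis i t) = g (y + axis i t)"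
      using elim by (auto simp: filterlim_iff)
    then show ?case
      unfolding complex_partial_def by (intro deriv_cong_ev) auto
  qed
qed

lift_definition germ_partial :: "('n::finite, 'm::finite) germ \<Rightarrow> 'm \<Rightarrow> 'n list \<Rightarrow> complex"
  is "\<lambda>f k d. fold complex_partial d (\<lambda>x. f x $ k) 0"
proof (intro ext)
  fix f g :: "complex^'n \<Rightarrow> complex^'m" and k d
  have "\<forall>\<^sub>F x in nhds 0. fold complex_partial d u x = fold complex_partial d v x"
    if "\<forall>\<^sub>F x in nhds 0. u x = v x" for u v :: "complex^'n \<Rightarrow> complex"
    using that by (induction d arbitrary: u v) (auto intro: eventually_complex_partial_eq)
  note fold_eq = this
  assume "germ_rel f g"
  then have "\<forall>\<^sub>F x in nhds 0. f x $ k = g x $ k"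
    by (auto simp: germ_rel_def elim: eventually_mono)
  from eventually_nhds_x_imp_x[OF fold_eq[OF this]] show
    "fold complex_partial d (\<lambda>x. f x $ k) 0 = fold complex_partial d (\<lambda>x. g x $ k) 0" .
qed

definition scalar_holo_at :: "(complex^'n \<Rightarrow> complex) \<Rightarrow> complex^'n \<Rightarrow> bool" where
  "scalar_holo_at h x \<longleftrightarrow>
     (\<exists>D. (h has_derivative D) (at x) \<and> (\<forall>c v. D (c *s v) = c * D v))"

lemma scalar_holo_at_const: "scalar_holo_at (\<lambda>x. c) x"
  unfolding scalar_holo_at_def by (auto intro!: exI[of _ "\<lambda>x. 0"])

lemma scalar_holo_at_nth: "scalar_holo_at (\<lambda>x. x $ i) x"
  unfolding scalar_holo_at_def
  by (intro exI[of _ "\<lambda>v. v $ i"])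
     (auto intro: bounded_linear_imp_has_derivative bounded_linear_vec_nth)

lemma scalar_holo_at_add:
  assumes "scalar_holo_at f x" "scalar_holo_at g x"
  shows "scalar_holo_at (\<lambda>x. f x + g x) x"
proof -
  obtain D E where "(f has_derivative D) (at x)" "\<And>c v. D (c *s v) = c * D v"
    "(g has_derivative E) (at x)" "\<And>c v. E (c *s v) = c * E v"
    using assms unfolding scalar_holo_at_def by blast
  then show ?thesis unfolding scalar_holo_at_def
    by (intro exI[of _ "\<lambda>v. D v + E v"]) (auto intro: has_derivative_add simp: algebra_simps)
qed

lemma scalar_holo_at_mult:
  assumes "scalar_holo_at f x" "scalar_holo_at g x"
  shows "scalar_holo_at (\<lambda>x. f x * g x) x"
proof -
  obtain D E where "(f has_derivative D) (at x)" "\<And>c v. D (c *s v) = c * D v"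
    "(g has_derivative E) (at x)" "\<And>c v. E (c *s v) = c * E v"
    using assms unfolding scalar_holo_at_def by blast
  then show ?thesis unfolding scalar_holo_at_def
    by (intro exI[of _ "\<lambda>v. f x * E v + D v * g x"] conjI has_derivative_mult)
       (auto simp: algebra_simps)
qed

lemma scalar_holo_at_diff:
  assumes "scalar_holo_at f x" "scalar_holo_at g x"
  shows "scalar_holo_at (\<lambda>x. f x - g x) x"
proof -
  have "scalar_holo_at (\<lambda>x. f x + (-1) * g x) x"
    by (intro scalar_holo_at_add scalar_holo_at_mult scalar_holo_at_const assms)
  then show ?thesis by simp
qed

lemma scalar_holo_at_power:
  assumes "scalar_holo_at f x"
  shows "scalar_holo_at (\<lambda>x. f x ^ n) x"
  by (induction n) (auto intro: scalar_holo_at_mult scalar_holo_at_const assms)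

lemma scalar_holo_at_divide:
  assumes "scalar_holo_at f x" "scalar_holo_at g x" "g x \<noteq> 0"
  shows "scalar_holo_at (\<lambda>x. f x / g x) x"
proof -
  obtain E where E: "(g has_derivative E) (at x)" "\<And>c v. E (c *s v) = c * E v"
    using assms unfolding scalar_holo_at_def by blast
  have "scalar_holo_at (\<lambda>x. inverse (g x)) x" unfolding scalar_holo_at_def
    by (intro exI[of _ "\<lambda>v. - (inverse (g x) * E v * inverse (g x))"])
       (use Deriv.has_derivative_inverse[OF assms(3) E(1)] E(2) in \<open>auto simp: algebra_simps\<close>)
  from scalar_holo_at_mult[OF assms(1) this] show ?thesis by (simp add: divide_inverse)
qed

lemmas scalar_holo_at_intros =
  scalar_holo_at_const scalar_holo_at_nth scalar_holo_at_add scalar_holo_at_diff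
  scalar_holo_at_mult scalar_holo_at_power

lemma complex_differentiable_at_componentwise:
  assumes "\<And>k. scalar_holo_at (\<lambda>x. f x $ k) x"
  shows "complex_differentiable_at f x"
proof -
  obtain D where D: "\<And>k. ((\<lambda>x. f x $ k) has_derivative D k) (at x)"
    "\<And>k c v. D k (c *s v) = c * D k v"
    using assms unfolding scalar_holo_at_def by metis
  have "((\<lambda>x. \<chi> k. f x $ k) has_derivative (\<lambda>v. \<chi> k. D k v)) (at x)"
    using D(1)
    by (intro has_derivative_componentwise_within[THEN iffD2])
       (auto simp: Basis_vec_def inner_axis intro: has_derivative_inner_left)
  then show ?thesis
    unfolding complex_differentiable_at_def using D(2)
    by (intro exI[of _ "\<lambda>v. \<chi> k. D k v"]) (auto simp: vec_eq_iff)
qed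

lemma scalar_holo_at_continuous: "scalar_holo_at f x \<Longrightarrow> isCont f x"
  by (auto simp: scalar_holo_at_def dest: has_derivative_continuous)

lemma scalar_holo_at_imp_ev_nonzero:
  assumes "scalar_holo_at q 0" "q 0 \<noteq> 0"
  shows "\<forall>\<^sub>F x in nhds 0. q x \<noteq> 0"
proof -
  have "(q \<longlongrightarrow> q 0) (nhds 0)"
    using scalar_holo_at_continuous[OF assms(1)] by (simp add: isCont_def tendsto_at_iff_tendsto_nhds)
  then show ?thesis using assms(2) by (rule tendsto_imp_eventually_ne)
qed

lemma germ_rel_quotient2:
  fixes q :: "complex^'n \<Rightarrow> complex"
  assumes "\<And>x. scalar_holo_at p1 x" "\<And>x. scalar_holo_at p2 x" "\<And>x. scalar_holo_at q x"
    and "q 0 \<noteq> 0" "p1 0 = 0" "p2 0 = 0"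
  defines "f \<equiv> \<lambda>x. vector [p1 x / q x, p2 x / q x] :: complex^2"
  shows "germ_rel f f"
proof -
  have "\<forall>\<^sub>F x in nhds 0. complex_differentiable_at f x"
    using scalar_holo_at_imp_ev_nonzero[OF assms(3,4)]
  proof eventually_elim
    case (elim x)
    have "scalar_holo_at (\<lambda>x. f x $ k) x" for k
      using exhaust_2[of k]
      by (elim disjE; simp only: f_def vector_2; intro scalar_holo_at_divide assms elim)
    then show ?case by (rule complex_differentiable_at_componentwise)
  qed
  moreover have "f 0 = 0" by (simp add: f_def assms vec_eq_iff forall_2)
  ultimately show ?thesis by (simp add: germ_rel_def pointed_holomorphic_def)
qed

lemma germ_rel_quotient3:
  fixes q :: "complex^'n \<Rightarrow> complex"
  assumes "\<And>x. scalar_holo_at p1 x" "\<And>x. scalar_holo_at p2 x" "\<And>x. scalar_holo_at p3 x"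
    "\<And>x. scalar_holo_at q x" and "q 0 \<noteq> 0" "p1 0 = 0" "p2 0 = 0" "p3 0 = 0"
  defines "f \<equiv> \<lambda>x. vector [p1 x / q x, p2 x / q x, p3 x / q x] :: complex^3"
  shows "germ_rel f f"
proof -
  have "\<forall>\<^sub>F x in nhds 0. complex_differentiable_at f x"
    using scalar_holo_at_imp_ev_nonzero[OF assms(4,5)]
  proof eventually_elim
    case (elim x)
    have "scalar_holo_at (\<lambda>x. f x $ k) x" for k
      using exhaust_3[of k]
      by (elim disjE; simp only: f_def vector_3; intro scalar_holo_at_divide assms elim)
    then show ?case by (rule complex_differentiable_at_componentwise)
  qed
  moreover have "f 0 = 0" by (simp add: f_def assms vec_eq_iff forall_3)
  ultimately show ?thesis by (simp add: germ_rel_def pointed_holomorphic_def)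
qed

text \<open>Source coordinates \<open>(z, w)\<close> have indices \<open>1, 2\<close>; the components \<open>f\<^sub>1, f\<^sub>2, g\<close> of a map into
  three-dimensional space have indices \<open>1, 2, 3\<close>.\<close>

definition heisenberg2 :: "(complex^2) set" where
  "heisenberg2 = {x. Im (x$2) = (cmod (x$1))\<^sup>2}"

definition heisenberg3 :: "real \<Rightarrow> (complex^3) set" where
  "heisenberg3 \<epsilon> = {x. Im (x$3) = (cmod (x$1))\<^sup>2 + \<epsilon> * (cmod (x$2))\<^sup>2}"

lift_definition maps_into :: "('n::finite, 'm::finite) germ \<Rightarrow> (complex^'n) set \<Rightarrow> (complex^'m) set \<Rightarrow> bool"
  is "\<lambda>f M M'. \<exists>U. open U \<and> 0 \<in> U \<and> f ` (U \<inter> M) \<subseteq> M'"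
proof (intro ext)
  fix f g :: "complex^'n \<Rightarrow> complex^'m" and M M'
  assume rel: "germ_rel f g"
  have transfer_eq: "\<exists>U. open U \<and> 0 \<in> U \<and> v ` (U \<inter> M) \<subseteq> M'"
    if eq: "\<forall>\<^sub>F x in nhds 0. u x = v x"
      and ex: "\<exists>U. open U \<and> 0 \<in> U \<and> u ` (U \<inter> M) \<subseteq> M'"
    for u v :: "complex^'n \<Rightarrow> complex^'m"
  proof -
    obtain U where U: "open U" "0 \<in> U" "u ` (U \<inter> M) \<subseteq> M'"
      using ex by blast
    obtain V where V: "open V" "0 \<in> V" "\<forall>x\<in>V. u x = v x"
      using eq unfolding eventually_nhds by blast
    have "v x \<in> M'" if "x \<in> (U \<inter> V) \<inter> M" for x
    proof -
      have "v x = u x" using that V(3) by simp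
      also have "u x \<in> M'" using that U(3) by blast
      finally show ?thesis .
    qed
    then have "v ` ((U \<inter> V) \<inter> M) \<subseteq> M'" by blast
    with U V show ?thesis by (metis IntI open_Int)
  qed
  have "\<forall>\<^sub>F x in nhds 0. f x = g x" "\<forall>\<^sub>F x in nhds 0. g x = f x"
    using rel by (simp_all add: germ_rel_def eq_commute[of "g _"])
  then show "(\<exists>U. open U \<and> 0 \<in> U \<and> f ` (U \<inter> M) \<subseteq> M') \<longleftrightarrow>
        (\<exists>U. open U \<and> 0 \<in> U \<and> g ` (U \<inter> M) \<subseteq> M')"
    using transfer_eq by blast
qed

definition class_F :: "real \<Rightarrow> (2, 3) germ set" where
  "class_F \<epsilon> =
     {H. maps_into H heisenberg2 (heisenberg3 \<epsilon>) \<and>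
         germ_partial H 1 [1] * germ_partial H 2 [1,1]
           - germ_partial H 2 [1] * germ_partial H 1 [1,1] \<noteq> 0 \<and>
         germ_partial H 3 [2] \<in> \<real> \<and> Re (germ_partial H 3 [2]) > 0}"

text \<open>The jet \<open>(f\<^sub>z, H\<^sub>w, f\<^sub>z\<^sub>z, H\<^sub>z\<^sub>w, H\<^sub>w\<^sub>w, f\<^sub>z\<^sub>z\<^sub>w)(0)\<close>, where \<open>f\<close> consists of the first two
  components of \<open>H\<close>; the target is a 15-dimensional complex space.\<close>

type_synonym jet =
  "(complex^2) \<times> (complex^3) \<times> (complex^2) \<times> (complex^3) \<times> (complex^3) \<times> (complex^2)"

definition jet0 :: "(2, 3) germ \<Rightarrow> jet" where
  "jet0 H =
     (let df = (\<lambda>d. vector [germ_partial H 1 d, germ_partial H 2 d] :: complex^2);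
          dH = (\<lambda>d. \<chi> k. germ_partial H k d)
      in (df [1], dH [2], df [1,1], dH [1,2], dH [2,2], df [1,1,2]))"

definition topology_F :: "real \<Rightarrow> (2, 3) germ topology" where
  "topology_F \<epsilon> = pullback_topology (class_F \<epsilon>) jet0 euclidean"

type_synonym params = "real \<times> real \<times> complex \<times> complex"
type_synonym params' = "real \<times> real \<times> complex \<times> (complex^2) \<times> (complex^2)"

definition Gamma :: "params set" where
  "Gamma = {(l, r, u, c). l > 0 \<and> cmod u = 1}"

definition Gamma' :: "real \<Rightarrow> params' set" where
  "Gamma' \<epsilon> = {(l', r', u', a', c').
     l' > 0 \<and> cmod u' = 1 \<and> (cmod (a'$1))\<^sup>2 + \<epsilon> * (cmod (a'$2))\<^sup>2 = 1}"

definition sigma_map :: "params \<Rightarrow> complex^2 \<Rightarrow> complex^2" where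
  "sigma_map = (\<lambda>(l, r, u, c) x.
     let z = x$1; w = x$2;
         \<delta> = 1 - 2 * \<i> * cnj c * z + (of_real r - \<i> * of_real ((cmod c)\<^sup>2)) * w
     in vector [of_real l * u * (z + c * w) / \<delta>, (of_real l)\<^sup>2 * w / \<delta>])"

definition U_matrix :: "real \<Rightarrow> complex \<Rightarrow> complex^2 \<Rightarrow> complex^2^2" where
  "U_matrix \<epsilon> u' a' =
     vector [vector [u' * a'$1, - of_real \<epsilon> * u' * a'$2],
             vector [cnj (a'$2), cnj (a'$1)]]"

definition sigma'_map :: "real \<Rightarrow> params' \<Rightarrow> complex^3 \<Rightarrow> complex^3" where
  "sigma'_map \<epsilon> = (\<lambda>(l', r', u', a', c') x.
     let z = vector [x$1, x$2] :: complex^2; w = x$3;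
         y = of_real l' *s (U_matrix \<epsilon> u' a' *v (z + w *s c'));
         \<delta> = 1 - 2 * \<i> * (cnj (c'$1) * z$1 + of_real \<epsilon> * cnj (c'$2) * z$2)
               + (of_real r' - \<i> * of_real ((cmod (c'$1))\<^sup>2 + \<epsilon> * (cmod (c'$2))\<^sup>2)) * w
     in vector [y$1 / \<delta>, y$2 / \<delta>, (of_real l')\<^sup>2 * w / \<delta>])"

lemma germ_rel_sigma_map: "germ_rel (sigma_map p) (sigma_map p)"
proof (cases p)
  case (fields l r u c)
  show ?thesis
    unfolding fields sigma_map_def Let_def split
    by (rule germ_rel_quotient2) (intro scalar_holo_at_intros | simp)+
qed

lemma germ_rel_sigma'_map: "germ_rel (sigma'_map \<epsilon> p) (sigma'_map \<epsilon> p)"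
proof (cases p)
  case (fields l r u a c)
  show ?thesis
    unfolding fields sigma'_map_def Let_def split
    by (rule germ_rel_quotient3)
       ((simp only: U_matrix_def matrix_vector_mult_def vector_2 sum_2 vec_lambda_beta
           vector_scalar_mult_def vector_add_component)?,
        (intro scalar_holo_at_intros | simp)+)+
qed

definition sigma :: "params \<Rightarrow> (2, 2) germ" where
  "sigma \<gamma> = abs_germ (sigma_map \<gamma>)"

definition sigma' :: "real \<Rightarrow> params' \<Rightarrow> (3, 3) germ" where
  "sigma' \<epsilon> \<gamma>' = abs_germ (sigma'_map \<epsilon> \<gamma>')"

definition germ_group :: "('n::finite, 'n) germ set \<Rightarrow> ('n, 'n) germ monoid" where
  "germ_group S = \<lparr>carrier = S, monoid.mult = germ_comp, one = germ_id\<rparr>"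

definition Iso2 :: "(2, 2) germ monoid" where
  "Iso2 = germ_group (sigma ` Gamma)"

definition Iso3 :: "real \<Rightarrow> (3, 3) germ monoid" where
  "Iso3 \<epsilon> = germ_group (sigma' \<epsilon> ` Gamma' \<epsilon>)"

definition isotropy_group :: "real \<Rightarrow> ((2, 2) germ \<times> (3, 3) germ) monoid" where
  "isotropy_group \<epsilon> = Iso2 \<times>\<times> Iso3 \<epsilon>"

text \<open>For \<open>\<epsilon> = 1\<close> and \<open>\<epsilon> = -1\<close> both parametrizations are injective on their parameter sets (the parameters can be read off
  from the 2-jet), so the topology below is the one making each of them a homeomorphism.\<close>

definition topology_isotropy :: "real \<Rightarrow> ((2, 2) germ \<times> (3, 3) germ) topology" where
  "topology_isotropy \<epsilon> =
     prod_topology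
       (pullback_topology (sigma ` Gamma) (inv_into Gamma sigma) (top_of_set Gamma))
       (pullback_topology (sigma' \<epsilon> ` Gamma' \<epsilon>) (inv_into (Gamma' \<epsilon>) (sigma' \<epsilon>))
          (top_of_set (Gamma' \<epsilon>)))"

definition G2_map :: "real \<Rightarrow> real \<Rightarrow> complex^2 \<Rightarrow> complex^3" where
  "G2_map eps t = (\<lambda>x.
      let \<epsilon> = complex_of_real eps; s = complex_of_real t; z = x$1; w = x$2;
          Q = 4 - 4 * \<epsilon> * s * z - \<i> * (\<epsilon> + s^2) * w - 2 * \<i> * s * z * w - \<epsilon> * s^2 * w^2
      in vector
           [(4 * z - 4 * \<epsilon> * s * z^2 + \<i> * (\<epsilon> - s^2) * z * w + s * w^2) / Q,
            (4 * z^2 + s^2 * w^2) / Q,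
            w * (4 - 4 * \<epsilon> * s * z - \<i> * (\<epsilon> + s^2) * w) / Q])"

definition G3_map :: "real \<Rightarrow> real \<Rightarrow> complex^2 \<Rightarrow> complex^3" where
  "G3_map eps t = (\<lambda>x.
      let \<epsilon> = complex_of_real eps; s = complex_of_real t; z = x$1; w = x$2;
          P1 = 256 * \<epsilon> * z + 96 * \<i> * z * w + 64 * \<epsilon> * s * w^2 + 64 * z^3 + 64 * \<i> * \<epsilon> * s * z^2 * w
                 - 3 * (3 * \<epsilon> - 16 * s^2) * z * w^2 + 4 * \<i> * s * w^3;
          P2 = 256 * \<epsilon> * z^2 - 16 * w^2 + 256 * s * z^3 + 16 * \<i> * z^2 * w - 16 * \<epsilon> * s * z * w^2 - \<i> * \<epsilon> * w^3;
          P3 = w * (256 * \<epsilon> - 32 * \<i> * w + 64 * z^2 - 64 * \<i> * \<epsilon> * s * z * w - (\<epsilon> + 16 * s^2) * w^2);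
          Q = 256 * \<epsilon> - 32 * \<i> * w + 64 * z^2 - 192 * \<i> * \<epsilon> * s * z * w - (17 * \<epsilon> + 144 * s^2) * w^2
                + 32 * \<i> * \<epsilon> * z^2 * w + 24 * s * z * w^2 + \<i> * w^3
      in vector [P1 / Q, P2 / Q, P3 / Q])"

lemma germ_rel_G2_map: "germ_rel (G2_map \<epsilon> s) (G2_map \<epsilon> s)"
  unfolding G2_map_def Let_def
  by (rule germ_rel_quotient3) (intro scalar_holo_at_intros | simp)+

lemma germ_rel_G3_map: "\<epsilon> \<noteq> 0 \<Longrightarrow> germ_rel (G3_map \<epsilon> s) (G3_map \<epsilon> s)"
  unfolding G3_map_def Let_def
  by (rule germ_rel_quotient3) (intro scalar_holo_at_intros | simp)+

definition normal_forms :: "real \<Rightarrow> (2, 3) germ set" where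
  "normal_forms \<epsilon> =
     {abs_germ (G2_map \<epsilon> s) | s. s > 0} \<union> {abs_germ (G3_map \<epsilon> s) | s. s > 0}"

definition frakF :: "real \<Rightarrow> (2, 3) germ set" where
  "frakF \<epsilon> =
     {germ_comp \<phi>' (germ_comp H (inv\<^bsub>Iso2\<^esub> \<phi>)) | H \<phi> \<phi>'.
        H \<in> normal_forms \<epsilon> \<and> (\<phi>, \<phi>') \<in> carrier (isotropy_group \<epsilon>)}"

definition topology_frakF :: "real \<Rightarrow> (2, 3) germ topology" where
  "topology_frakF \<epsilon> = subtopology (topology_F \<epsilon>) (frakF \<epsilon>)"

text \<open>The restriction to \<open>frakF \<epsilon>\<close> is what the library's notion of a group action requires.\<close>

definition N_map :: "real \<Rightarrow> (2, 2) germ \<times> (3, 3) germ \<Rightarrow> (2, 3) germ \<Rightarrow> (2, 3) germ" where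
  "N_map \<epsilon> = (\<lambda>(\<phi>, \<phi>'). \<lambda>H\<in>frakF \<epsilon>. germ_comp \<phi>' (germ_comp H (inv\<^bsub>Iso2\<^esub> \<phi>)))"

end

theory Submission
  imports Defs
begin

text \<open>
  The isotropy group \<open>\<G>\<close> acts on \<open>frakF\<close> by left translation in disguise. Every map of \<open>frakF\<close> is
  \<open>\<phi>' \<circ> H\<^sub>t \<circ> \<phi>\<^sup>-\<^sup>1\<close> with \<open>(\<phi>, \<phi>') \<in> \<G>\<close> and a normal form \<open>H\<^sub>t\<close>, and the pair \<open>((\<phi>, \<phi>'), t)\<close> is unique and
  depends continuously on the jet of the map. Hence \<open>frakF\<close> is homeomorphic to \<open>\<G> \<times> T\<close>, with \<open>T\<close> the set
  of normal form parameters, such that \<open>\<G>\<close> acts by translation in the first factor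
  (\<open>homeomorphic_maps_bundle\<close>, \<open>N_map_bundle_map\<close>). For a topological group such an action is free,
  and \<open>(g, x) \<mapsto> (x, gx)\<close> has a continuous left inverse; a continuous map into a Hausdorff space with a
  continuous left inverse is a closed embedding, so it is proper (\<open>trivial_bundle_action\<close>).

  The work lies in recovering \<open>((\<phi>, \<phi>'), t)\<close> from the jet \<open>jet0\<close>. Three facts make this feasible.

  First, \<open>jet0\<close> only sees the Taylor coefficients of \<open>1, z, w, z\<^sup>2, zw, w\<^sup>2, z\<^sup>2w\<close>, that is, the class in the
  ring \<open>\<complex>[z,w]/(z\<^sup>3, zw\<^sup>2, w\<^sup>3)\<close>, and this class is computed by ring operations alone.

  Second, to this precision the families \<open>G2\<close> and \<open>G3\<close> are one family of polynomial maps with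
  parameters \<open>s\<close> and \<open>b\<close>, where \<open>b = s\<^sup>2/4\<close> for \<open>G2\<close> and \<open>b = -\<epsilon>/16\<close> for \<open>G3\<close> (\<open>has_jet_G2\<close>, \<open>has_jet_G3\<close>). The
  two curves of parameters meet only for \<open>\<epsilon> = -1\<close>, \<open>s = 1/2\<close>, and there both normal forms are the same map.

  Third, the equations for the parameters can be solved one after the other
  (\<open>recover_composite_jet\<close>): \<open>g\<^sub>w\<close> and the determinant of \<open>f\<^sub>z\<close> and \<open>f\<^sub>z\<^sub>z\<close> give \<open>\<lambda>\<close> and \<open>\<lambda>'\<close>; the Hermitian
  product and the determinant with \<open>f\<^sub>z\<close> remove the matrix \<open>U'\<close> up to the phase \<open>u\<close>; \<open>f\<^sub>w\<close> and \<open>f\<^sub>z\<^sub>w\<close> give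
  \<open>c\<close> and \<open>c'\<close>; \<open>f\<^sub>w\<^sub>w\<close> gives \<open>s/u\<close> and \<open>b/u\<^sup>2\<close>, hence \<open>u\<close>, as \<open>s > 0\<close>; finally \<open>g\<^sub>w\<^sub>w\<close> gives \<open>r + \<lambda>\<^sup>2r'\<close> and
  \<open>f\<^sub>z\<^sub>z\<^sub>w\<close> separates \<open>r\<close> from \<open>r'\<close>. All formulas are continuous. That the jet in turn depends
  continuously on the parameters follows from the rationality of the maps
  (\<open>rational_family_fold_partial\<close>).
\<close>

section \<open>Families of rational functions and their partial derivatives\<close>

text \<open>Rational functions of the variable, regular at the origin, with coefficients depending
  continuously on a parameter in \<open>S\<close>. The class is closed under partial derivatives, and values at
  the origin are continuous in the parameter; so all Taylor coefficients at the origin are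
  continuous in the parameter, without computing them. The last rule makes the class one of germs,
  which is needed because partial derivatives are rational only near the origin.\<close>

inductive rational_family ::
    "'p::topological_space set \<Rightarrow> ('p \<Rightarrow> complex^'n \<Rightarrow> complex) \<Rightarrow> bool" for S where
  rational_family_const: "continuous_on S k \<Longrightarrow> rational_family S (\<lambda>p x. k p)"
| rational_family_nth: "rational_family S (\<lambda>p x. x $ i)"
| rational_family_add: "rational_family S f \<Longrightarrow> rational_family S g \<Longrightarrow>
    rational_family S (\<lambda>p x. f p x + g p x)"
| rational_family_mult: "rational_family S f \<Longrightarrow> rational_family S g \<Longrightarrow>
    rational_family S (\<lambda>p x. f p x * g p x)"
| rational_family_inverse: "rational_family S f \<Longrightarrow> (\<And>p. p \<in> S \<Longrightarrow> f p 0 \<noteq> 0) \<Longrightarrow>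
    rational_family S (\<lambda>p x. inverse (f p x))"
| rational_family_cong: "rational_family S f \<Longrightarrow>
    (\<And>p. p \<in> S \<Longrightarrow> \<forall>\<^sub>F x in nhds 0. g p x = f p x) \<Longrightarrow> rational_family S g"

lemma rational_family_uminus:
  assumes "rational_family S f" shows "rational_family S (\<lambda>p x. - f p x)"
  using rational_family_mult[OF rational_family_const[of S "\<lambda>_. -1"] assms] by simp

lemma rational_family_diff:
  assumes "rational_family S f" "rational_family S g"
  shows "rational_family S (\<lambda>p x. f p x - g p x)"
  using rational_family_add[OF assms(1) rational_family_uminus[OF assms(2)]] by simp

lemma rational_family_power:
  assumes "rational_family S f" shows "rational_family S (\<lambda>p x. f p x ^ n)"
  by (induction n) (auto intro: rational_family_mult assms rational_family_const)

lemma rational_family_divide: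
  assumes "rational_family S f" "rational_family S g" "\<And>p. p \<in> S \<Longrightarrow> g p 0 \<noteq> 0"
  shows "rational_family S (\<lambda>p x. f p x / g p x)"
  using rational_family_mult[OF assms(1) rational_family_inverse[OF assms(2,3)]]
  by (simp add: divide_inverse)

lemma isCont_cong_eventually:
  fixes f g :: "'a::t2_space \<Rightarrow> 'b::topological_space"
  assumes "\<forall>\<^sub>F x in nhds a. g x = f x" "isCont f a"
  shows "isCont g a"
  using assms isCont_cong by blast

lemma rational_family_isCont:
  assumes "rational_family S f" "p \<in> S" shows "isCont (f p) 0"
  using assms
proof induction
  case (rational_family_cong f g)
  then show ?case by (intro isCont_cong_eventually[of "g p" "f p"]) auto
qed (auto intro!: continuous_intros)

lemma rational_family_at0:
  assumes "rational_family S f" shows "continuous_on S (\<lambda>p. f p 0)"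
  using assms
proof induction
  case (rational_family_cong f g)
  then have "g p 0 = f p 0" if "p \<in> S" for p
    using eventually_nhds_x_imp_x that by blast
  then show ?case using rational_family_cong by (simp cong: continuous_on_cong)
qed (auto intro!: continuous_intros)

lemma axis_path_tendsto: "((\<lambda>t. y + axis i t) \<longlongrightarrow> y) (nhds (0::complex))"
  for y :: "complex^'n"
proof -
  have "continuous_on UNIV (\<lambda>t. y + axis i t)"
  proof -
    have eq: "(\<lambda>t. y + axis i t) = (\<lambda>t. \<chi> j. y $ j + (if j = i then t else 0))"
      by (auto simp: vec_eq_iff axis_def)
    have cont: "continuous_on UNIV (\<lambda>t. \<chi> j. y $ j + (if j = i then t else 0))"
    proof (intro continuous_on_vec_lambda)
      fix j
      show "continuous_on UNIV (\<lambda>t. y $ j + (if j = i then t else 0))"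
        by (cases "j = i") (auto intro!: continuous_intros)
    qed
    show ?thesis by (subst eq) (rule cont)
  qed
  then have "isCont (\<lambda>t. y + axis i t) 0" by (simp add: continuous_on_eq_continuous_at)
  then have "((\<lambda>t. y + axis i t) \<longlongrightarrow> y + axis i 0) (nhds 0)"
    using tendsto_at_iff_tendsto_nhds[THEN iffD1, of "\<lambda>t. y + axis i t" 0]
    by (simp only: isCont_def)
  moreover have "y + axis i 0 = y" by (simp add: vec_eq_iff axis_def)
  ultimately show ?thesis by (simp only:)
qed

lemma rational_family_ev_nonzero:
  assumes "rational_family S f" "p \<in> S" "f p 0 \<noteq> 0"
  shows "\<forall>\<^sub>F x in nhds 0. f p x \<noteq> 0"
  using rational_family_isCont[OF assms(1,2)] assms(3)
  by (metis tendsto_imp_eventually_ne isCont_def tendsto_at_iff_tendsto_nhds)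

text \<open>The derivative is built along the rules of the class. Existence is claimed on a neighbourhood of
  the origin, since higher derivatives are taken next.\<close>
lemma rational_family_has_partial:
  fixes f :: "'p::topological_space \<Rightarrow> complex^'n \<Rightarrow> complex" and i :: 'n
  assumes "rational_family S f"
  shows "\<exists>g. rational_family S g \<and>
    (\<forall>p\<in>S. \<forall>\<^sub>F x in nhds 0. ((\<lambda>t. f p (x + axis i t)) has_field_derivative g p x) (at 0))"
  using assms
proof induction
  case (rational_family_const k)
  have "rational_family S (\<lambda>p (x::complex^'n). 0)"
    by (rule rational_family.rational_family_const) simp
  then show ?case by (intro exI[of _ "\<lambda>p x. 0"]) auto
next
  case (rational_family_nth j)
  have "rational_family S (\<lambda>p (x::complex^'n). (if i = j then 1 else 0))"
    by (rule rational_family.rational_family_const) simp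
  then show ?case
    by (intro exI[of _ "\<lambda>p x. if i = j then 1 else 0"])
       (auto simp: axis_def intro!: always_eventually derivative_eq_intros)
next
  case (rational_family_add f g)
  then obtain f' g' where *: "rational_family S f'" "rational_family S g'"
    "\<forall>p\<in>S. \<forall>\<^sub>F x in nhds 0. ((\<lambda>t. f p (x + axis i t)) has_field_derivative f' p x) (at 0)"
    "\<forall>p\<in>S. \<forall>\<^sub>F x in nhds 0. ((\<lambda>t. g p (x + axis i t)) has_field_derivative g' p x) (at 0)"
    by blast
  show ?case
  proof (intro exI[of _ "\<lambda>p x. f' p x + g' p x"] conjI rational_family.rational_family_add * ballI)
    fix p assume p: "p \<in> S"
    from bspec[OF *(3) p] bspec[OF *(4) p]
    show "\<forall>\<^sub>F x in nhds 0. ((\<lambda>t. f p (x + axis i t) + g p (x + axis i t))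
        has_field_derivative f' p x + g' p x) (at 0)"
      by eventually_elim (rule DERIV_add)
  qed
next
  case (rational_family_mult f g)
  then obtain f' g' where *: "rational_family S f'" "rational_family S g'"
    "\<forall>p\<in>S. \<forall>\<^sub>F x in nhds 0. ((\<lambda>t. f p (x + axis i t)) has_field_derivative f' p x) (at 0)"
    "\<forall>p\<in>S. \<forall>\<^sub>F x in nhds 0. ((\<lambda>t. g p (x + axis i t)) has_field_derivative g' p x) (at 0)"
    by blast
  have ax: "x + axis i (0::complex) = x" for x :: "complex^'n" by (simp add: vec_eq_iff axis_def)
  show ?case
  proof (intro exI[of _ "\<lambda>p x. f' p x * g p x + g' p x * f p x"] conjI ballI)
    show "rational_family S (\<lambda>p x. f' p x * g p x + g' p x * f p x)"
      using rational_family.rational_family_add[OF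
          rational_family.rational_family_mult[OF *(1) rational_family_mult(2)]
          rational_family.rational_family_mult[OF *(2) rational_family_mult(1)]] .
    fix p assume p: "p \<in> S"
    from bspec[OF *(3) p] bspec[OF *(4) p]
    show "\<forall>\<^sub>F x in nhds 0. ((\<lambda>t. f p (x + axis i t) * g p (x + axis i t))
        has_field_derivative f' p x * g p x + g' p x * f p x) (at 0)"
    proof eventually_elim
      case (elim x)
      from DERIV_mult[OF elim] show ?case by (simp only: ax)
    qed
  qed
next
  case (rational_family_inverse f)
  then obtain f' where *: "rational_family S f'"
    "\<forall>p\<in>S. \<forall>\<^sub>F x in nhds 0. ((\<lambda>t. f p (x + axis i t)) has_field_derivative f' p x) (at 0)"
    by blast
  have ax: "x + axis i (0::complex) = x" for x :: "complex^'n" by (simp add: vec_eq_iff axis_def)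
  show ?case
  proof (intro exI[of _ "\<lambda>p x. - (inverse (f p x) * f' p x * inverse (f p x))"] conjI ballI)
    show "rational_family S (\<lambda>p x. - (inverse (f p x) * f' p x * inverse (f p x)))"
    proof -
      have "rational_family S (\<lambda>p x. inverse (f p x))"
        using rational_family_inverse by (intro rational_family.rational_family_inverse) auto
      from rational_family.rational_family_mult[OF rational_family.rational_family_mult[OF this *(1)] this]
      show ?thesis by (rule rational_family_uminus)
    qed
    fix p assume p: "p \<in> S"
    from bspec[OF *(2) p] rational_family_ev_nonzero[OF rational_family_inverse(1) p
        rational_family_inverse(2)[OF p]]
    show "\<forall>\<^sub>F x in nhds 0. ((\<lambda>t. inverse (f p (x + axis i t)))
        has_field_derivative - (inverse (f p x) * f' p x * inverse (f p x))) (at 0)"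
    proof eventually_elim
      case (elim x)
      have "f p (x + axis i 0) \<noteq> 0" using elim(2) by (simp only: ax) simp
      from DERIV_inverse'[OF elim(1) this] show ?case by (simp only: ax)
    qed
  qed
next
  case (rational_family_cong f g)
  then obtain f' where *: "rational_family S f'"
    "\<forall>p\<in>S. \<forall>\<^sub>F x in nhds 0. ((\<lambda>t. f p (x + axis i t)) has_field_derivative f' p x) (at 0)"
    by blast
  show ?case
  proof (intro exI[of _ f'] conjI ballI * )
    fix p assume p: "p \<in> S"
    have "\<forall>\<^sub>F y in nhds 0. \<forall>\<^sub>F x in nhds y. g p x = f p x"
      using rational_family_cong(2)[OF p] by (simp add: eventually_eventually)
    with bspec[OF *(2) p]
    show "\<forall>\<^sub>F x in nhds 0. ((\<lambda>t. g p (x + axis i t)) has_field_derivative f' p x) (at 0)"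
    proof eventually_elim
      case (elim y)
      have "\<forall>\<^sub>F t in nhds 0. g p (y + axis i t) = f p (y + axis i t)"
        using elim(2) axis_path_tendsto[of y i] by (auto simp: filterlim_iff)
      then show ?case using elim(1) by (simp add: DERIV_cong_ev)
    qed
  qed
qed

lemma rational_family_partial_derivative:
  assumes "rational_family S f" "p \<in> S"
  shows "\<forall>\<^sub>F x in nhds 0.
    ((\<lambda>t. f p (x + axis i t)) has_field_derivative complex_partial i (f p) x) (at 0)"
proof -
  obtain g where "\<forall>\<^sub>F x in nhds 0. ((\<lambda>t. f p (x + axis i t)) has_field_derivative g p x) (at 0)"
    using rational_family_has_partial[OF assms(1)] assms(2) by blast
  then show ?thesis
    by eventually_elim (simp add: complex_partial_def DERIV_imp_deriv)
qed

lemma rational_family_complex_partial: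
  assumes "rational_family S f"
  shows "rational_family S (\<lambda>p. complex_partial i (f p))"
proof -
  obtain g where g: "rational_family S g"
    "\<forall>p\<in>S. \<forall>\<^sub>F x in nhds 0. ((\<lambda>t. f p (x + axis i t)) has_field_derivative g p x) (at 0)"
    using rational_family_has_partial[OF assms(1)] by blast
  show ?thesis
  proof (rule rational_family_cong[OF g(1)])
    fix p assume "p \<in> S"
    from bspec[OF g(2) this] show "\<forall>\<^sub>F x in nhds 0. complex_partial i (f p) x = g p x"
      by eventually_elim (auto simp: complex_partial_def dest: DERIV_imp_deriv)
  qed
qed

lemma rational_family_fold_partial:
  assumes "rational_family S f"
  shows "rational_family S (\<lambda>p. fold complex_partial d (f p))"
  using assms
proof (induction d arbitrary: f)
  case (Cons i d)
  from Cons.IH[OF rational_family_complex_partial[OF Cons.prems]] show ?case by simp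
qed simp

text \<open>A single function is a family over a one-point parameter space, here \<open>{0}\<close>.\<close>
definition rational_germ :: "(complex^'n \<Rightarrow> complex) \<Rightarrow> bool" where
  "rational_germ f \<longleftrightarrow> rational_family {0::real} (\<lambda>_. f)"

lemma rational_germ_const: "rational_germ (\<lambda>x. k)"
  and rational_germ_nth: "rational_germ (\<lambda>x. x $ i)"
  and rational_germ_add: "rational_germ f \<Longrightarrow> rational_germ g \<Longrightarrow> rational_germ (\<lambda>x. f x + g x)"
  and rational_germ_diff: "rational_germ f \<Longrightarrow> rational_germ g \<Longrightarrow> rational_germ (\<lambda>x. f x - g x)"
  and rational_germ_uminus: "rational_germ f \<Longrightarrow> rational_germ (\<lambda>x. - f x)"
  and rational_germ_mult: "rational_germ f \<Longrightarrow> rational_germ g \<Longrightarrow> rational_germ (\<lambda>x. f x * g x)"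
  and rational_germ_power: "rational_germ f \<Longrightarrow> rational_germ (\<lambda>x. f x ^ n)"
  and rational_germ_divide: "rational_germ f \<Longrightarrow> rational_germ g \<Longrightarrow> g 0 \<noteq> 0 \<Longrightarrow>
        rational_germ (\<lambda>x. f x / g x)"
  and rational_germ_partial: "rational_germ f \<Longrightarrow> rational_germ (complex_partial i f)"
  unfolding rational_germ_def
  by (rule rational_family_const rational_family_nth rational_family_add rational_family_diff
      rational_family_uminus rational_family_mult rational_family_power rational_family_divide
      rational_family_complex_partial; simp)+

lemmas rational_germ_intros = rational_germ_const rational_germ_nth rational_germ_add
  rational_germ_diff rational_germ_uminus rational_germ_mult rational_germ_power rational_germ_partial

lemma rational_germ_partial_derivative:
  assumes "rational_germ f"
  shows "\<forall>\<^sub>F x in nhds 0.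
    ((\<lambda>t. f (x + axis i t)) has_field_derivative complex_partial i f x) (at 0)"
  using rational_family_partial_derivative[OF assms[unfolded rational_germ_def]] by simp

lemma complex_partial_add:
  assumes "rational_germ f" "rational_germ g"
  shows "\<forall>\<^sub>F x in nhds 0. complex_partial i (\<lambda>x. f x + g x) x =
    complex_partial i f x + complex_partial i g x"
  using rational_germ_partial_derivative[OF assms(1)] rational_germ_partial_derivative[OF assms(2)]
  by eventually_elim (subst complex_partial_def, rule DERIV_imp_deriv, rule DERIV_add)

lemma complex_partial_mult:
  assumes "rational_germ f" "rational_germ g"
  shows "\<forall>\<^sub>F x in nhds 0. complex_partial i (\<lambda>x. f x * g x) x =
    complex_partial i f x * g x + complex_partial i g x * f x"
  using rational_germ_partial_derivative[OF assms(1), of i]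
    rational_germ_partial_derivative[OF assms(2), of i]
proof eventually_elim
  case (elim x)
  have ax: "x + axis i (0::complex) = x" by (simp add: vec_eq_iff axis_def)
  from DERIV_mult[OF elim] show ?case
    by (subst complex_partial_def, intro DERIV_imp_deriv) (simp add: ax)
qed

lemma complex_partial_const: "complex_partial i (\<lambda>x. k) = (\<lambda>x. 0)"
  by (simp add: complex_partial_def fun_eq_iff)

lemma complex_partial_nth: "complex_partial (i :: 'n::finite) (\<lambda>x. x $ j) = (\<lambda>x. if i = j then 1 else 0)"
proof
  fix x :: "complex^'n"
  have "((\<lambda>t. (x + axis i t) $ j) has_field_derivative (if i = j then 1 else 0)) (at 0)"
    by (auto simp: axis_def intro!: derivative_eq_intros)
  then show "complex_partial i (\<lambda>x. x $ j) x = (if i = j then 1 else 0)"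
    by (simp add: complex_partial_def DERIV_imp_deriv)
qed

lemma complex_partial_add_cong:
  assumes "rational_germ f" "rational_germ g"
    and "\<forall>\<^sub>F x in nhds (0::complex^'n). h x = f x + g x"
  shows "\<forall>\<^sub>F x in nhds 0. complex_partial i h x = complex_partial i f x + complex_partial i g x"
  using eventually_complex_partial_eq[OF assms(3), of i] complex_partial_add[OF assms(1,2), of i]
  by eventually_elim simp

lemma complex_partial_mult_twice:
  assumes f: "rational_germ f" and g: "rational_germ g"
  shows "\<forall>\<^sub>F x in nhds (0::complex^'n). complex_partial j (complex_partial i (\<lambda>x. f x * g x)) x =
    (complex_partial j (complex_partial i f) x * g x + complex_partial j g x * complex_partial i f x) +
    (complex_partial j (complex_partial i g) x * f x + complex_partial j f x * complex_partial i g x)"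
proof -
  note f' = rational_germ_partial[OF f, of i] and g' = rational_germ_partial[OF g, of i]
  from complex_partial_add_cong[OF rational_germ_mult[OF f' g] rational_germ_mult[OF g' f]
      complex_partial_mult[OF f g], of j]
    complex_partial_mult[OF f' g, of j] complex_partial_mult[OF g' f, of j]
  show ?thesis by eventually_elim simp
qed

section \<open>Truncated jets\<close>

text \<open>The ring \<open>\<complex>[z,w]/(z\<^sup>3, zw\<^sup>2, w\<^sup>3)\<close>, with basis \<open>1, z, w, z\<^sup>2, zw, w\<^sup>2, z\<^sup>2w\<close> in the order of
  the selectors. These monomials are closed under divisors and contain all those that occur in
  \<open>jet0\<close>, so sums, products and quotients of functions can be computed on these seven coefficients
  alone.\<close>

datatype tjet = TJ (j00: complex) (j10: complex) (j01: complex) (j20: complex) (j11: complex)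
  (j02: complex) (j21: complex)

instantiation tjet :: comm_ring_1
begin
definition "0 = TJ 0 0 0 0 0 0 0"
definition "1 = TJ 1 0 0 0 0 0 0"
definition "a + b = TJ (j00 a + j00 b) (j10 a + j10 b) (j01 a + j01 b) (j20 a + j20 b)
  (j11 a + j11 b) (j02 a + j02 b) (j21 a + j21 b)"
definition "a - b = TJ (j00 a - j00 b) (j10 a - j10 b) (j01 a - j01 b) (j20 a - j20 b)
  (j11 a - j11 b) (j02 a - j02 b) (j21 a - j21 b)"
definition "- a = TJ (- j00 a) (- j10 a) (- j01 a) (- j20 a) (- j11 a) (- j02 a) (- j21 a)"
definition "a * b = TJ (j00 a * j00 b) (j00 a * j10 b + j10 a * j00 b)
  (j00 a * j01 b + j01 a * j00 b)
  (j00 a * j20 b + j10 a * j10 b + j20 a * j00 b)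
  (j00 a * j11 b + j10 a * j01 b + j01 a * j10 b + j11 a * j00 b)
  (j00 a * j02 b + j01 a * j01 b + j02 a * j00 b)
  (j00 a * j21 b + j10 a * j11 b + j01 a * j20 b + j20 a * j01 b + j11 a * j10 b + j21 a * j00 b)"
instance
  by standard
    (auto simp: zero_tjet_def one_tjet_def plus_tjet_def minus_tjet_def uminus_tjet_def
      times_tjet_def tjet.expand algebra_simps)
end

lemmas tjet_ops = zero_tjet_def one_tjet_def plus_tjet_def minus_tjet_def uminus_tjet_def
  times_tjet_def

definition jconst :: "complex \<Rightarrow> tjet" where "jconst k = TJ k 0 0 0 0 0 0"

text \<open>The factors \<open>1/2\<close> turn derivatives into Taylor coefficients, so that \<open>trunc_jet\<close> is a ring
  homomorphism on rational germs.\<close>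

definition trunc_jet :: "(complex^2 \<Rightarrow> complex) \<Rightarrow> tjet" where
  "trunc_jet h = TJ (h 0) (fold complex_partial [1] h 0) (fold complex_partial [2] h 0)
    (fold complex_partial [1,1] h 0 / 2) (fold complex_partial [1,2] h 0)
    (fold complex_partial [2,2] h 0 / 2) (fold complex_partial [1,1,2] h 0 / 2)"

lemma trunc_jet_cong:
  assumes "\<forall>\<^sub>F x in nhds 0. f x = g x" shows "trunc_jet f = trunc_jet g"
proof -
  have "fold complex_partial d f 0 = fold complex_partial d g 0" for d
  proof -
    have "\<forall>\<^sub>F x in nhds 0. fold complex_partial d u x = fold complex_partial d v x"
      if "\<forall>\<^sub>F x in nhds 0. u x = v x" for u v :: "complex^2 \<Rightarrow> complex"
      using that
    proof (induction d arbitrary: u v)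
      case (Cons i d)
      from Cons.IH[OF eventually_complex_partial_eq[OF Cons.prems]] show ?case by simp
    qed simp
    from eventually_nhds_x_imp_x[OF this[OF assms]] show ?thesis .
  qed
  moreover have "f 0 = g 0" using eventually_nhds_x_imp_x[OF assms] .
  ultimately show ?thesis by (simp only: trunc_jet_def)
qed

lemma trunc_jet_const: "trunc_jet (\<lambda>x. k) = jconst k"
  by (simp add: trunc_jet_def jconst_def complex_partial_const)

lemma trunc_jet_nth: "trunc_jet (\<lambda>x. x $ 1) = TJ 0 1 0 0 0 0 0" "trunc_jet (\<lambda>x. x $ 2) = TJ 0 0 1 0 0 0 0"
  by (simp_all add: trunc_jet_def complex_partial_nth complex_partial_const)

lemma trunc_jet_mult:
  assumes f: "rational_germ f" and g: "rational_germ g"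
  shows "trunc_jet (\<lambda>x. f x * g x) = trunc_jet f * trunc_jet g"
proof -
  note f1 = rational_germ_partial[OF f, of 1] and g1 = rational_germ_partial[OF g, of 1]
  note f11 = rational_germ_partial[OF f1, of 1] and g11 = rational_germ_partial[OF g1, of 1]
  let ?h = "\<lambda>x. f x * g x"
  have 1: "complex_partial i ?h 0 = complex_partial i f 0 * g 0 + complex_partial i g 0 * f 0" for i
    by (rule eventually_nhds_x_imp_x[OF complex_partial_mult[OF f g]])
  note 2 = eventually_nhds_x_imp_x[OF complex_partial_mult_twice[OF f g]]
  have "\<forall>\<^sub>F x in nhds 0. complex_partial 2 (complex_partial 1 (complex_partial 1 ?h)) x =
    complex_partial 2 (\<lambda>x. (complex_partial 1 (complex_partial 1 f) x * g x +
        complex_partial 1 g x * complex_partial 1 f x) +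
      (complex_partial 1 (complex_partial 1 g) x * f x +
        complex_partial 1 f x * complex_partial 1 g x)) x"
    by (intro eventually_complex_partial_eq complex_partial_mult_twice f g)
  moreover note complex_partial_add[OF
      rational_germ_add[OF rational_germ_mult[OF f11 g] rational_germ_mult[OF g1 f1]]
      rational_germ_add[OF rational_germ_mult[OF g11 f] rational_germ_mult[OF f1 g1]], of 2]
    complex_partial_add[OF rational_germ_mult[OF f11 g] rational_germ_mult[OF g1 f1], of 2]
    complex_partial_add[OF rational_germ_mult[OF g11 f] rational_germ_mult[OF f1 g1], of 2]
    complex_partial_mult[OF f11 g, of 2] complex_partial_mult[OF g1 f1, of 2]
    complex_partial_mult[OF g11 f, of 2] complex_partial_mult[OF f1 g1, of 2]
  ultimately have "\<forall>\<^sub>F x in nhds 0.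
    complex_partial 2 (complex_partial 1 (complex_partial 1 ?h)) x =
      complex_partial 2 (complex_partial 1 (complex_partial 1 f)) x * g x
      + complex_partial 2 g x * complex_partial 1 (complex_partial 1 f) x
      + 2 * (complex_partial 2 (complex_partial 1 g) x * complex_partial 1 f x
        + complex_partial 2 (complex_partial 1 f) x * complex_partial 1 g x)
      + complex_partial 2 (complex_partial 1 (complex_partial 1 g)) x * f x
      + complex_partial 2 f x * complex_partial 1 (complex_partial 1 g) x"
    by eventually_elim (simp add: algebra_simps)
  note 3 = eventually_nhds_x_imp_x[OF this]
  show ?thesis
    by (simp add: trunc_jet_def times_tjet_def 1 2 3 field_simps)
qed

lemma trunc_jet_add:
  assumes f: "rational_germ f" and g: "rational_germ g"
  shows "trunc_jet (\<lambda>x. f x + g x) = trunc_jet f + trunc_jet g"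
proof -
  have 0: "\<forall>\<^sub>F x in nhds 0. fold complex_partial d (\<lambda>x. f x + g x) x =
    fold complex_partial d f x + fold complex_partial d g x" for d
  proof (induction d rule: rev_induct)
    case (snoc i d)
    have r: "rational_germ (fold complex_partial d u)" if "rational_germ u" for u :: "complex^2 \<Rightarrow> complex"
      using rational_family_fold_partial[of "{0::real}" "\<lambda>_. u" d] that
      by (simp add: rational_germ_def)
    from complex_partial_add_cong[OF r[OF f] r[OF g] snoc.IH, of i] show ?case by simp
  qed simp
  note eventually_nhds_x_imp_x[OF this]
  then show ?thesis
    by (simp only: trunc_jet_def plus_tjet_def tjet.sel add_divide_distrib)
qed

definition has_jet :: "(complex^2 \<Rightarrow> complex) \<Rightarrow> tjet \<Rightarrow> bool" where
  "has_jet h j \<longleftrightarrow> rational_germ h \<and> trunc_jet h = j"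

lemma has_jet_const: "has_jet (\<lambda>x. k) (jconst k)"
  and has_jet_nth: "has_jet (\<lambda>x. x $ 1) (TJ 0 1 0 0 0 0 0)" "has_jet (\<lambda>x. x $ 2) (TJ 0 0 1 0 0 0 0)"
  by (simp_all add: has_jet_def rational_germ_intros trunc_jet_const trunc_jet_nth)

lemma has_jet_add: "has_jet f a \<Longrightarrow> has_jet g b \<Longrightarrow> has_jet (\<lambda>x. f x + g x) (a + b)"
  and has_jet_mult: "has_jet f a \<Longrightarrow> has_jet g b \<Longrightarrow> has_jet (\<lambda>x. f x * g x) (a * b)"
  by (auto simp: has_jet_def rational_germ_intros trunc_jet_add trunc_jet_mult)

lemma has_jet_uminus: "has_jet f a \<Longrightarrow> has_jet (\<lambda>x. - f x) (- a)"
  using has_jet_mult[OF has_jet_const[of "-1"], of f a]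
  by (simp add: jconst_def tjet_ops)

lemma has_jet_diff: "has_jet f a \<Longrightarrow> has_jet g b \<Longrightarrow> has_jet (\<lambda>x. f x - g x) (a - b)"
  using has_jet_add[of f a "\<lambda>x. - g x" "- b"] has_jet_uminus[of g b] by simp

lemma has_jet_power: "has_jet f a \<Longrightarrow> has_jet (\<lambda>x. f x ^ n) (a ^ n)"
proof (induction n)
  case 0
  show ?case using has_jet_const[of 1] by (simp add: jconst_def tjet_ops)
next
  case (Suc n)
  from has_jet_mult[OF Suc.prems Suc.IH[OF Suc.prems]] show ?case by simp
qed

lemma tjet_mult_cancel_right:
  assumes "a * c = b * c" "j00 c \<noteq> 0" shows "a = b"
proof -
  have "(a - b) * c = 0" using assms(1) by (simp add: algebra_simps)
  with assms(2) have "a - b = 0"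
    by (auto simp: tjet_ops tjet.expand)
  then show ?thesis by simp
qed

text \<open>A quotient is computed by guessing its jet and checking a product: a jet with nonzero constant
  term can be cancelled.\<close>

lemma has_jet_divide:
  assumes "has_jet f a" "has_jet g b" "j00 b \<noteq> 0" "c * b = a"
  shows "has_jet (\<lambda>x. f x / g x) c"
proof -
  have g0: "g 0 \<noteq> 0" using assms(2,3) by (auto simp: has_jet_def trunc_jet_def)
  have r: "rational_germ (\<lambda>x. f x / g x)"
    using assms g0 by (auto simp: has_jet_def intro: rational_germ_divide)
  have "\<forall>\<^sub>F x in nhds 0. g x \<noteq> 0"
    using rational_family_ev_nonzero[of "{0}" "\<lambda>_::real. g" 0] assms(2) g0
    by (simp add: has_jet_def rational_germ_def)
  then have "trunc_jet (\<lambda>x. f x / g x * g x) = trunc_jet f"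
    by (intro trunc_jet_cong) (auto elim: eventually_mono)
  with trunc_jet_mult[OF r, of g] assms have "trunc_jet (\<lambda>x. f x / g x) * b = c * b"
    by (simp only: has_jet_def)
  then have "trunc_jet (\<lambda>x. f x / g x) = c" using assms(3) by (rule tjet_mult_cancel_right)
  with r show ?thesis by (simp add: has_jet_def)
qed

lemmas has_jet_intros = has_jet_const has_jet_nth has_jet_add has_jet_diff has_jet_uminus
  has_jet_mult has_jet_power

lemma tjet_mult_TJ:
  "TJ a0 a1 a2 a3 a4 a5 a6 * TJ b0 b1 b2 b3 b4 b5 b6 = TJ (a0 * b0) (a0 * b1 + a1 * b0) (a0 * b2 + a2 * b0)
    (a0 * b3 + a1 * b1 + a3 * b0) (a0 * b4 + a1 * b2 + a2 * b1 + a4 * b0) (a0 * b5 + a2 * b2 + a5 * b0)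
    (a0 * b6 + a1 * b4 + a2 * b3 + a3 * b2 + a4 * b1 + a6 * b0)"
  by (simp add: times_tjet_def)

lemma tjet_linear_TJ:
  "TJ a0 a1 a2 a3 a4 a5 a6 + TJ b0 b1 b2 b3 b4 b5 b6 =
    TJ (a0 + b0) (a1 + b1) (a2 + b2) (a3 + b3) (a4 + b4) (a5 + b5) (a6 + b6)"
  "TJ a0 a1 a2 a3 a4 a5 a6 - TJ b0 b1 b2 b3 b4 b5 b6 =
    TJ (a0 - b0) (a1 - b1) (a2 - b2) (a3 - b3) (a4 - b4) (a5 - b5) (a6 - b6)"
  "- TJ a0 a1 a2 a3 a4 a5 a6 = TJ (- a0) (- a1) (- a2) (- a3) (- a4) (- a5) (- a6)"
  by (simp_all add: tjet_ops)

lemmas tjet_simps = tjet_mult_TJ tjet_linear_TJ jconst_def power2_eq_square power3_eq_cube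

lemma has_jet_sigma_map:
  fixes l r :: real and u c k e :: complex
  defines "k \<equiv> 2 * \<i> * cnj c" and "e \<equiv> complex_of_real r - \<i> * complex_of_real ((cmod c)\<^sup>2)"
  shows "has_jet (\<lambda>x. sigma_map (l, r, u, c) x $ 1)
      (TJ 0 (l * u) (l * u * c) (k * l * u) (l * u * (k * c - e)) (- (e * l * u * c)) (l * u * k * (k * c - 2 * e)))"
    and "has_jet (\<lambda>x. sigma_map (l, r, u, c) x $ 2)
      (TJ 0 0 (l\<^sup>2) 0 (k * l\<^sup>2) (- (e * l\<^sup>2)) (k\<^sup>2 * l\<^sup>2))"
proof -
  have d: "has_jet (\<lambda>x. 1 - k * x $ 1 + e * x $ 2) (TJ 1 (- k) e 0 0 0 0)" (is "has_jet _ ?d")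
  proof -
    have "has_jet (\<lambda>x. 1 - k * x $ 1 + e * x $ 2)
      (jconst 1 - jconst k * TJ 0 1 0 0 0 0 0 + jconst e * TJ 0 0 1 0 0 0 0)"
      by (intro has_jet_intros)
    then show ?thesis by (simp add: tjet_simps)
  qed
  have n1: "has_jet (\<lambda>x. of_real l * u * (x $ 1 + c * x $ 2)) (TJ 0 (l * u) (l * u * c) 0 0 0 0)"
  proof -
    have "has_jet (\<lambda>x. of_real l * u * (x $ 1 + c * x $ 2))
      (jconst (of_real l * u) * (TJ 0 1 0 0 0 0 0 + jconst c * TJ 0 0 1 0 0 0 0))"
      by (intro has_jet_intros)
    then show ?thesis by (simp add: tjet_simps)
  qed
  have n2: "has_jet (\<lambda>x. (of_real l)\<^sup>2 * x $ 2) (TJ 0 0 (l\<^sup>2) 0 0 0 0)"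
  proof -
    have "has_jet (\<lambda>x. (of_real l)\<^sup>2 * x $ 2) (jconst ((of_real l)\<^sup>2) * TJ 0 0 1 0 0 0 0)"
      by (intro has_jet_intros)
    then show ?thesis by (simp add: tjet_simps)
  qed
  show "has_jet (\<lambda>x. sigma_map (l, r, u, c) x $ 1)
      (TJ 0 (l * u) (l * u * c) (k * l * u) (l * u * (k * c - e)) (- (e * l * u * c)) (l * u * k * (k * c - 2 * e)))"
    unfolding sigma_map_def Let_def split vector_2 k_def[symmetric] e_def[symmetric]
    by (rule has_jet_divide[OF n1 d]) (auto simp: tjet_simps algebra_simps)
  show "has_jet (\<lambda>x. sigma_map (l, r, u, c) x $ 2)
      (TJ 0 0 (l\<^sup>2) 0 (k * l\<^sup>2) (- (e * l\<^sup>2)) (k\<^sup>2 * l\<^sup>2))"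
    unfolding sigma_map_def Let_def split vector_2 k_def[symmetric] e_def[symmetric]
    by (rule has_jet_divide[OF n2 d]) (auto simp: tjet_simps algebra_simps)
qed

section \<open>A common polynomial model of the two families\<close>

text \<open>Modulo the ideal \<open>(z\<^sup>4, z\<^sup>3w, zw\<^sup>2, w\<^sup>3)\<close> the maps \<open>G2\<close> and \<open>G3\<close> agree with this polynomial map, for
  \<open>b = s\<^sup>2/4\<close> and \<open>b = -\<epsilon>/16\<close> respectively. For the components \<open>\<tau>\<^sub>1, \<tau>\<^sub>2\<close> of an isotropy, with
  leading terms proportional to \<open>z + cw\<close> and \<open>w\<close>, the truncated jets of \<open>\<tau>\<^sub>1\<^sup>4, \<tau>\<^sub>1\<^sup>3\<tau>\<^sub>2, \<tau>\<^sub>1\<tau>\<^sub>2\<^sup>2\<close> and \<open>\<tau>\<^sub>2\<^sup>3\<close>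
  vanish, whereas that of \<open>\<tau>\<^sub>1\<^sup>3\<close> can contain \<open>z\<^sup>2w\<close>. So both families are treated at once, with the
  parameters \<open>(s, b)\<close>.\<close>

definition G_model :: "real \<Rightarrow> real \<Rightarrow> real \<Rightarrow> complex^2 \<Rightarrow> complex^3" where
  "G_model eps s b x = (let z = x $ 1; w = x $ 2 in vector
     [z + \<i> * eps / 2 * (z * w) + s / 4 * (w * w) + \<i> * s * (z * z * w),
      z * z + b * (w * w) + \<i> * (eps + 4 * b) / 4 * (z * z * w) + eps * s * (z * z * z),
      w])"

definition model_jet :: "real \<Rightarrow> real \<Rightarrow> real \<Rightarrow> 3 \<Rightarrow> tjet \<Rightarrow> tjet \<Rightarrow> tjet" where
  "model_jet eps s b k A B = (if k = 1 then
       A + jconst (\<i> * eps / 2) * (A * B) + jconst (s / 4) * (B * B) + jconst (\<i> * s) * (A * A * B)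
     else if k = 2 then
       A * A + jconst b * (B * B) + jconst (\<i> * (eps + 4 * b) / 4) * (A * A * B)
       + jconst (eps * s) * (A * A * A)
     else B)"

lemma has_jet_eqI: "has_jet h a \<Longrightarrow> a = b \<Longrightarrow> has_jet h b"
  by simp

lemma has_jet_G_model:
  assumes "has_jet (\<lambda>x. y x $ 1) A" "has_jet (\<lambda>x. y x $ 2) B"
  shows "has_jet (\<lambda>x. G_model eps s b (y x) $ k) (model_jet eps s b k A B)"
proof -
  have three: "k = 1 \<or> k = 2 \<or> k = 3" by (rule exhaust_3)
  have 1: "has_jet (\<lambda>x. G_model eps s b (y x) $ 1) (model_jet eps s b 1 A B)"
    unfolding G_model_def model_jet_def Let_def vector_3 simp_thms if_True
    by (rule has_jet_eqI, (rule has_jet_intros assms)+) simp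
  have 2: "has_jet (\<lambda>x. G_model eps s b (y x) $ 2) (model_jet eps s b 2 A B)"
    unfolding G_model_def Let_def vector_3
    by (rule has_jet_eqI, (rule has_jet_intros assms)+) (simp add: model_jet_def)
  have 3: "has_jet (\<lambda>x. G_model eps s b (y x) $ 3) (model_jet eps s b 3 A B)"
    unfolding G_model_def Let_def vector_3 using assms by (simp add: model_jet_def)
  show ?thesis using 1 2 3 three by metis
qed

text \<open>The hypotheses on the jets hold for the components of an isotropy: its second component has no
  terms in \<open>1, z, z\<^sup>2\<close>.\<close>

lemma has_jet_G2:
  assumes y: "has_jet (\<lambda>x. y x $ 1) (TJ 0 a1 a2 a3 a4 a5 a6)" "has_jet (\<lambda>x. y x $ 2) (TJ 0 0 b2 0 b4 b5 b6)"
    and eps: "eps = 1 \<or> eps = -1"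
  shows "has_jet (\<lambda>x. G2_map eps s (y x) $ k)
    (model_jet eps s (s\<^sup>2 / 4) k (TJ 0 a1 a2 a3 a4 a5 a6) (TJ 0 0 b2 0 b4 b5 b6))"
proof -
  have three: "k = 1 \<or> k = 2 \<or> k = 3" by (rule exhaust_3)
  have 1: "has_jet (\<lambda>x. G2_map eps s (y x) $ 1)
    (model_jet eps s (s\<^sup>2 / 4) 1 (TJ 0 a1 a2 a3 a4 a5 a6) (TJ 0 0 b2 0 b4 b5 b6))"
    unfolding G2_map_def Let_def vector_3
    by (rule has_jet_divide, (rule has_jet_intros y)+)
       (use eps in \<open>auto simp: tjet_simps model_jet_def field_simps\<close>)
  have 2: "has_jet (\<lambda>x. G2_map eps s (y x) $ 2)
    (model_jet eps s (s\<^sup>2 / 4) 2 (TJ 0 a1 a2 a3 a4 a5 a6) (TJ 0 0 b2 0 b4 b5 b6))"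
    unfolding G2_map_def Let_def vector_3
    by (rule has_jet_divide, (rule has_jet_intros y)+)
       (use eps in \<open>auto simp: tjet_simps model_jet_def field_simps\<close>)
  have 3: "has_jet (\<lambda>x. G2_map eps s (y x) $ 3)
    (model_jet eps s (s\<^sup>2 / 4) 3 (TJ 0 a1 a2 a3 a4 a5 a6) (TJ 0 0 b2 0 b4 b5 b6))"
    unfolding G2_map_def Let_def vector_3
    by (rule has_jet_divide, (rule has_jet_intros y)+)
       (use eps in \<open>auto simp: tjet_simps model_jet_def field_simps\<close>)
  show ?thesis using 1 2 3 three by metis
qed

lemma has_jet_G3:
  assumes y: "has_jet (\<lambda>x. y x $ 1) (TJ 0 a1 a2 a3 a4 a5 a6)" "has_jet (\<lambda>x. y x $ 2) (TJ 0 0 b2 0 b4 b5 b6)"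
    and eps: "eps = 1 \<or> eps = -1"
  shows "has_jet (\<lambda>x. G3_map eps s (y x) $ k)
    (model_jet eps s (- eps / 16) k (TJ 0 a1 a2 a3 a4 a5 a6) (TJ 0 0 b2 0 b4 b5 b6))"
proof -
  have three: "k = 1 \<or> k = 2 \<or> k = 3" by (rule exhaust_3)
  have 1: "has_jet (\<lambda>x. G3_map eps s (y x) $ 1)
    (model_jet eps s (- eps / 16) 1 (TJ 0 a1 a2 a3 a4 a5 a6) (TJ 0 0 b2 0 b4 b5 b6))"
    unfolding G3_map_def Let_def vector_3
    by (rule has_jet_divide, (rule has_jet_intros y)+)
       (use eps in \<open>auto simp: tjet_simps model_jet_def field_simps\<close>)
  have 2: "has_jet (\<lambda>x. G3_map eps s (y x) $ 2)
    (model_jet eps s (- eps / 16) 2 (TJ 0 a1 a2 a3 a4 a5 a6) (TJ 0 0 b2 0 b4 b5 b6))"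
    unfolding G3_map_def Let_def vector_3
    by (rule has_jet_divide, (rule has_jet_intros y)+)
       (use eps in \<open>auto simp: tjet_simps model_jet_def field_simps\<close>)
  have 3: "has_jet (\<lambda>x. G3_map eps s (y x) $ 3)
    (model_jet eps s (- eps / 16) 3 (TJ 0 a1 a2 a3 a4 a5 a6) (TJ 0 0 b2 0 b4 b5 b6))"
    unfolding G3_map_def Let_def vector_3
    by (rule has_jet_divide, (rule has_jet_intros y)+)
       (use eps in \<open>auto simp: tjet_simps model_jet_def field_simps\<close>)
  show ?thesis using 1 2 3 three by metis
qed

section \<open>Jets of the maps in an orbit\<close>

text \<open>The geometric series for \<open>1/(1 + n)\<close> stops after \<open>n\<^sup>3\<close>: an element without constant term has
  vanishing fourth power, as no monomial of the truncated ring has degree above 3.\<close>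

definition jinv :: "tjet \<Rightarrow> tjet" where
  "jinv d = (let n = d - 1 in 1 - n + n * n - n * n * n)"

lemma jinv: "j00 d = 1 \<Longrightarrow> jinv d * d = 1"
  by (cases d) (simp add: jinv_def Let_def tjet_ops algebra_simps)

lemma quotient_components:
  assumes "X * D = N" "j00 D = 1" "j00 N = 0"
  shows "j00 X = 0" "j10 X = j10 N" "j01 X = j01 N"
    "j20 X = j20 N - j10 X * j10 D" "j11 X = j11 N - j10 X * j01 D - j01 X * j10 D"
    "j02 X = j02 N - j01 X * j01 D"
    "j21 X = j21 N - j20 X * j01 D - j11 X * j10 D - j10 X * j11 D - j01 X * j20 D"
  using assms by (auto simp: times_tjet_def)

definition sigma'_den :: "real \<Rightarrow> params' \<Rightarrow> tjet \<Rightarrow> tjet \<Rightarrow> tjet \<Rightarrow> tjet" where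
  "sigma'_den eps = (\<lambda>(l, r, u, a, c) F1 F2 F3.
     jconst 1 - jconst (2 * \<i>) * (jconst (cnj (c $ 1)) * F1 + jconst (of_real eps * cnj (c $ 2)) * F2)
     + jconst (of_real r - \<i> * of_real ((cmod (c $ 1))\<^sup>2 + eps * (cmod (c $ 2))\<^sup>2)) * F3)"

lemma sigma'_map_explicit:
  "sigma'_map eps (l, r, u, a, c) x =
    (let \<delta> = 1 - 2 * \<i> * (cnj (c $ 1) * x $ 1 + of_real eps * cnj (c $ 2) * x $ 2)
        + (of_real r - \<i> * of_real ((cmod (c $ 1))\<^sup>2 + eps * (cmod (c $ 2))\<^sup>2)) * x $ 3
     in vector [(l * u * a $ 1 * (x $ 1 + c $ 1 * x $ 3) - l * eps * u * a $ 2 * (x $ 2 + c $ 2 * x $ 3)) / \<delta>,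
        (l * cnj (a $ 2) * (x $ 1 + c $ 1 * x $ 3) + l * cnj (a $ 1) * (x $ 2 + c $ 2 * x $ 3)) / \<delta>,
        (of_real l)\<^sup>2 * x $ 3 / \<delta>])"
  by (simp add: sigma'_map_def Let_def U_matrix_def matrix_vector_mult_def sum_2
      vec_eq_iff forall_3 algebra_simps)

lemma has_jet_sigma'_map:
  fixes eps l r :: real and u :: complex and a c :: "complex^2" and H :: "complex^2 \<Rightarrow> complex^3"
    and F :: "3 \<Rightarrow> tjet" and D :: tjet
  assumes H: "\<And>k. has_jet (\<lambda>x. H x $ k) (F k)" and F0: "\<And>k. j00 (F k) = 0"
  defines "D \<equiv> sigma'_den eps (l, r, u, a, c) (F 1) (F 2) (F 3)"
  assumes X: "X1 * D = F 1 + jconst (c $ 1) * F 3" "X2 * D = F 2 + jconst (c $ 2) * F 3" "X3 * D = F 3"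
  shows "has_jet (\<lambda>x. sigma'_map eps (l, r, u, a, c) (H x) $ 1)
      (jconst (l * u * a $ 1) * X1 - jconst (l * eps * u * a $ 2) * X2)"
    "has_jet (\<lambda>x. sigma'_map eps (l, r, u, a, c) (H x) $ 2)
      (jconst (l * cnj (a $ 2)) * X1 + jconst (l * cnj (a $ 1)) * X2)"
    "has_jet (\<lambda>x. sigma'_map eps (l, r, u, a, c) (H x) $ 3) (jconst (l\<^sup>2) * X3)"
proof -
  have den: "has_jet (\<lambda>x. 1 - 2 * \<i> * (cnj (c $ 1) * H x $ 1 + of_real eps * cnj (c $ 2) * H x $ 2)
      + (of_real r - \<i> * of_real ((cmod (c $ 1))\<^sup>2 + eps * (cmod (c $ 2))\<^sup>2)) * H x $ 3) D"
    unfolding D_def sigma'_den_def split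
    by (rule has_jet_const has_jet_add has_jet_diff has_jet_mult H)+
  have D0: "j00 D \<noteq> 0" using F0 by (simp add: D_def sigma'_den_def jconst_def tjet_ops)
  show "has_jet (\<lambda>x. sigma'_map eps (l, r, u, a, c) (H x) $ 1)
      (jconst (l * u * a $ 1) * X1 - jconst (l * eps * u * a $ 2) * X2)"
    unfolding sigma'_map_explicit Let_def vector_3
    by (rule has_jet_divide[OF _ den D0], (rule has_jet_const has_jet_add has_jet_diff has_jet_mult H)+)
       (simp only: left_diff_distrib mult.assoc X of_real_mult)
  show "has_jet (\<lambda>x. sigma'_map eps (l, r, u, a, c) (H x) $ 2)
      (jconst (l * cnj (a $ 2)) * X1 + jconst (l * cnj (a $ 1)) * X2)"
    unfolding sigma'_map_explicit Let_def vector_3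
    by (rule has_jet_divide[OF _ den D0], (rule has_jet_const has_jet_add has_jet_diff has_jet_mult H)+)
       (simp only: distrib_right mult.assoc X)
  show "has_jet (\<lambda>x. sigma'_map eps (l, r, u, a, c) (H x) $ 3) (jconst (l\<^sup>2) * X3)"
    unfolding sigma'_map_explicit Let_def vector_3
    by (rule has_jet_divide[OF _ den D0], (rule has_jet_const has_jet_mult H)+)
       (simp only: mult.assoc X of_real_power)
qed

definition source_jets :: "params \<Rightarrow> tjet \<times> tjet" where
  "source_jets = (\<lambda>(l, r, u, c).
     let k = 2 * \<i> * cnj c; e = complex_of_real r - \<i> * complex_of_real ((cmod c)\<^sup>2)
     in (TJ 0 (l * u) (l * u * c) (k * l * u) (l * u * (k * c - e)) (- (e * l * u * c))
           (l * u * k * (k * c - 2 * e)),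
         TJ 0 0 (l\<^sup>2) 0 (k * l\<^sup>2) (- (e * l\<^sup>2)) (k\<^sup>2 * l\<^sup>2)))"

text \<open>The map \<open>\<sigma>' \<circ> G \<circ> \<sigma>\<close> is \<open>\<lambda>'U'\<close> applied to \<open>(X\<^sub>1, X\<^sub>2)\<close> in its first two components and
  \<open>\<lambda>'\<^sup>2 X\<^sub>3\<close> in the last. Stating the coefficients for the \<open>X\<^sub>i\<close>, before \<open>U'\<close> mixes them, and in the
  implicit form \<open>X D = N\<close> with the denominator \<open>D\<close> of \<open>\<sigma>'\<close>, keeps the equations short. The sum
  \<open>e + D1\<close> of the \<open>w\<close>-coefficients of the two denominators occurs in all coefficients of \<open>w\<^sup>2\<close>, which is why
  second derivatives determine only the combination \<open>r + \<lambda>\<^sup>2r'\<close>; the coefficient of \<open>z\<^sup>2w\<close>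
  contains \<open>2e + D1\<close> instead and separates \<open>r\<close> from \<open>r'\<close>.\<close>

lemma composite_jet_equations:
  fixes eps l r l' r' s b :: real and u u' c k e D1 :: complex and a' c' :: "complex^2"
  defines "k \<equiv> 2 * \<i> * cnj c" and "e \<equiv> complex_of_real r - \<i> * complex_of_real ((cmod c)\<^sup>2)"
    and "D1 \<equiv> - (2 * \<i> * cnj (c' $ 1) * l * u * c)
      + (of_real r' - \<i> * of_real ((cmod (c' $ 1))\<^sup>2 + eps * (cmod (c' $ 2))\<^sup>2)) * l\<^sup>2"
  assumes G: "\<And>i. has_jet (\<lambda>x. G (sigma_map (l, r, u, c) x) $ i)
    (model_jet eps s b i (fst (source_jets (l, r, u, c))) (snd (source_jets (l, r, u, c))))"
  obtains X1 X2 X3 where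
    "has_jet (\<lambda>x. sigma'_map eps (l', r', u', a', c') (G (sigma_map (l, r, u, c) x)) $ 1)
      (jconst (l' * u' * a' $ 1) * X1 - jconst (l' * eps * u' * a' $ 2) * X2)"
    "has_jet (\<lambda>x. sigma'_map eps (l', r', u', a', c') (G (sigma_map (l, r, u, c) x)) $ 2)
      (jconst (l' * cnj (a' $ 2)) * X1 + jconst (l' * cnj (a' $ 1)) * X2)"
    "has_jet (\<lambda>x. sigma'_map eps (l', r', u', a', c') (G (sigma_map (l, r, u, c) x)) $ 3)
      (jconst (l'\<^sup>2) * X3)"
    "j00 X1 = 0" "j00 X2 = 0" "j00 X3 = 0"
    "j10 X1 = l * u" "j10 X2 = 0" "j10 X3 = 0" "j01 X1 = l * u * c + c' $ 1 * l\<^sup>2" "j01 X2 = c' $ 2 * l\<^sup>2"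
    "j01 X3 = l\<^sup>2" "j20 X2 = l\<^sup>2 * u\<^sup>2"
    "j11 X2 = 2 * l\<^sup>2 * u\<^sup>2 * c + c' $ 2 * l\<^sup>2 * (k + 2 * \<i> * cnj (c' $ 1) * l * u)"
    "j02 X1 = - (l * u * c + c' $ 1 * l\<^sup>2) * (e + D1) + \<i> * eps / 2 * l^3 * u * c + s / 4 * l^4"
    "j02 X2 = l\<^sup>2 * u\<^sup>2 * c\<^sup>2 + b * l^4 - c' $ 2 * l\<^sup>2 * (e + D1)"
    "j02 X3 = - l\<^sup>2 * (e + D1)"
    "j21 X2 = l\<^sup>2 * u\<^sup>2 * (4 * k * c - 2 * e - D1) + \<i> * (eps + 4 * b) / 4 * l^4 * u\<^sup>2
      + 3 * eps * s * l^3 * u^3 * c + c' $ 2 * k\<^sup>2 * l\<^sup>2 + 2 * \<i> * cnj (c' $ 1) * l * u * j11 X2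
      + 2 * \<i> * c' $ 2 * l\<^sup>2 * (cnj (c' $ 1) * k * l * u + eps * cnj (c' $ 2) * l\<^sup>2 * u\<^sup>2)"
proof -
  define A B where "A = fst (source_jets (l, r, u, c))" and "B = snd (source_jets (l, r, u, c))"
  have AB: "A = TJ 0 (l * u) (l * u * c) (k * l * u) (l * u * (k * c - e)) (- (e * l * u * c))
           (l * u * k * (k * c - 2 * e))" "B = TJ 0 0 (l\<^sup>2) 0 (k * l\<^sup>2) (- (e * l\<^sup>2)) (k\<^sup>2 * l\<^sup>2)"
    by (simp_all add: A_def B_def source_jets_def Let_def k_def e_def)
  define F where "F = (\<lambda>i. model_jet eps s b i A B)"
  define D where "D = sigma'_den eps (l', r', u', a', c') (F 1) (F 2) (F 3)"
  define X1 X2 X3 where "X1 = (F 1 + jconst (c' $ 1) * F 3) * jinv D"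
    and "X2 = (F 2 + jconst (c' $ 2) * F 3) * jinv D" and "X3 = F 3 * jinv D"
  define e' where "e' = of_real r' - \<i> * of_real ((cmod (c' $ 1))\<^sup>2 + eps * (cmod (c' $ 2))\<^sup>2)"
  have D1: "D1 = - (2 * \<i> * cnj (c' $ 1) * l * u * c) + e' * l\<^sup>2" by (simp add: D1_def e'_def)
  have F: "j00 (F i) = 0" for i by (simp add: F_def model_jet_def AB jconst_def tjet_ops)
  have D_eq: "D = jconst 1 - jconst (2 * \<i>) * (jconst (cnj (c' $ 1)) * F 1
      + jconst (of_real eps * cnj (c' $ 2)) * F 2) + jconst e' * F 3"
    by (simp add: D_def sigma'_den_def e'_def)
  have D0: "j00 D = 1" by (simp add: D_eq F jconst_def tjet_ops)
  have XD: "X1 * D = F 1 + jconst (c' $ 1) * F 3" "X2 * D = F 2 + jconst (c' $ 2) * F 3" "X3 * D = F 3"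
    using jinv[OF D0] by (simp_all only: X1_def X2_def X3_def mult.assoc mult_1_right)
  have N0: "j00 (F 1 + jconst (c' $ 1) * F 3) = 0" "j00 (F 2 + jconst (c' $ 2) * F 3) = 0" "j00 (F 3) = 0"
    by (simp_all add: F jconst_def tjet_ops)
  note X1 = quotient_components[OF XD(1) D0 N0(1)] and X2 = quotient_components[OF XD(2) D0 N0(2)]
    and X3 = quotient_components[OF XD(3) D0 N0(3)]
  have F1: "j10 (F 1) = l * u" "j01 (F 1) = l * u * c" "j20 (F 1) = k * l * u"
     "j02 (F 1) = - (e * l * u * c) + \<i> * eps / 2 * l^3 * u * c + s / 4 * l^4"
    by (simp_all add: F_def model_jet_def AB jconst_def tjet_ops power_def algebra_simps)
  have F2: "j10 (F 2) = 0" "j01 (F 2) = 0" "j20 (F 2) = l\<^sup>2 * u\<^sup>2" "j11 (F 2) = 2 * l\<^sup>2 * u\<^sup>2 * c"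
     "j02 (F 2) = l\<^sup>2 * u\<^sup>2 * c\<^sup>2 + b * l^4"
     "j21 (F 2) = 2 * l\<^sup>2 * u\<^sup>2 * (2 * k * c - e) + \<i> * (eps + 4 * b) / 4 * l^4 * u\<^sup>2
      + 3 * eps * s * l^3 * u^3 * c"
    by (simp_all add: F_def model_jet_def AB jconst_def tjet_ops power_def algebra_simps)
  have F3: "j10 (F 3) = 0" "j01 (F 3) = l\<^sup>2" "j20 (F 3) = 0" "j11 (F 3) = k * l\<^sup>2" "j02 (F 3) = - (e * l\<^sup>2)"
      "j21 (F 3) = k\<^sup>2 * l\<^sup>2"
    by (simp_all add: F_def model_jet_def AB)
  have Dc: "j10 D = - (2 * \<i> * cnj (c' $ 1) * l * u)" "j01 D = D1"
     "j20 D = - (2 * \<i> * (cnj (c' $ 1) * k * l * u + eps * cnj (c' $ 2) * l\<^sup>2 * u\<^sup>2))"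
    by (simp_all add: D_eq F F1 F2 F3 D1 jconst_def tjet_ops algebra_simps)
  show thesis
  proof (rule that[of X1 X2 X3])
    note s = has_jet_sigma'_map[where H = "\<lambda>x. G (sigma_map (l, r, u, c) x)" and F = F and eps = eps
        and l = l' and r = r' and u = u' and a = a' and c = c']
    have G': "has_jet (\<lambda>x. G (sigma_map (l, r, u, c) x) $ i) (F i)" for i
      using G by (simp add: F_def A_def B_def)
    note s' = s[OF G' F, folded D_def, OF XD]
    show "has_jet (\<lambda>x. sigma'_map eps (l', r', u', a', c') (G (sigma_map (l, r, u, c) x)) $ 1)
      (jconst (l' * u' * a' $ 1) * X1 - jconst (l' * eps * u' * a' $ 2) * X2)" by (rule s'(1))
    show "has_jet (\<lambda>x. sigma'_map eps (l', r', u', a', c') (G (sigma_map (l, r, u, c) x)) $ 2)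
      (jconst (l' * cnj (a' $ 2)) * X1 + jconst (l' * cnj (a' $ 1)) * X2)" by (rule s'(2))
    show "has_jet (\<lambda>x. sigma'_map eps (l', r', u', a', c') (G (sigma_map (l, r, u, c) x)) $ 3)
      (jconst (l'\<^sup>2) * X3)" using s'(3) by simp
    show "j00 X1 = 0" "j00 X2 = 0" "j00 X3 = 0" by (rule X1 X2 X3)+
    have N: "j10 (F 1 + jconst z * F 3) = j10 (F 1) + z * j10 (F 3)"
      "j01 (F 1 + jconst z * F 3) = j01 (F 1) + z * j01 (F 3)"
      "j02 (F 1 + jconst z * F 3) = j02 (F 1) + z * j02 (F 3)"
      "j10 (F 2 + jconst z * F 3) = j10 (F 2) + z * j10 (F 3)"
      "j01 (F 2 + jconst z * F 3) = j01 (F 2) + z * j01 (F 3)"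
      "j20 (F 2 + jconst z * F 3) = j20 (F 2) + z * j20 (F 3)"
      "j11 (F 2 + jconst z * F 3) = j11 (F 2) + z * j11 (F 3)"
      "j02 (F 2 + jconst z * F 3) = j02 (F 2) + z * j02 (F 3)"
      "j21 (F 2 + jconst z * F 3) = j21 (F 2) + z * j21 (F 3)" for z
      by (simp_all add: jconst_def tjet_ops F)
    show a: "j10 X1 = l * u" "j10 X2 = 0" "j10 X3 = 0" "j01 X1 = l * u * c + c' $ 1 * l\<^sup>2"
      "j01 X2 = c' $ 2 * l\<^sup>2" "j01 X3 = l\<^sup>2"
      by (simp_all add: X1 X2 X3 N F1 F2 F3)
    show b: "j20 X2 = l\<^sup>2 * u\<^sup>2" by (simp add: X2(4) N a F1 F2 F3)
    show c: "j11 X2 = 2 * l\<^sup>2 * u\<^sup>2 * c + c' $ 2 * l\<^sup>2 * (k + 2 * \<i> * cnj (c' $ 1) * l * u)"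
      by (simp only: X2(5) N a F1 F2 F3 Dc) (simp add: algebra_simps)
    show "j02 X1 = - (l * u * c + c' $ 1 * l\<^sup>2) * (e + D1) + \<i> * eps / 2 * l^3 * u * c + s / 4 * l^4"
      by (simp only: X1(6) N a F1 F2 F3 Dc) (simp add: algebra_simps)
    show "j02 X2 = l\<^sup>2 * u\<^sup>2 * c\<^sup>2 + b * l^4 - c' $ 2 * l\<^sup>2 * (e + D1)"
      by (simp only: X2(6) N a F1 F2 F3 Dc) (simp add: algebra_simps)
    show "j02 X3 = - l\<^sup>2 * (e + D1)"
      by (simp only: X3(6) N a F1 F2 F3 Dc) (simp add: algebra_simps)
    show "j21 X2 = l\<^sup>2 * u\<^sup>2 * (4 * k * c - 2 * e - D1) + \<i> * (eps + 4 * b) / 4 * l^4 * u\<^sup>2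
      + 3 * eps * s * l^3 * u^3 * c + c' $ 2 * k\<^sup>2 * l\<^sup>2 + 2 * \<i> * cnj (c' $ 1) * l * u * j11 X2
      + 2 * \<i> * c' $ 2 * l\<^sup>2 * (cnj (c' $ 1) * k * l * u + eps * cnj (c' $ 2) * l\<^sup>2 * u\<^sup>2)"
      by (simp only: X2(7) N a b F1 F2 F3 Dc) (simp add: algebra_simps)
  qed
qed

section \<open>Recovering all parameters from the jet\<close>

text \<open>The entries of a jet are derivatives; halving some of them gives Taylor coefficients.\<close>

definition "jf10 (j::jet) = fst j"
definition "jH01 (j::jet) = fst (snd j)"
definition "jf20 (j::jet) = (\<chi> i. fst (snd (snd j)) $ i / 2)"
definition "jH11 (j::jet) = fst (snd (snd (snd j)))"
definition "jH02 (j::jet) = (\<chi> i. fst (snd (snd (snd (snd j)))) $ i / 2)"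
definition "jf21 (j::jet) = (\<chi> i. snd (snd (snd (snd (snd j)))) $ i / 2)"

definition first_two :: "complex^3 \<Rightarrow> complex^2" where "first_two v = vector [v $ 1, v $ 2]"

text \<open>The parameters of \<open>\<sigma>' \<circ> G \<circ> \<sigma>\<close> as explicit functions of its jet, in an order in which each uses
  only earlier ones. Since \<open>g\<^sub>w = \<lambda>\<^sup>2\<lambda>'\<^sup>2\<close> and \<open>det(f\<^sub>z, f\<^sub>z\<^sub>z/2) = \<lambda>'\<^sup>2\<lambda>\<^sup>3u\<^sup>3u'\<close>, the dilations come first.
  The functionals \<open>rec_F1\<close> and \<open>rec_F2\<close>, a Hermitian product with \<open>f\<^sub>z\<close> and a determinant with \<open>f\<^sub>z\<close>,
  send \<open>\<lambda>'U'(X, Y)\<close> to \<open>X/u\<close> and \<open>Y/u\<^sup>2\<close>: they undo \<open>\<lambda>'U'\<close> and in addition normalize the phase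
  \<open>u\<close> to 1. Until \<open>u\<close> is known, all quantities are therefore those of the map conjugated by the
  rotation \<open>u\<close>: \<open>rec_c1\<close> is \<open>c'\<^sub>1/u\<close>, \<open>rec_c2\<close> is \<open>c'\<^sub>2/u\<^sup>2\<close>, \<open>rec_A\<close> is \<open>c + \<lambda>c'\<^sub>1/u\<close>, \<open>rec_S\<close> is \<open>s/u\<close> and
  \<open>rec_B\<close> is \<open>b/u\<^sup>2\<close>. As \<open>s > 0\<close>, the phase of \<open>rec_S\<close> gives \<open>u\<close>; for \<open>s = 0\<close> it could not be
  determined, in accordance with the rotations that fix the map then.\<close>

definition "rec_g j = Re (jH01 j $ 3)"
definition "rec_D j = jf10 j $ 1 * jf20 j $ 2 - jf10 j $ 2 * jf20 j $ 1"
definition "rec_l j = cmod (rec_D j) / rec_g j"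
definition "rec_l' j = sqrt (rec_g j) / rec_l j"
definition "rec_F1 eps j v = (v $ 1 * cnj (jf10 j $ 1) + of_real eps * (v $ 2 * cnj (jf10 j $ 2)))
  / of_real ((rec_l' j)\<^sup>2 * rec_l j)" for v :: "complex^2"
definition "rec_F2 j v = (jf10 j $ 1 * v $ 2 - jf10 j $ 2 * v $ 1) * of_real ((rec_l j)\<^sup>2) / rec_D j"
  for v :: "complex^2"
definition "rec_A eps j = rec_F1 eps j (first_two (jH01 j)) / of_real (rec_l j)"
definition "rec_c2 j = rec_F2 j (first_two (jH01 j)) / of_real ((rec_l j)\<^sup>2)"
definition "rec_c eps j =
  (rec_F2 j (first_two (jH11 j)) / of_real ((rec_l j)\<^sup>2) - 2 * \<i> * rec_c2 j * cnj (rec_A eps j)) / 2"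
definition "rec_c1 eps j = (rec_A eps j - rec_c eps j) / of_real (rec_l j)"
definition "rec_G j = jH02 j $ 3 / of_real (rec_g j)"
definition "rec_S eps j = 4 / of_real ((rec_l j) ^ 4) * (rec_F1 eps j (first_two (jH02 j))
  - of_real (rec_l j) * rec_A eps j * rec_G j - \<i> * of_real eps / 2 * of_real ((rec_l j) ^ 3) * rec_c eps j)"
definition "rec_B eps j = (rec_F2 j (first_two (jH02 j)) - (rec_c eps j)\<^sup>2 * of_real ((rec_l j)\<^sup>2)
  - rec_c2 j * of_real ((rec_l j)\<^sup>2) * rec_G j) / of_real ((rec_l j) ^ 4)"
definition "rec_u eps j = cnj (rec_S eps j) / of_real (cmod (rec_S eps j))"
definition "rec_r eps j = Re (rec_G j) +
  Re (4 * (of_real (rec_l j))\<^sup>2 * (2 * \<i> * cnj (rec_c eps j)) * rec_c eps j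
    + 3 * of_real eps * cnj (rec_S eps j) * of_real (rec_l j) ^ 3 * rec_c eps j
    + rec_c2 j * (2 * \<i> * cnj (rec_c eps j))\<^sup>2 * (of_real (rec_l j))\<^sup>2
    + 2 * \<i> * cnj (rec_c1 eps j) * of_real (rec_l j) * rec_F2 j (first_two (jH11 j))
    + 2 * \<i> * rec_c2 j * (of_real (rec_l j))\<^sup>2 *
        (cnj (rec_c1 eps j) * (2 * \<i> * cnj (rec_c eps j)) * of_real (rec_l j)
         + of_real eps * cnj (rec_c2 j) * (of_real (rec_l j))\<^sup>2)
    - rec_F2 j (jf21 j)) / (rec_l j)\<^sup>2"
definition "rec_r' eps j = (- Re (rec_G j) - rec_r eps j
    + Re (2 * \<i> * cnj (rec_c1 eps j) * of_real (rec_l j) * rec_c eps j)) / (rec_l j)\<^sup>2"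
definition "rec_u' eps j = rec_D j / of_real (cmod (rec_D j)) * cnj (rec_u eps j) ^ 3"
definition "rec_a' eps j = (vector [jf10 j $ 1 / (of_real (rec_l j * rec_l' j) * rec_u eps j * rec_u' eps j),
   cnj (jf10 j $ 2 / (of_real (rec_l j * rec_l' j) * rec_u eps j))] :: complex^2)"
definition "rec_c' eps j = (vector [rec_u eps j * rec_c1 eps j, (rec_u eps j)\<^sup>2 * rec_c2 j] :: complex^2)"

definition recover :: "real \<Rightarrow> jet \<Rightarrow> params \<times> params' \<times> (real \<times> real)" where
  "recover eps j = ((rec_l j, rec_r eps j, rec_u eps j, rec_c eps j),
    (rec_l' j, rec_r' eps j, rec_u' eps j, rec_a' eps j, rec_c' eps j),
    (cmod (rec_S eps j), Re ((rec_u eps j)\<^sup>2 * rec_B eps j)))"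

text \<open>The condition under which none of the formulas divides by zero.\<close>

definition recover_domain :: "real \<Rightarrow> jet set" where
  "recover_domain eps = {j. rec_g j > 0 \<and> rec_D j \<noteq> 0 \<and> rec_S eps j \<noteq> 0}"

lemma continuous_on_vector2:
  fixes f g :: "'a::topological_space \<Rightarrow> complex"
  assumes "continuous_on S f" "continuous_on S g"
  shows "continuous_on S (\<lambda>x. vector [f x, g x] :: complex^2)"
proof -
  have "continuous_on S (\<lambda>x. \<chi> i::2. if i = 1 then f x else g x)"
  proof (rule continuous_on_vec_lambda)
    fix i :: 2 show "continuous_on S (\<lambda>x. if i = 1 then f x else g x)"
      using assms by (cases "i = 1") auto
  qed
  moreover have "(\<chi> i::2. if i = 1 then f x else g x) = vector [f x, g x]" for x
    by (simp add: vec_eq_iff forall_2)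
  ultimately show ?thesis by simp
qed

lemma continuous_on_vector3:
  fixes f g h :: "'a::topological_space \<Rightarrow> complex"
  assumes "continuous_on S f" "continuous_on S g" "continuous_on S h"
  shows "continuous_on S (\<lambda>x. vector [f x, g x, h x] :: complex^3)"
proof -
  have "continuous_on S (\<lambda>x. \<chi> i::3. if i = 1 then f x else if i = 2 then g x else h x)"
  proof (rule continuous_on_vec_lambda)
    fix i :: 3 show "continuous_on S (\<lambda>x. if i = 1 then f x else if i = 2 then g x else h x)"
      using assms by (cases "i = 1"; cases "i = 2") auto
  qed
  moreover have "(\<chi> i::3. if i = 1 then f x else if i = 2 then g x else h x) = vector [f x, g x, h x]" for x
    by (simp add: vec_eq_iff forall_3)
  ultimately show ?thesis by simp
qed

lemma continuous_on_recover: "continuous_on (recover_domain eps) (recover eps)"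
proof -
  let ?\<Omega> = "recover_domain eps"
  have dom: "rec_g j \<noteq> 0" "rec_g j > 0" "rec_D j \<noteq> 0" "rec_S eps j \<noteq> 0" if "j \<in> ?\<Omega>" for j
    using that by (auto simp: recover_domain_def)
  have l0: "rec_l j \<noteq> 0" "rec_l' j \<noteq> 0" if "j \<in> ?\<Omega>" for j
    using dom[OF that] by (auto simp: rec_l'_def rec_l_def)
  have u0: "rec_u eps j \<noteq> 0" "rec_u' eps j \<noteq> 0" if "j \<in> ?\<Omega>" for j
    using dom[OF that] by (auto simp: rec_u_def rec_u'_def)
  have c1: "continuous_on ?\<Omega> jf10" "continuous_on ?\<Omega> jH01" "continuous_on ?\<Omega> jf20" "continuous_on ?\<Omega> jH11"
    "continuous_on ?\<Omega> jH02" "continuous_on ?\<Omega> jf21"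
    unfolding jf10_def jH01_def jf20_def jH11_def jH02_def jf21_def
    by (auto intro!: continuous_intros continuous_on_vec_lambda)
  have first_two: "continuous_on ?\<Omega> (\<lambda>j. first_two (f j))" if "continuous_on ?\<Omega> f" for f
    unfolding first_two_def by (intro continuous_on_vector2 continuous_intros that)
  have g: "continuous_on ?\<Omega> rec_g" unfolding rec_g_def by (intro continuous_intros c1)
  have D: "continuous_on ?\<Omega> rec_D" unfolding rec_D_def by (intro continuous_intros c1)
  have l: "continuous_on ?\<Omega> rec_l" unfolding rec_l_def
    by (intro continuous_intros c1 g D) (use dom in auto)
  have l': "continuous_on ?\<Omega> rec_l'" unfolding rec_l'_def
    by (intro continuous_intros c1 g D l) (use l0 in auto)
  have F1: "continuous_on ?\<Omega> (\<lambda>j. rec_F1 eps j (f j))" if "continuous_on ?\<Omega> f" for f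
    unfolding rec_F1_def by (intro continuous_intros c1 that l l') (use l0 in auto)
  have F2: "continuous_on ?\<Omega> (\<lambda>j. rec_F2 j (f j))" if "continuous_on ?\<Omega> f" for f
    unfolding rec_F2_def by (intro continuous_intros c1 that l D) (use dom in auto)
  have A: "continuous_on ?\<Omega> (rec_A eps)" unfolding rec_A_def
    by (intro continuous_intros F1 first_two c1 l) (use l0 in auto)
  have c2: "continuous_on ?\<Omega> rec_c2" unfolding rec_c2_def
    by (intro continuous_intros F2 first_two c1 l) (use l0 in auto)
  have c: "continuous_on ?\<Omega> (rec_c eps)" unfolding rec_c_def
    by (intro continuous_intros F2 first_two c1 l A c2) (use l0 in auto)
  have cc1: "continuous_on ?\<Omega> (rec_c1 eps)" unfolding rec_c1_def
    by (intro continuous_intros c1 l A c) (use l0 in auto)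
  have G: "continuous_on ?\<Omega> rec_G" unfolding rec_G_def
    by (intro continuous_intros c1 g) (use dom in auto)
  have S: "continuous_on ?\<Omega> (rec_S eps)" unfolding rec_S_def
    by (intro continuous_intros F1 first_two c1 l A G c) (use l0 in auto)
  have B: "continuous_on ?\<Omega> (rec_B eps)" unfolding rec_B_def
    by (intro continuous_intros F2 first_two c1 l c c2 G) (use l0 in auto)
  have u: "continuous_on ?\<Omega> (rec_u eps)" unfolding rec_u_def
    by (intro continuous_intros S) (use dom in auto)
  have r: "continuous_on ?\<Omega> (rec_r eps)" unfolding rec_r_def
    by (intro continuous_intros F2 first_two c1 l c c2 G S cc1) (use l0 in auto)
  have r': "continuous_on ?\<Omega> (rec_r' eps)" unfolding rec_r'_def
    by (intro continuous_intros l c cc1 G r) (use l0 in auto)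
  have u': "continuous_on ?\<Omega> (rec_u' eps)" unfolding rec_u'_def
    by (intro continuous_intros u D) (use dom in auto)
  have a': "continuous_on ?\<Omega> (rec_a' eps)" unfolding rec_a'_def
    by (intro continuous_on_vector2 continuous_intros c1 l l' u u') (use l0 u0 in auto)
  have c': "continuous_on ?\<Omega> (rec_c' eps)" unfolding rec_c'_def
    by (intro continuous_on_vector2 continuous_intros u cc1 c2)
  show ?thesis unfolding recover_def
    by (intro continuous_intros l r u c l' r' u' a' c' S B)
qed

definition jet_of :: "tjet \<Rightarrow> tjet \<Rightarrow> tjet \<Rightarrow> jet" where
  "jet_of T1 T2 T3 = (vector [j10 T1, j10 T2], vector [j01 T1, j01 T2, j01 T3],
    vector [2 * j20 T1, 2 * j20 T2], vector [j11 T1, j11 T2, j11 T3],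
    vector [2 * j02 T1, 2 * j02 T2, 2 * j02 T3], vector [2 * j21 T1, 2 * j21 T2])"

lemma jet_of_parts:
  "jf10 (jet_of T1 T2 T3) = vector [j10 T1, j10 T2]" "jH01 (jet_of T1 T2 T3) = vector [j01 T1, j01 T2, j01 T3]"
  "jf20 (jet_of T1 T2 T3) = vector [j20 T1, j20 T2]" "jH11 (jet_of T1 T2 T3) = vector [j11 T1, j11 T2, j11 T3]"
  "jH02 (jet_of T1 T2 T3) = vector [j02 T1, j02 T2, j02 T3]" "jf21 (jet_of T1 T2 T3) = vector [j21 T1, j21 T2]"
  by (simp_all add: jet_of_def jf10_def jH01_def jf20_def jH11_def jH02_def jf21_def vec_eq_iff forall_2 forall_3)

lemma jet0_abs_germ:
  assumes "germ_rel f f" and T: "\<And>k. trunc_jet (\<lambda>x. f x $ k) = T k"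
  shows "jet0 (abs_germ f) = jet_of (T 1) (T 2) (T 3)"
proof -
  have p: "germ_partial (abs_germ f) k d = fold complex_partial d (\<lambda>x. f x $ k) 0" for k d
    using germ_partial.abs_eq[OF assms(1)] by simp
  show ?thesis
    by (simp add: jet0_def Let_def p T[symmetric] jet_of_def trunc_jet_def vec_eq_iff forall_3 forall_2
        del: fold_simps)
qed

text \<open>The assumptions on the \<open>X\<^sub>i\<close> are the equations satisfied by the composites; they are solved one
  parameter at a time.\<close>

lemma recover_composite_jet:
  fixes eps l r l' r' s b :: real and u u' c k e D1 :: complex and a' c' :: "complex^2"
  defines "k \<equiv> 2 * \<i> * cnj c" and "e \<equiv> complex_of_real r - \<i> * complex_of_real ((cmod c)\<^sup>2)"
    and "D1 \<equiv> - (2 * \<i> * cnj (c' $ 1) * l * u * c)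
      + (of_real r' - \<i> * of_real ((cmod (c' $ 1))\<^sup>2 + eps * (cmod (c' $ 2))\<^sup>2)) * l\<^sup>2"
  assumes pos: "l > 0" "l' > 0" "s > 0" and unit: "cmod u = 1" "cmod u' = 1"
    and a': "(cmod (a' $ 1))\<^sup>2 + eps * (cmod (a' $ 2))\<^sup>2 = 1"
    and X: "j10 X1 = l * u" "j10 X2 = 0" "j01 X1 = l * u * c + c' $ 1 * l\<^sup>2"
    "j01 X2 = c' $ 2 * l\<^sup>2"
    "j01 X3 = l\<^sup>2" "j20 X2 = l\<^sup>2 * u\<^sup>2"
    "j11 X2 = 2 * l\<^sup>2 * u\<^sup>2 * c + c' $ 2 * l\<^sup>2 * (k + 2 * \<i> * cnj (c' $ 1) * l * u)"
    "j02 X1 = - (l * u * c + c' $ 1 * l\<^sup>2) * (e + D1) + \<i> * eps / 2 * l^3 * u * c + s / 4 * l^4"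
    "j02 X2 = l\<^sup>2 * u\<^sup>2 * c\<^sup>2 + b * l^4 - c' $ 2 * l\<^sup>2 * (e + D1)"
    "j02 X3 = - l\<^sup>2 * (e + D1)"
    "j21 X2 = l\<^sup>2 * u\<^sup>2 * (4 * k * c - 2 * e - D1) + \<i> * (eps + 4 * b) / 4 * l^4 * u\<^sup>2
      + 3 * eps * s * l^3 * u^3 * c + c' $ 2 * k\<^sup>2 * l\<^sup>2 + 2 * \<i> * cnj (c' $ 1) * l * u * j11 X2
      + 2 * \<i> * c' $ 2 * l\<^sup>2 * (cnj (c' $ 1) * k * l * u + eps * cnj (c' $ 2) * l\<^sup>2 * u\<^sup>2)"
    and T: "T1 = jconst (l' * u' * a' $ 1) * X1 - jconst (l' * eps * u' * a' $ 2) * X2"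
    "T2 = jconst (l' * cnj (a' $ 2)) * X1 + jconst (l' * cnj (a' $ 1)) * X2"
    "T3 = jconst (l'\<^sup>2) * X3"
  shows "jet_of T1 T2 T3 \<in> recover_domain eps"
    and "recover eps (jet_of T1 T2 T3) = ((l, r, u, c), (l', r', u', a', c'), (s, b))"
proof -
  define j where "j = jet_of T1 T2 T3"
  define c1 c2 where "c1 = c' $ 1" and "c2 = c' $ 2"
  define a1 a2 where "a1 = a' $ 1" and "a2 = a' $ 2"
  have [simp]: "l \<noteq> 0" "l' \<noteq> 0" "u \<noteq> 0" "u' \<noteq> 0" using pos unit by auto
  have uc: "u * cnj u = 1" "u' * cnj u' = 1"
    using unit by (simp_all add: complex_norm_square[symmetric])
  then have cu: "cnj u = 1 / u" "cnj u' = 1 / u'" by (simp_all add: field_simps)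
  have a1: "a1 * cnj a1 + of_real eps * (a2 * cnj a2) = 1"
  proof -
    have "a1 * cnj a1 + of_real eps * (a2 * cnj a2) = of_real ((cmod a1)\<^sup>2 + eps * (cmod a2)\<^sup>2)"
      by (simp only: of_real_add of_real_mult complex_norm_square)
    then show ?thesis using a' by (simp add: a1_def a2_def)
  qed
  have comp: "f T1 = l' * u' * a1 * f X1 - l' * eps * u' * a2 * f X2"
     "f T2 = l' * cnj a2 * f X1 + l' * cnj a1 * f X2" "f T3 = l'\<^sup>2 * f X3"
    if "f = j10 \<or> f = j01 \<or> f = j20 \<or> f = j11 \<or> f = j02 \<or> f = j21" for f :: "tjet \<Rightarrow> complex"
    using that by (auto simp: T jconst_def tjet_ops a1_def a2_def)
  have p: "jf10 j $ 1 = l' * u' * a1 * (l * u)" "jf10 j $ 2 = l' * cnj a2 * (l * u)"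
    by (simp_all add: j_def jet_of_parts comp X)
  \<comment> \<open>\<open>U'\<close> preserves the Hermitian form and has determinant \<open>u'\<close>, so the pairings with
    \<open>f\<^sub>z = \<lambda>'U'(\<lambda>u, 0)\<close> extract the two components of \<open>U'\<^sup>-\<^sup>1f\<close>, up to factors.\<close>
  have herm: "(l' * u' * a1 * x - l' * eps * u' * a2 * y) * cnj (jf10 j $ 1)
      + eps * ((l' * cnj a2 * x + l' * cnj a1 * y) * cnj (jf10 j $ 2)) = l'\<^sup>2 * l * cnj u * x" for x y :: complex
  proof -
    have "(l' * u' * a1 * x - l' * eps * u' * a2 * y) * cnj (jf10 j $ 1)
      + eps * ((l' * cnj a2 * x + l' * cnj a1 * y) * cnj (jf10 j $ 2)) =
      l'\<^sup>2 * l * cnj u * ((u' * cnj u') * (a1 * cnj a1 * x - eps * a2 * cnj a1 * y)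
        + eps * (a2 * cnj a2 * x + a2 * cnj a1 * y))"
      by (simp add: p power2_eq_square algebra_simps)
    also have "\<dots> = l'\<^sup>2 * l * cnj u * ((a1 * cnj a1 + of_real eps * (a2 * cnj a2)) * x)"
      by (simp only: uc) (simp add: algebra_simps)
    finally show ?thesis by (simp only: a1 mult_1_left)
  qed
  have det: "jf10 j $ 1 * (l' * cnj a2 * x + l' * cnj a1 * y)
      - jf10 j $ 2 * (l' * u' * a1 * x - l' * eps * u' * a2 * y) = l'\<^sup>2 * l * u * u' * y" for x y :: complex
  proof -
    have "jf10 j $ 1 * (l' * cnj a2 * x + l' * cnj a1 * y)
      - jf10 j $ 2 * (l' * u' * a1 * x - l' * eps * u' * a2 * y)
      = l'\<^sup>2 * l * u * u' * ((a1 * cnj a1 + of_real eps * (a2 * cnj a2)) * y)"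
      by (simp add: p power2_eq_square algebra_simps)
    then show ?thesis by (simp only: a1 mult_1_left)
  qed
  have g: "rec_g j = l'\<^sup>2 * l\<^sup>2"
    by (simp add: rec_g_def j_def jet_of_parts comp X flip: of_real_power of_real_mult)
  have D: "rec_D j = l'\<^sup>2 * l^3 * u^3 * u'"
    using det[of "j20 X1" "j20 X2"] X(6)
    by (simp add: rec_D_def j_def jet_of_parts comp power2_eq_square power3_eq_cube algebra_simps)
  have normD: "cmod (rec_D j) = l'\<^sup>2 * l^3"
    using pos unit by (simp add: D norm_mult norm_power)
  have l: "rec_l j = l"
    by (simp add: rec_l_def normD g power2_eq_square power3_eq_cube)
  have l': "rec_l' j = l'"
    using pos by (simp add: rec_l'_def l g real_sqrt_mult)
  have F1: "rec_F1 eps j (vector [l' * u' * a1 * x - l' * eps * u' * a2 * y,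
      l' * cnj a2 * x + l' * cnj a1 * y]) = x / u" for x y :: complex
    by (simp only: rec_F1_def vector_2 herm l l') (simp add: cu)
  have F2: "rec_F2 j (vector [l' * u' * a1 * x - l' * eps * u' * a2 * y,
      l' * cnj a2 * x + l' * cnj a1 * y]) = y / u\<^sup>2" for x y :: complex
    by (simp only: rec_F2_def vector_2 det l D) (simp add: field_simps power2_eq_square power3_eq_cube)
  have vecs: "first_two (jH01 j) = vector [l' * u' * a1 * j01 X1 - l' * eps * u' * a2 * j01 X2,
      l' * cnj a2 * j01 X1 + l' * cnj a1 * j01 X2]"
    "first_two (jH11 j) = vector [l' * u' * a1 * j11 X1 - l' * eps * u' * a2 * j11 X2,
      l' * cnj a2 * j11 X1 + l' * cnj a1 * j11 X2]"
    "first_two (jH02 j) = vector [l' * u' * a1 * j02 X1 - l' * eps * u' * a2 * j02 X2,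
      l' * cnj a2 * j02 X1 + l' * cnj a1 * j02 X2]"
    "jf21 j = vector [l' * u' * a1 * j21 X1 - l' * eps * u' * a2 * j21 X2,
      l' * cnj a2 * j21 X1 + l' * cnj a1 * j21 X2]"
    by (simp_all add: first_two_def j_def jet_of_parts comp)
  have A: "rec_A eps j = c + l * c1 / u"
    by (simp only: rec_A_def vecs F1 X l c1_def) (simp add: field_simps power2_eq_square)
  have c2: "rec_c2 j = c2 / u\<^sup>2"
    by (simp only: rec_c2_def vecs F2 X l c2_def) (simp add: field_simps power2_eq_square)
  have cnjA: "cnj (rec_A eps j) = cnj c + l * cnj c1 * u"
    by (simp add: A cu)
  have c: "rec_c eps j = c"
    by (simp only: rec_c_def vecs F2 X l c2 cnjA c1_def c2_def k_def)
       (simp add: field_simps power2_eq_square)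
  have cc1: "rec_c1 eps j = c1 / u"
    by (simp add: rec_c1_def A c l)
  have G: "rec_G j = - (e + D1)"
  proof -
    have "jH02 j $ 3 = l'\<^sup>2 * (- l\<^sup>2 * (e + D1))" by (simp add: j_def jet_of_parts comp X)
    then show ?thesis by (simp add: rec_G_def g)
  qed
  have S: "rec_S eps j = s / u"
    by (simp only: rec_S_def vecs F1 X l A G c c1_def)
       (simp add: field_simps power2_eq_square power3_eq_cube power4_eq_xxxx)
  have normS: "cmod (rec_S eps j) = s" using pos unit by (simp add: S norm_divide)
  have B: "rec_B eps j = b / u\<^sup>2"
    by (simp only: rec_B_def vecs F2 X l c c2 G c2_def)
       (simp add: field_simps power2_eq_square power3_eq_cube power4_eq_xxxx)
  have u: "rec_u eps j = u"
    using pos by (simp add: rec_u_def normS) (simp add: S cu)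
  have r: "rec_r eps j = r"
  proof -
    have Y: "rec_F2 j (first_two (jH11 j)) = j11 X2 / u\<^sup>2" "rec_F2 j (jf21 j) = j21 X2 / u\<^sup>2"
      by (simp_all only: vecs F2)
    have cnjs: "cnj (rec_c1 eps j) = cnj c1 * u" "cnj (rec_c2 j) = cnj c2 * u\<^sup>2" "cnj (rec_S eps j) = s * u"
      by (simp_all add: cc1 c2 S cu power_divide)
    have "4 * (of_real (rec_l j))\<^sup>2 * (2 * \<i> * cnj (rec_c eps j)) * rec_c eps j
      + 3 * of_real eps * cnj (rec_S eps j) * of_real (rec_l j) ^ 3 * rec_c eps j
      + rec_c2 j * (2 * \<i> * cnj (rec_c eps j))\<^sup>2 * (of_real (rec_l j))\<^sup>2
      + 2 * \<i> * cnj (rec_c1 eps j) * of_real (rec_l j) * rec_F2 j (first_two (jH11 j))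
      + 2 * \<i> * rec_c2 j * (of_real (rec_l j))\<^sup>2 *
        (cnj (rec_c1 eps j) * (2 * \<i> * cnj (rec_c eps j)) * of_real (rec_l j)
         + of_real eps * cnj (rec_c2 j) * (of_real (rec_l j))\<^sup>2)
      - rec_F2 j (jf21 j) = of_real (l\<^sup>2) * (2 * e + D1) - \<i> * of_real ((eps + 4 * b) / 4 * l^4)"
      unfolding Y X(11) cnjs c l c2 k_def[symmetric]
      by (simp add: cu field_simps power2_eq_square power3_eq_cube power4_eq_xxxx c1_def c2_def)
    \<comment> \<open>Only \<open>e\<close> survives, since \<open>D1\<close> cancels and the coefficient from the model is imaginary.\<close>
    then have "rec_r eps j = Re (- (e + D1)) + Re (of_real (l\<^sup>2) * (2 * e + D1)
        - \<i> * of_real ((eps + 4 * b) / 4 * l^4)) / l\<^sup>2"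
      by (simp only: rec_r_def G l)
    also have "\<dots> = Re e" by (simp add: field_simps del: of_real_power)
    also have "\<dots> = r" by (simp add: e_def)
    finally show ?thesis .
  qed
  have r': "rec_r' eps j = r'"
  proof -
    have "Re D1 = r' * l\<^sup>2 - Re (2 * \<i> * cnj c1 * l * u * c)"
    proof -
      have "(of_real r' - \<i> * of_real ((cmod (c' $ 1))\<^sup>2 + eps * (cmod (c' $ 2))\<^sup>2)) * (of_real l)\<^sup>2
        = of_real (r' * l\<^sup>2) - \<i> * of_real (((cmod (c' $ 1))\<^sup>2 + eps * (cmod (c' $ 2))\<^sup>2) * l\<^sup>2)"
        by (simp add: algebra_simps)
      then have "Re ((of_real r' - \<i> * of_real ((cmod (c' $ 1))\<^sup>2 + eps * (cmod (c' $ 2))\<^sup>2)) * (of_real l)\<^sup>2)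
        = r' * l\<^sup>2" by (simp del: of_real_mult of_real_power of_real_add)
      then show ?thesis by (simp add: D1_def c1_def)
    qed
    moreover have "Re e = r" by (simp add: e_def)
    moreover have "cnj (rec_c1 eps j) = cnj c1 * u" by (simp add: cc1 cu)
    ultimately have "rec_r' eps j = (r + (r' * l\<^sup>2 - Re (2 * \<i> * cnj c1 * l * u * c)) - r
        + Re (2 * \<i> * (cnj c1 * u) * l * c)) / l\<^sup>2"
      by (simp only: rec_r'_def G r l c uminus_complex.sel plus_complex.sel minus_minus)
    also have "2 * \<i> * (cnj c1 * u) * l * c = 2 * \<i> * cnj c1 * l * u * c" by (simp add: algebra_simps)
    finally show ?thesis by simp
  qed
  have u': "rec_u' eps j = u'"
    unfolding rec_u'_def normD u unfolding D by (simp add: cu field_simps power3_eq_cube power2_eq_square)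
  have a'': "rec_a' eps j = a'"
    by (simp add: rec_a'_def p l l' u u' vec_eq_iff forall_2 a1_def a2_def cu)
  have c'': "rec_c' eps j = c'"
    by (simp add: rec_c'_def u cc1 c2 vec_eq_iff forall_2 c1_def c2_def)
  have b: "Re (u\<^sup>2 * rec_B eps j) = b" by (simp add: B)
  show "jet_of T1 T2 T3 \<in> recover_domain eps"
    using pos unfolding j_def[symmetric] recover_domain_def by (simp add: g D S)
  show "recover eps (jet_of T1 T2 T3) = ((l, r, u, c), (l', r', u', a', c'), (s, b))"
    unfolding j_def[symmetric] recover_def by (simp only: l r u c l' r' u' a'' c'' b normS)
qed

section \<open>The isotropy groups\<close>

lemma germ_rel_comp: "germ_rel f f \<Longrightarrow> germ_rel g g \<Longrightarrow> germ_rel (f \<circ> g) (f \<circ> g)"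
  by (auto simp: germ_rel_def pointed_holomorphic_comp)

lemma germ_comp_abs_germ:
  "germ_rel f f \<Longrightarrow> germ_rel g g \<Longrightarrow> germ_comp (abs_germ f) (abs_germ g) = abs_germ (f \<circ> g)"
  by (rule germ_comp.abs_eq)

lemma abs_germ_eqI:
  assumes "germ_rel f f" "germ_rel g g" "\<forall>\<^sub>F x in nhds 0. f x = g x"
  shows "abs_germ f = abs_germ g"
  using assms by (intro Quotient3_rel_abs[OF Quotient3_germ]) (auto simp: germ_rel_def)

lemma germ_comp_assoc: "germ_comp (germ_comp a b) c = germ_comp a (germ_comp b c)"
  by transfer (auto simp: comp_assoc intro!: germ_rel_comp)

lemma germ_comp_id: "germ_comp germ_id a = a" "germ_comp a germ_id = a"
  by (transfer; auto simp: comp_def)+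

lemma group_germ_groupI:
  assumes "\<And>x y. x \<in> S \<Longrightarrow> y \<in> S \<Longrightarrow> germ_comp x y \<in> S" "germ_id \<in> S"
    "\<And>x. x \<in> S \<Longrightarrow> \<exists>y\<in>S. germ_comp y x = germ_id"
  shows "group (germ_group S)"
  by (rule groupI) (use assms in \<open>auto simp: germ_group_def germ_comp_assoc germ_comp_id\<close>)

lemma of_real_cmod_square: "complex_of_real (cmod z) ^ 2 = z * cnj z"
  by (metis complex_norm_square of_real_power)

text \<open>The composition law of the parameters. Both kinds of isotropies have the form
  \<open>(\<lambda>U(z + cw), \<lambda>\<^sup>2w) / (1 - 2\<i>\<langle>z,c\<rangle> + (r - \<i>\<langle>c,c\<rangle>)w)\<close>, and a composite has
  \<open>c = c\<^sub>1 + \<lambda>\<^sub>1U\<^sub>1\<^sup>-\<^sup>1c\<^sub>2\<close>, which produces the imaginary part of \<open>\<langle>c\<^sub>1,U\<^sub>1\<^sup>-\<^sup>1c\<^sub>2\<rangle>\<close> in the parameter \<open>r\<close>.\<close>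
definition sigma_mult :: "params \<Rightarrow> params \<Rightarrow> params" where
  "sigma_mult = (\<lambda>(l2, r2, u2, c2) (l1, r1, u1, c1).
     (l2 * l1, r1 + l1\<^sup>2 * r2 + 2 * l1 * Im (c1 * cnj (cnj u1 * c2)), u2 * u1, c1 + of_real l1 * (cnj u1 * c2)))"

definition sigma_inv :: "params \<Rightarrow> params" where
  "sigma_inv = (\<lambda>(l, r, u, c). (1 / l, - r / l\<^sup>2, cnj u, - (u * c) / of_real l))"

definition sigma_den :: "params \<Rightarrow> complex^2 \<Rightarrow> complex" where
  "sigma_den = (\<lambda>(l, r, u, c) x. 1 - 2 * \<i> * cnj c * x $ 1 + (of_real r - \<i> * of_real ((cmod c)\<^sup>2)) * x $ 2)"

lemma sigma_map_eq: "sigma_map (l, r, u, c) x =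
  vector [of_real l * u * (x $ 1 + c * x $ 2) / sigma_den (l, r, u, c) x,
    (of_real l)\<^sup>2 * x $ 2 / sigma_den (l, r, u, c) x]"
  by (simp add: sigma_map_def sigma_den_def Let_def)

lemma sigma_map_mult:
  assumes "q \<in> Gamma" and d: "sigma_den q x \<noteq> 0"
  shows "sigma_map p (sigma_map q x) = sigma_map (sigma_mult p q) x"
proof -
  obtain l r u c where q: "q = (l, r, u, c)" by (cases q)
  obtain l2 r2 u2 c2 where p: "p = (l2, r2, u2, c2)" by (cases p)
  have u: "u * cnj u = 1" and l: "l > 0" using assms(1) q
    by (simp_all add: Gamma_def complex_norm_square[symmetric])
  have den: "sigma_den p (sigma_map q x) = sigma_den (sigma_mult p q) x / sigma_den q x"
  proof -
    have "sigma_den p (sigma_map q x) * sigma_den q x = sigma_den q x - 2 * \<i> * cnj c2 * (l * u * (x $ 1 + c * x $ 2))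
      + (of_real r2 - \<i> * of_real ((cmod c2)\<^sup>2)) * ((of_real l)\<^sup>2 * x $ 2)"
    proof -
      define D where "D = sigma_den q x"
      have s: "sigma_map q x $ 1 = of_real l * u * (x $ 1 + c * x $ 2) / D"
        "sigma_map q x $ 2 = (of_real l)\<^sup>2 * x $ 2 / D"
        by (simp_all add: q sigma_map_eq D_def)
      have p': "sigma_den p y = 1 - 2 * \<i> * cnj c2 * y $ 1 + (of_real r2 - \<i> * of_real ((cmod c2)\<^sup>2)) * y $ 2"
        for y by (simp add: p sigma_den_def)
      show ?thesis
        using d unfolding D_def[symmetric] p' s by (simp add: field_simps)
    qed
    also have "\<dots> = sigma_den (sigma_mult p q) x"
    proof -
      have "(cmod (c + of_real l * (cnj u * c2)))\<^sup>2 = (cmod c)\<^sup>2 + 2 * l * Re (c * cnj (cnj u * c2)) + l\<^sup>2 * (cmod c2)\<^sup>2"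
      proof -
        have "complex_of_real ((cmod (c + of_real l * (cnj u * c2)))\<^sup>2) =
          c * cnj c + l * (c * cnj (cnj u * c2) + cnj (c * cnj (cnj u * c2))) + l\<^sup>2 * (u * cnj u) * (c2 * cnj c2)"
          by (simp only: complex_norm_square) (simp add: power2_eq_square algebra_simps)
        also have "\<dots> = of_real ((cmod c)\<^sup>2 + 2 * l * Re (c * cnj (cnj u * c2)) + l\<^sup>2 * (cmod c2)\<^sup>2)"
          by (simp only: u complex_add_cnj complex_norm_square of_real_add of_real_mult) simp
        finally show ?thesis by (simp only: of_real_eq_iff)
      qed
      then have e: "complex_of_real (r + l\<^sup>2 * r2 + 2 * l * Im (c * cnj (cnj u * c2)))
          - \<i> * of_real ((cmod (c + of_real l * (cnj u * c2)))\<^sup>2)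
        = (of_real r - \<i> * of_real ((cmod c)\<^sup>2)) - 2 * \<i> * l * (c * cnj (cnj u * c2))
          + l\<^sup>2 * (of_real r2 - \<i> * of_real ((cmod c2)\<^sup>2))"
        by (simp add: complex_eq_iff algebra_simps)
      show ?thesis
        unfolding p q sigma_mult_def sigma_den_def split e
        by (simp add: algebra_simps)
    qed
    finally show ?thesis using d by (simp add: field_simps)
  qed
  have num: "of_real l2 * u2 * (sigma_map q x $ 1 + c2 * sigma_map q x $ 2) =
     of_real (l2 * l) * (u2 * u) * (x $ 1 + (c + of_real l * (cnj u * c2)) * x $ 2) / sigma_den q x"
  proof -
    have "of_real (l2 * l) * (u2 * u) * (x $ 1 + (c + of_real l * (cnj u * c2)) * x $ 2)
      = l2 * u2 * (l * u * (x $ 1 + c * x $ 2)) + l2 * u2 * c2 * l\<^sup>2 * (u * cnj u) * x $ 2"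
      by (simp add: algebra_simps power2_eq_square)
    also have "\<dots> = l2 * u2 * (l * u * (x $ 1 + c * x $ 2) + c2 * (l\<^sup>2 * x $ 2))"
      by (simp only: u) (simp add: algebra_simps)
    finally have *: "of_real (l2 * l) * (u2 * u) * (x $ 1 + (c + of_real l * (cnj u * c2)) * x $ 2)
      = l2 * u2 * (l * u * (x $ 1 + c * x $ 2) + c2 * (l\<^sup>2 * x $ 2))" .
    show ?thesis unfolding * by (simp add: q sigma_map_eq add_divide_distrib distrib_left)
  qed
  have "sigma_map p (sigma_map q x) =
    vector [of_real l2 * u2 * (sigma_map q x $ 1 + c2 * sigma_map q x $ 2) / sigma_den p (sigma_map q x),
      (of_real l2)\<^sup>2 * sigma_map q x $ 2 / sigma_den p (sigma_map q x)]"
    by (simp only: p sigma_map_eq[of l2])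
  also have "\<dots> = sigma_map (sigma_mult p q) x"
    unfolding den num using d
    by (simp add: p q sigma_mult_def sigma_map_eq power_mult_distrib mult.assoc)
  finally show ?thesis .
qed

lemma sigma_den_nonzero: "\<forall>\<^sub>F x in nhds 0. sigma_den p x \<noteq> 0"
proof (cases p)
  case (fields l r u c)
  have "scalar_holo_at (sigma_den p) 0"
    unfolding fields sigma_den_def split by (intro scalar_holo_at_intros)
  moreover have "sigma_den p 0 \<noteq> 0" by (simp add: fields sigma_den_def)
  ultimately show ?thesis by (rule scalar_holo_at_imp_ev_nonzero)
qed

lemma sigma_mult:
  assumes "q \<in> Gamma" shows "germ_comp (sigma p) (sigma q) = sigma (sigma_mult p q)"
  unfolding sigma_def germ_comp_abs_germ[OF germ_rel_sigma_map germ_rel_sigma_map]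
proof (rule abs_germ_eqI)
  show "\<forall>\<^sub>F x in nhds 0. (sigma_map p \<circ> sigma_map q) x = sigma_map (sigma_mult p q) x"
    using sigma_den_nonzero[of q] by eventually_elim (simp add: sigma_map_mult[OF assms])
qed (rule germ_rel_sigma_map germ_rel_comp)+

lemma sigma_mult_closed: "p \<in> Gamma \<Longrightarrow> q \<in> Gamma \<Longrightarrow> sigma_mult p q \<in> Gamma"
  by (auto simp: Gamma_def sigma_mult_def norm_mult)

lemma sigma_inv_closed: "p \<in> Gamma \<Longrightarrow> sigma_inv p \<in> Gamma"
  by (auto simp: Gamma_def sigma_inv_def)

lemma sigma_one: "sigma (1, 0, 1, 0) = germ_id" "(1, 0, 1, 0) \<in> Gamma"
proof -
  have "sigma_map (1, 0, 1, 0) = (\<lambda>x. x)"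
    by (simp add: fun_eq_iff sigma_map_def vec_eq_iff forall_2)
  then show "sigma (1, 0, 1, 0) = germ_id" by (simp add: sigma_def germ_id.abs_eq)
qed (simp add: Gamma_def)

lemma sigma_mult_inv: "p \<in> Gamma \<Longrightarrow> sigma_mult (sigma_inv p) p = (1, 0, 1, 0)"
proof (cases p)
  case (fields l r u c)
  assume "p \<in> Gamma"
  then have u: "cnj u * u = 1" and l: "l > 0"
    by (simp_all add: fields Gamma_def complex_norm_square[symmetric] mult.commute)
  have "of_real l * (cnj u * (- (u * c) / of_real l)) = - ((cnj u * u) * c)"
    using l by (simp add: field_simps)
  then have 1: "of_real l * (cnj u * (- (u * c) / of_real l)) = - c" by (simp add: u)
  then have 2: "cnj u * (- (u * c) / of_real l) = - c / of_real l" using l by (simp add: field_simps)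
  have 3: "Im (c * cnj (- c / of_real l)) = 0"
  proof -
    have "c * cnj (- c / of_real l) = of_real (- ((cmod c)\<^sup>2) / l)"
      by (simp add: of_real_cmod_square)
    then show ?thesis by (simp only: Im_complex_of_real)
  qed
  show ?thesis
    unfolding fields sigma_inv_def sigma_mult_def split 2 3 using l u by simp
qed

lemma group_Iso2: "group Iso2"
  unfolding Iso2_def
proof (rule group_germ_groupI)
  show "germ_comp x y \<in> sigma ` Gamma" if "x \<in> sigma ` Gamma" "y \<in> sigma ` Gamma" for x y
    using that sigma_mult sigma_mult_closed by force
  show "germ_id \<in> sigma ` Gamma" using sigma_one by force
  show "\<exists>y\<in>sigma ` Gamma. germ_comp y x = germ_id" if "x \<in> sigma ` Gamma" for x
  proof -
    from that obtain p where p: "p \<in> Gamma" "x = sigma p" by blast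
    then have "germ_comp (sigma (sigma_inv p)) x = germ_id"
      by (simp only: sigma_mult sigma_mult_inv sigma_one)
    then show ?thesis using sigma_inv_closed[OF p(1)] by blast
  qed
qed

lemma Iso2_simps: "carrier Iso2 = sigma ` Gamma" "x \<otimes>\<^bsub>Iso2\<^esub> y = germ_comp x y" "\<one>\<^bsub>Iso2\<^esub> = germ_id"
  by (simp_all add: Iso2_def germ_group_def)

lemma inv_Iso2: "p \<in> Gamma \<Longrightarrow> inv\<^bsub>Iso2\<^esub> (sigma p) = sigma (sigma_inv p)"
  by (rule group.inv_equality[OF group_Iso2])
     (auto simp: Iso2_simps sigma_mult sigma_mult_inv sigma_one sigma_inv_closed)

text \<open>The Hermitian form of the target hyperquadric, the matrix \<open>U'\<close> as a map, and its inverse for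
  parameters in \<open>Gamma'\<close>, which is also its adjoint for the form. With these the computation for the target group is the same as
  for the source group.\<close>

definition herm :: "real \<Rightarrow> complex^2 \<Rightarrow> complex^2 \<Rightarrow> complex" where
  "herm eps x y = x $ 1 * cnj (y $ 1) + of_real eps * (x $ 2 * cnj (y $ 2))"

definition Umap :: "real \<Rightarrow> complex \<Rightarrow> complex^2 \<Rightarrow> complex^2 \<Rightarrow> complex^2" where
  "Umap eps u a x = vector [u * a $ 1 * x $ 1 - of_real eps * u * a $ 2 * x $ 2,
     cnj (a $ 2) * x $ 1 + cnj (a $ 1) * x $ 2]"

definition Uinv :: "real \<Rightarrow> complex \<Rightarrow> complex^2 \<Rightarrow> complex^2 \<Rightarrow> complex^2" where
  "Uinv eps u a x = vector [cnj u * cnj (a $ 1) * x $ 1 + of_real eps * a $ 2 * x $ 2,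
     - (cnj u * cnj (a $ 2) * x $ 1) + a $ 1 * x $ 2]"

lemma vec2_eqI: "x $ 1 = y $ 1 \<Longrightarrow> x $ 2 = y $ 2 \<Longrightarrow> x = (y :: complex^2)"
  by (simp add: vec_eq_iff forall_2)

lemma Umap_linear: "Umap eps u a (x + y) = Umap eps u a x + Umap eps u a y"
  "Umap eps u a (k *s x) = k *s Umap eps u a x"
  by (simp_all add: Umap_def vec_eq_iff forall_2 algebra_simps)

lemma herm_linear: "herm eps (x + y) z = herm eps x z + herm eps y z"
  "herm eps (k *s x) z = k * herm eps x z"
  "herm eps z (x + y) = herm eps z x + herm eps z y"
  "herm eps z (k *s x) = cnj k * herm eps z x"
  by (simp_all add: herm_def algebra_simps)

lemma herm_cnj: "herm eps y x = cnj (herm eps x y)"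
  by (simp add: herm_def mult.commute)

lemma herm_self: "herm eps x x = of_real ((cmod (x $ 1))\<^sup>2 + eps * (cmod (x $ 2))\<^sup>2)"
  by (simp add: herm_def of_real_cmod_square)

lemma Im_herm_self: "Im (herm eps x x) = 0"
  by (simp only: herm_self Im_complex_of_real)

lemma unit_eqs:
  fixes a :: "complex^2"
  assumes "cmod u = 1" "(cmod (a $ 1))\<^sup>2 + eps * (cmod (a $ 2))\<^sup>2 = 1"
  shows "u * cnj u = 1" "a $ 1 * cnj (a $ 1) + of_real eps * (a $ 2 * cnj (a $ 2)) = 1"
proof -
  show "u * cnj u = 1" using assms(1) by (simp add: complex_norm_square[symmetric])
  show "a $ 1 * cnj (a $ 1) + of_real eps * (a $ 2 * cnj (a $ 2)) = 1"
    using herm_self[of eps a] assms(2) by (simp add: herm_def)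
qed

lemma Umap_Uinv:
  assumes "cmod u = 1" "(cmod (a $ 1))\<^sup>2 + eps * (cmod (a $ 2))\<^sup>2 = 1"
  shows "Umap eps u a (Uinv eps u a x) = x" "Uinv eps u a (Umap eps u a x) = x"
proof -
  note u = unit_eqs(1)[OF assms] and n = unit_eqs(2)[OF assms]
  let ?n = "a $ 1 * cnj (a $ 1) + of_real eps * (a $ 2 * cnj (a $ 2))"
  have "Umap eps u a (Uinv eps u a x) $ 1 = (u * cnj u) * (?n * x $ 1)"
    "Umap eps u a (Uinv eps u a x) $ 2 = ?n * x $ 2"
    by (simp_all add: Umap_def Uinv_def algebra_simps)
  then show "Umap eps u a (Uinv eps u a x) = x" by (simp only: u n mult_1_left vec2_eqI)
  have "Uinv eps u a (Umap eps u a x) $ 1 =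
      (u * cnj u) * (a $ 1 * cnj (a $ 1) * x $ 1 - of_real eps * cnj (a $ 1) * a $ 2 * x $ 2)
      + of_real eps * a $ 2 * (cnj (a $ 2) * x $ 1 + cnj (a $ 1) * x $ 2)"
    "Uinv eps u a (Umap eps u a x) $ 2 =
      - (u * cnj u) * (cnj (a $ 2) * a $ 1 * x $ 1 - of_real eps * cnj (a $ 2) * a $ 2 * x $ 2)
      + a $ 1 * (cnj (a $ 2) * x $ 1 + cnj (a $ 1) * x $ 2)"
    by (simp_all add: Umap_def Uinv_def algebra_simps)
  then have "Uinv eps u a (Umap eps u a x) $ 1 = ?n * x $ 1" "Uinv eps u a (Umap eps u a x) $ 2 = ?n * x $ 2"
    unfolding u by (simp_all add: algebra_simps)
  then show "Uinv eps u a (Umap eps u a x) = x" by (simp only: n mult_1_left vec2_eqI)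
qed

lemma herm_Umap: "herm eps (Umap eps u a x) y = herm eps x (Uinv eps u a y)"
  by (simp add: herm_def Umap_def Uinv_def algebra_simps)

lemma herm_Uinv:
  assumes "cmod u = 1" "(cmod (a $ 1))\<^sup>2 + eps * (cmod (a $ 2))\<^sup>2 = 1"
  shows "herm eps (Uinv eps u a x) (Uinv eps u a y) = herm eps x y"
  by (metis herm_Umap Umap_Uinv(1)[OF assms])

definition sigma'_mult :: "real \<Rightarrow> params' \<Rightarrow> params' \<Rightarrow> params'" where
  "sigma'_mult eps = (\<lambda>(l2, r2, u2, a2, c2) (l1, r1, u1, a1, c1).
     (l2 * l1, r1 + l1\<^sup>2 * r2 + 2 * l1 * Im (herm eps c1 (Uinv eps u1 a1 c2)), u2 * u1,
      vector [a2 $ 1 * a1 $ 1 - of_real eps * cnj u1 * a2 $ 2 * cnj (a1 $ 2),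
        cnj u1 * a2 $ 2 * cnj (a1 $ 1) + a2 $ 1 * a1 $ 2],
      c1 + of_real l1 *s Uinv eps u1 a1 c2))"

definition sigma'_inv :: "real \<Rightarrow> params' \<Rightarrow> params'" where
  "sigma'_inv eps = (\<lambda>(l, r, u, a, c). (1 / l, - r / l\<^sup>2, cnj u, vector [cnj (a $ 1), - (u * a $ 2)],
     of_real (- 1 / l) *s Umap eps u a c))"

definition sigma'_fden :: "real \<Rightarrow> params' \<Rightarrow> complex^3 \<Rightarrow> complex" where
  "sigma'_fden eps = (\<lambda>(l, r, u, a, c) x.
     1 - 2 * \<i> * herm eps (first_two x) c + (of_real r - \<i> * herm eps c c) * x $ 3)"

lemma sigma'_map_eq:
  fixes eps l r :: real and u :: complex and a c :: "complex^2"
  defines "d \<equiv> sigma'_fden eps (l, r, u, a, c)"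
  shows "first_two (sigma'_map eps (l, r, u, a, c) x) =
      (of_real l / d x) *s Umap eps u a (first_two x + x $ 3 *s c)"
    "sigma'_map eps (l, r, u, a, c) x $ 3 = (of_real l)\<^sup>2 * x $ 3 / d x"
proof -
  have *: "(1 - 2 * \<i> * (cnj (c $ 1) * (vector [x $ 1, x $ 2] :: complex^2) $ 1
      + of_real eps * cnj (c $ 2) * (vector [x $ 1, x $ 2] :: complex^2) $ 2)
     + (of_real r - \<i> * of_real ((cmod (c $ 1))\<^sup>2 + eps * (cmod (c $ 2))\<^sup>2)) * x $ 3) = d x"
    by (simp only: d_def sigma'_fden_def herm_self split) (simp add: herm_def first_two_def algebra_simps)
  show "first_two (sigma'_map eps (l, r, u, a, c) x) =
      (of_real l / d x) *s Umap eps u a (first_two x + x $ 3 *s c)"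
    unfolding sigma'_map_def split Let_def *
    by (simp add: first_two_def vec_eq_iff forall_2 U_matrix_def matrix_vector_mult_def sum_2 Umap_def
        add_divide_distrib algebra_simps)
  show "sigma'_map eps (l, r, u, a, c) x $ 3 = (of_real l)\<^sup>2 * x $ 3 / d x"
    unfolding sigma'_map_def split Let_def * by simp
qed

lemma vec3_eqI: "first_two x = first_two y \<Longrightarrow> x $ 3 = y $ 3 \<Longrightarrow> x = y"
  by (simp add: first_two_def vec_eq_iff forall_2 forall_3)

lemma Umap_mult:
  assumes "cmod v = 1"
  shows "Umap eps u a (Umap eps v b x) = Umap eps (u * v)
    (vector [a $ 1 * b $ 1 - of_real eps * cnj v * a $ 2 * cnj (b $ 2),
        cnj v * a $ 2 * cnj (b $ 1) + a $ 1 * b $ 2]) x"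
proof -
  have v: "v * cnj v = 1" using assms by (simp add: complex_norm_square[symmetric])
  have "Umap eps (u * v) (vector [a $ 1 * b $ 1 - of_real eps * cnj v * a $ 2 * cnj (b $ 2),
        cnj v * a $ 2 * cnj (b $ 1) + a $ 1 * b $ 2]) x $ 1 =
     u * (v * a $ 1 * b $ 1 - of_real eps * (v * cnj v) * a $ 2 * cnj (b $ 2)) * x $ 1
     - of_real eps * u * ((v * cnj v) * a $ 2 * cnj (b $ 1) + v * a $ 1 * b $ 2) * x $ 2"
    by (simp add: Umap_def algebra_simps)
  then have "Umap eps (u * v) (vector [a $ 1 * b $ 1 - of_real eps * cnj v * a $ 2 * cnj (b $ 2),
        cnj v * a $ 2 * cnj (b $ 1) + a $ 1 * b $ 2]) x $ 1 = Umap eps u a (Umap eps v b x) $ 1"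
    unfolding v by (simp add: Umap_def algebra_simps)
  moreover have "Umap eps (u * v) (vector [a $ 1 * b $ 1 - of_real eps * cnj v * a $ 2 * cnj (b $ 2),
        cnj v * a $ 2 * cnj (b $ 1) + a $ 1 * b $ 2]) x $ 2 = Umap eps u a (Umap eps v b x) $ 2"
    by (simp add: Umap_def algebra_simps)
  ultimately show ?thesis by (simp add: vec2_eqI)
qed

lemma sigma'_map_mult:
  assumes "q \<in> Gamma' eps" and d: "sigma'_fden eps q x \<noteq> 0"
  shows "sigma'_map eps p (sigma'_map eps q x) = sigma'_map eps (sigma'_mult eps p q) x"
proof -
  obtain l r u a c where q: "q = (l, r, u, a, c)" by (cases q)
  obtain l2 r2 u2 a2 c2 where p: "p = (l2, r2, u2, a2, c2)" by (cases p)
  have u: "cmod u = 1" "(cmod (a $ 1))\<^sup>2 + eps * (cmod (a $ 2))\<^sup>2 = 1" and l: "l > 0"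
    using assms(1) by (simp_all add: q Gamma'_def)
  define D where "D = sigma'_fden eps q x"
  define z where "z = first_two x"
  define c3 where "c3 = c + of_real l *s Uinv eps u a c2"
  define y where "y = sigma'_map eps q x"
  have y: "first_two y = (of_real l / D) *s Umap eps u a (z + x $ 3 *s c)"
    "y $ 3 = (of_real l)\<^sup>2 * x $ 3 / D"
    by (simp_all only: y_def q sigma'_map_eq D_def z_def)
  have den: "sigma'_fden eps p y = sigma'_fden eps (sigma'_mult eps p q) x / D"
  proof -
    let ?h = "herm eps c (Uinv eps u a c2)"
    have "sigma'_fden eps p y = 1 - 2 * \<i> * herm eps (first_two y) c2 + (of_real r2 - \<i> * herm eps c2 c2) * y $ 3"
      by (simp add: p sigma'_fden_def)
    also have "\<dots> * D = D - 2 * \<i> * l * herm eps (z + x $ 3 *s c) (Uinv eps u a c2)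
      + (of_real r2 - \<i> * herm eps c2 c2) * ((of_real l)\<^sup>2 * x $ 3)"
      using d unfolding y herm_linear herm_Umap D_def[symmetric] by (simp add: field_simps)
    finally have 1: "sigma'_fden eps p y * D = D - 2 * \<i> * l * herm eps (z + x $ 3 *s c) (Uinv eps u a c2)
      + (of_real r2 - \<i> * herm eps c2 c2) * ((of_real l)\<^sup>2 * x $ 3)" .
    have "herm eps c3 c3 = herm eps c c + l * (?h + cnj ?h) + l\<^sup>2 * herm eps c2 c2"
      unfolding c3_def herm_linear herm_Uinv[OF u] herm_cnj[of eps "Uinv eps u a c2" c]
      by (simp add: algebra_simps power2_eq_square)
    then have "complex_of_real (r + l\<^sup>2 * r2 + 2 * l * Im ?h) - \<i> * herm eps c3 c3 =
        (of_real r - \<i> * herm eps c c) - 2 * \<i> * l * ?h + l\<^sup>2 * (of_real r2 - \<i> * herm eps c2 c2)"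
      by (simp add: complex_eq_iff algebra_simps)
    then have "sigma'_fden eps (sigma'_mult eps p q) x = 1 - 2 * \<i> * herm eps z c3 +
      ((of_real r - \<i> * herm eps c c) - 2 * \<i> * l * ?h + l\<^sup>2 * (of_real r2 - \<i> * herm eps c2 c2)) * x $ 3"
      by (simp only: p q sigma'_mult_def sigma'_fden_def split z_def c3_def)
    also have "\<dots> = sigma'_fden eps p y * D"
      unfolding 1 unfolding D_def q sigma'_fden_def split c3_def herm_linear z_def
      by (simp add: algebra_simps)
    finally show ?thesis using d by (simp add: D_def field_simps)
  qed
  have num: "first_two y + y $ 3 *s c2 = (of_real l / D) *s Umap eps u a (z + x $ 3 *s c3)"
  proof -
    have "Umap eps u a (z + x $ 3 *s c3) = Umap eps u a (z + x $ 3 *s c) + (x $ 3 * l) *s c2"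
      by (simp add: c3_def vector_add_ldistrib Umap_linear Umap_Uinv[OF u] add.assoc vector_smult_assoc)
    then show ?thesis
      by (simp add: y vec_eq_iff power2_eq_square algebra_simps)
  qed
  let ?e = "vector [a2 $ 1 * a $ 1 - of_real eps * cnj u * a2 $ 2 * cnj (a $ 2),
        cnj u * a2 $ 2 * cnj (a $ 1) + a2 $ 1 * a $ 2] :: complex^2"
  have pq: "sigma'_mult eps p q = (l2 * l, r + l\<^sup>2 * r2 + 2 * l * Im (herm eps c (Uinv eps u a c2)),
      u2 * u, ?e, c3)"
    by (simp add: p q sigma'_mult_def c3_def)
  have D0: "D \<noteq> 0" using d by (simp add: D_def)
  show ?thesis
  proof (rule vec3_eqI)
    have "first_two (sigma'_map eps p y) = (of_real l2 / sigma'_fden eps p y) *s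
        ((of_real l / D) *s Umap eps u2 a2 (Umap eps u a (z + x $ 3 *s c3)))"
      by (simp only: p sigma'_map_eq num Umap_linear)
    also have "\<dots> = (of_real (l2 * l) / sigma'_fden eps (sigma'_mult eps p q) x) *s
        Umap eps (u2 * u) ?e (z + x $ 3 *s c3)"
      unfolding den Umap_mult[OF u(1)] using D0 by (simp add: vec_eq_iff)
    also have "\<dots> = first_two (sigma'_map eps (sigma'_mult eps p q) x)"
      by (simp only: pq sigma'_map_eq z_def)
    finally show "first_two (sigma'_map eps p (sigma'_map eps q x)) =
      first_two (sigma'_map eps (sigma'_mult eps p q) x)" by (simp only: y_def)
    have "sigma'_map eps p y $ 3 = (of_real l2)\<^sup>2 * y $ 3 / sigma'_fden eps p y"
      by (simp only: p sigma'_map_eq)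
    also have "\<dots> = (of_real (l2 * l))\<^sup>2 * x $ 3 / sigma'_fden eps (sigma'_mult eps p q) x"
      unfolding den y using D0 by (simp add: power_mult_distrib)
    also have "\<dots> = sigma'_map eps (sigma'_mult eps p q) x $ 3"
      by (simp only: pq sigma'_map_eq)
    finally show "sigma'_map eps p (sigma'_map eps q x) $ 3 = sigma'_map eps (sigma'_mult eps p q) x $ 3"
      by (simp only: y_def)
  qed
qed

lemma sigma'_fden_nonzero: "\<forall>\<^sub>F x in nhds 0. sigma'_fden eps p x \<noteq> 0"
proof (cases p)
  case (fields l r u a c)
  have "scalar_holo_at (sigma'_fden eps p) 0"
    unfolding fields sigma'_fden_def split herm_def first_two_def vector_2
    by (intro scalar_holo_at_intros)
  moreover have "sigma'_fden eps p 0 \<noteq> 0" by (simp add: fields sigma'_fden_def herm_def first_two_def)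
  ultimately show ?thesis by (rule scalar_holo_at_imp_ev_nonzero)
qed

lemma sigma'_mult:
  assumes "q \<in> Gamma' eps" shows "germ_comp (sigma' eps p) (sigma' eps q) = sigma' eps (sigma'_mult eps p q)"
  unfolding sigma'_def germ_comp_abs_germ[OF germ_rel_sigma'_map germ_rel_sigma'_map]
proof (rule abs_germ_eqI)
  show "\<forall>\<^sub>F x in nhds 0. (sigma'_map eps p \<circ> sigma'_map eps q) x = sigma'_map eps (sigma'_mult eps p q) x"
    using sigma'_fden_nonzero[of eps q] by eventually_elim (simp add: sigma'_map_mult[OF assms])
qed (rule germ_rel_sigma'_map germ_rel_comp)+

lemma sigma'_mult_closed:
  assumes "p \<in> Gamma' eps" "q \<in> Gamma' eps" shows "sigma'_mult eps p q \<in> Gamma' eps"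
proof -
  obtain l r u a c where q: "q = (l, r, u, a, c)" by (cases q)
  obtain l2 r2 u2 a2 c2 where p: "p = (l2, r2, u2, a2, c2)" by (cases p)
  let ?e = "vector [a2 $ 1 * a $ 1 - of_real eps * cnj u * a2 $ 2 * cnj (a $ 2),
        cnj u * a2 $ 2 * cnj (a $ 1) + a2 $ 1 * a $ 2] :: complex^2"
  have u: "u * cnj u = 1" and n: "herm eps a a = 1" "herm eps a2 a2 = 1"
    using assms unit_eqs[of u a eps] herm_self[of eps a] herm_self[of eps a2] by (auto simp: p q Gamma'_def)
  have "herm eps ?e ?e = (a2 $ 1 * a $ 1) * cnj (a2 $ 1 * a $ 1)
      + of_real eps * of_real eps * (u * cnj u) * (a2 $ 2 * a $ 2) * cnj (a2 $ 2 * a $ 2)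
      + of_real eps * (u * cnj u) * (a2 $ 2 * a $ 1) * cnj (a2 $ 2 * a $ 1)
      + of_real eps * (a2 $ 1 * a $ 2) * cnj (a2 $ 1 * a $ 2)"
    by (simp add: herm_def algebra_simps)
  also have "\<dots> = herm eps a2 a2 * herm eps a a"
    unfolding u by (simp add: herm_def algebra_simps)
  finally have "herm eps ?e ?e = 1" by (simp add: n)
  then have "(cmod (?e $ 1))\<^sup>2 + eps * (cmod (?e $ 2))\<^sup>2 = 1"
    unfolding herm_self of_real_eq_1_iff .
  then show ?thesis using assms by (simp add: p q Gamma'_def sigma'_mult_def norm_mult)
qed

lemma sigma'_inv_closed: "p \<in> Gamma' eps \<Longrightarrow> sigma'_inv eps p \<in> Gamma' eps"
  by (auto simp: Gamma'_def sigma'_inv_def norm_mult)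

lemma sigma'_one: "sigma' eps (1, 0, 1, vector [1, 0], 0) = germ_id" "(1, 0, 1, vector [1, 0], 0) \<in> Gamma' eps"
proof -
  have "sigma'_map eps (1, 0, 1, vector [1, 0], 0) x = x" for x
  proof (rule vec3_eqI)
    show "first_two (sigma'_map eps (1, 0, 1, vector [1, 0], 0) x) = first_two x"
      unfolding sigma'_map_eq
      by (simp add: sigma'_fden_def herm_def Umap_def first_two_def vec_eq_iff forall_2)
    show "sigma'_map eps (1, 0, 1, vector [1, 0], 0) x $ 3 = x $ 3"
      unfolding sigma'_map_eq by (simp add: sigma'_fden_def herm_def)
  qed
  then have "sigma'_map eps (1, 0, 1, vector [1, 0], 0) = (\<lambda>x. x)" by (rule ext)
  then show "sigma' eps (1, 0, 1, vector [1, 0], 0) = germ_id"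
    by (simp only: sigma'_def germ_id.abs_eq)
qed (simp add: Gamma'_def)

lemma sigma'_mult_inv:
  assumes "p \<in> Gamma' eps" shows "sigma'_mult eps (sigma'_inv eps p) p = (1, 0, 1, vector [1, 0], 0)"
proof -
  obtain l r u a c where p: "p = (l, r, u, a, c)" by (cases p)
  have a: "cmod u = 1" "(cmod (a $ 1))\<^sup>2 + eps * (cmod (a $ 2))\<^sup>2 = 1" and l: "l > 0"
    using assms by (simp_all add: p Gamma'_def)
  note u = unit_eqs[OF a]
  have lin: "Uinv eps u a (k *s x) = k *s Uinv eps u a x" for k x
    by (simp add: Uinv_def vec_eq_iff forall_2 algebra_simps)
  have V: "Uinv eps u a (of_real (- 1 / l) *s Umap eps u a c) = of_real (- 1 / l) *s c"
    by (simp only: lin Umap_Uinv[OF a])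
  have H: "Im (herm eps c (of_real (- 1 / l) *s c)) = 0"
    by (simp only: herm_linear) (simp add: Im_herm_self)
  have e: "vector [cnj (a $ 1) * a $ 1 - of_real eps * cnj u * (- (u * a $ 2)) * cnj (a $ 2),
      cnj u * (- (u * a $ 2)) * cnj (a $ 1) + cnj (a $ 1) * a $ 2] = (vector [1, 0] :: complex^2)"
  proof -
    have "cnj (a $ 1) * a $ 1 - of_real eps * cnj u * (- (u * a $ 2)) * cnj (a $ 2) =
      a $ 1 * cnj (a $ 1) + of_real eps * (u * cnj u) * (a $ 2 * cnj (a $ 2))"
      "cnj u * (- (u * a $ 2)) * cnj (a $ 1) + cnj (a $ 1) * a $ 2 =
      - (u * cnj u) * a $ 2 * cnj (a $ 1) + cnj (a $ 1) * a $ 2"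
      by (simp_all add: algebra_simps)
    then have "cnj (a $ 1) * a $ 1 - of_real eps * cnj u * (- (u * a $ 2)) * cnj (a $ 2) = 1"
      "cnj u * (- (u * a $ 2)) * cnj (a $ 1) + cnj (a $ 1) * a $ 2 = 0"
      using u by (simp_all only: mult_1_right) simp_all
    then show ?thesis by (simp only:)
  qed
  show ?thesis
    unfolding p sigma'_inv_def sigma'_mult_def split V H vector_2 e
    using l u by (simp add: vec_eq_iff mult.commute)
qed

lemma group_Iso3: "group (Iso3 eps)"
  unfolding Iso3_def
proof (rule group_germ_groupI)
  show "germ_comp x y \<in> sigma' eps ` Gamma' eps" if "x \<in> sigma' eps ` Gamma' eps" "y \<in> sigma' eps ` Gamma' eps" for x y
    using that sigma'_mult sigma'_mult_closed by force
  show "germ_id \<in> sigma' eps ` Gamma' eps"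
    using sigma'_one[of eps] by (metis imageI)
  show "\<exists>y\<in>sigma' eps ` Gamma' eps. germ_comp y x = germ_id" if "x \<in> sigma' eps ` Gamma' eps" for x
  proof -
    from that obtain p where p: "p \<in> Gamma' eps" "x = sigma' eps p" by blast
    then have "germ_comp (sigma' eps (sigma'_inv eps p)) x = germ_id"
      by (simp only: sigma'_mult sigma'_mult_inv sigma'_one)
    then show ?thesis using sigma'_inv_closed[OF p(1)] by blast
  qed
qed

lemma Iso3_simps: "carrier (Iso3 eps) = sigma' eps ` Gamma' eps" "x \<otimes>\<^bsub>Iso3 eps\<^esub> y = germ_comp x y"
  "\<one>\<^bsub>Iso3 eps\<^esub> = germ_id"
  by (simp_all add: Iso3_def germ_group_def)

lemma inv_Iso3: "p \<in> Gamma' eps \<Longrightarrow> inv\<^bsub>Iso3 eps\<^esub> (sigma' eps p) = sigma' eps (sigma'_inv eps p)"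
  by (rule group.inv_equality[OF group_Iso3])
     (auto simp: Iso3_simps sigma'_mult sigma'_mult_inv sigma'_one sigma'_inv_closed)

section \<open>The orbits of the normal forms lie in the class\<close>

lemma maps_into_abs_germ:
  assumes "germ_rel f f"
  shows "maps_into (abs_germ f) M M' \<longleftrightarrow> (\<forall>\<^sub>F x in nhds 0. x \<in> M \<longrightarrow> f x \<in> M')"
proof -
  have "(\<exists>U. open U \<and> 0 \<in> U \<and> f ` (U \<inter> M) \<subseteq> M') \<longleftrightarrow> (\<forall>\<^sub>F x in nhds 0. x \<in> M \<longrightarrow> f x \<in> M')"
    unfolding eventually_nhds by blast
  then show ?thesis using maps_into.abs_eq[OF assms] by simp
qed

lemma Im_divide_eq:
  assumes "Im (n * cnj d) = t" shows "Im (n / d) = t / (cmod d)\<^sup>2"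
  using assms by (simp add: complex_div_cnj[of n d] del: complex_mult_cnj)

text \<open>With \<open>\<delta>\<close> the denominator, \<open>Im(w/\<delta>) = Im(w \<delta>\<^sup>*)/|\<delta>|\<^sup>2\<close>, and expanding gives
  \<open>Im(w \<delta>\<^sup>*) = Im w - |z|\<^sup>2 + |z + cw|\<^sup>2\<close>.\<close>

lemma sigma_map_heisenberg:
  assumes "p \<in> Gamma"
  shows "x \<in> heisenberg2 \<Longrightarrow> sigma_map p x \<in> heisenberg2"
proof -
  assume x: "x \<in> heisenberg2"
  obtain l r u c where p: "p = (l, r, u, c)" by (cases p)
  have u: "cmod u = 1" and l: "l > 0" using assms by (simp_all add: p Gamma_def)
  define z w d where "z = x $ 1" and "w = x $ 2" and "d = sigma_den p x"
  have zw: "Im w = (cmod z)\<^sup>2" using x by (simp add: heisenberg2_def z_def w_def)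
  have d: "d = 1 - 2 * \<i> * cnj c * z + (of_real r - \<i> * of_real ((cmod c)\<^sup>2)) * w"
    by (simp add: d_def p sigma_den_def z_def w_def)
  have "(cmod (z + c * w))\<^sup>2 = (cmod z)\<^sup>2 + 2 * Re (c * cnj z * w) + (cmod c)\<^sup>2 * (cmod w)\<^sup>2"
    unfolding cmod_power2 by (simp add: power2_eq_square algebra_simps)
  moreover have "Im (w * cnj d) = Im w + 2 * Re (c * cnj z * w) + (cmod c)\<^sup>2 * (cmod w)\<^sup>2"
    unfolding d cmod_power2 by (simp add: power2_eq_square algebra_simps)
  ultimately have "Im (w * cnj d) = (cmod (z + c * w))\<^sup>2" by (simp add: zw)
  then have "Im (w / d) = (cmod (z + c * w))\<^sup>2 / (cmod d)\<^sup>2" by (rule Im_divide_eq)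
  moreover have "Im ((of_real l)\<^sup>2 * w / d) = l\<^sup>2 * Im (w / d)"
  proof -
    have "(of_real l)\<^sup>2 * w / d = of_real (l\<^sup>2) * (w / d)" by simp
    then show ?thesis by (simp only: Im_complex_of_real times_complex.sel Re_complex_of_real mult_zero_left add_0_right)
  qed
  moreover have "sigma_map p x $ 1 = of_real l * u * (z + c * w) / d" "sigma_map p x $ 2 = (of_real l)\<^sup>2 * w / d"
    by (simp_all add: p sigma_map_eq z_def w_def d_def)
  ultimately show ?thesis
    using u by (simp add: heisenberg2_def norm_mult norm_divide power_mult_distrib power_divide)
qed

lemma heisenberg3_herm: "x \<in> heisenberg3 eps \<longleftrightarrow> of_real (Im (x $ 3)) = herm eps (first_two x) (first_two x)"
proof -
  have "herm eps (first_two x) (first_two x) = of_real ((cmod (x $ 1))\<^sup>2 + eps * (cmod (x $ 2))\<^sup>2)"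
    by (simp add: herm_self first_two_def)
  then show ?thesis unfolding heisenberg3_def by (simp only: of_real_eq_iff mem_Collect_eq)
qed

lemma sigma'_map_heisenberg:
  assumes "p \<in> Gamma' eps"
  shows "x \<in> heisenberg3 eps \<Longrightarrow> sigma'_map eps p x \<in> heisenberg3 eps"
proof -
  assume x: "x \<in> heisenberg3 eps"
  obtain l r u a c where p: "p = (l, r, u, a, c)" by (cases p)
  have u: "cmod u = 1" "(cmod (a $ 1))\<^sup>2 + eps * (cmod (a $ 2))\<^sup>2 = 1" and l: "l > 0"
    using assms by (simp_all add: p Gamma'_def)
  define z w d where "z = first_two x" and "w = x $ 3" and "d = sigma'_fden eps p x"
  have zw: "of_real (Im w) = herm eps z z" using x by (simp add: heisenberg3_herm z_def w_def)
  have d: "d = 1 - 2 * \<i> * herm eps z c + (of_real r - \<i> * herm eps c c) * w"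
    by (simp add: d_def p sigma'_fden_def z_def w_def)
  have "w * cnj d - cnj (w * cnj d) = 2 * \<i> * herm eps (z + w *s c) (z + w *s c)"
  proof -
    have zw': "w = cnj w + 2 * \<i> * herm eps z z"
      using zw[symmetric] by (simp add: complex_eq_iff)
    have "w * cnj d - cnj (w * cnj d) = w * (1 + 2 * \<i> * herm eps c z) - cnj w * (1 - 2 * \<i> * herm eps z c)
        + 2 * \<i> * herm eps c c * w * cnj w"
    proof -
      have "cnj (herm eps z c) = herm eps c z" "cnj (herm eps c z) = herm eps z c" "cnj (herm eps c c) = herm eps c c"
        by (rule herm_cnj[symmetric])+
      then show ?thesis unfolding d by (simp add: algebra_simps)
    qed
    also have "\<dots> = 2 * \<i> * herm eps (z + w *s c) (z + w *s c)"
      unfolding herm_linear using zw' by (simp add: algebra_simps)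
    finally show ?thesis .
  qed
  moreover have "w * cnj d - cnj (w * cnj d) = 2 * \<i> * of_real (Im (w * cnj d))"
    by (simp add: complex_eq_iff)
  ultimately have I: "of_real (Im (w * cnj d)) = herm eps (z + w *s c) (z + w *s c)" by simp
  then have "of_real (Im (w / d)) = herm eps (z + w *s c) (z + w *s c) / of_real ((cmod d)\<^sup>2)"
    by (simp only: Im_divide_eq[OF refl] of_real_divide)
  moreover have "of_real (Im ((of_real l)\<^sup>2 * w / d)) = (of_real l)\<^sup>2 * complex_of_real (Im (w / d))"
  proof -
    have "(of_real l)\<^sup>2 * w / d = of_real (l\<^sup>2) * (w / d)" by simp
    then have "Im ((of_real l)\<^sup>2 * w / d) = l\<^sup>2 * Im (w / d)"
      by (simp only: Im_complex_of_real times_complex.sel Re_complex_of_real mult_zero_left add_0_right)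
    then show ?thesis by simp
  qed
  moreover have "first_two (sigma'_map eps p x) = (of_real l / d) *s Umap eps u a (z + w *s c)"
     "sigma'_map eps p x $ 3 = (of_real l)\<^sup>2 * w / d"
    by (simp_all only: p sigma'_map_eq z_def w_def d_def)
  moreover have "herm eps (Umap eps u a y) (Umap eps u a y) = herm eps y y" for y
    by (simp only: herm_Umap Umap_Uinv[OF u])
  ultimately show ?thesis
    unfolding heisenberg3_herm
    by (simp add: herm_linear complex_norm_square[symmetric] power2_eq_square field_simps of_real_cmod_square[symmetric])
qed

lemma quotient_heisenberg3:
  assumes "P3 * cnj Q - Q * cnj P3 = 2 * \<i> * (P1 * cnj P1 + of_real eps * (P2 * cnj P2))"
  shows "vector [P1 / Q, P2 / Q, P3 / Q] \<in> heisenberg3 eps"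
proof -
  have "P3 * cnj Q - Q * cnj P3 = 2 * \<i> * of_real (Im (P3 * cnj Q))"
    by (simp add: complex_eq_iff)
  then have "complex_of_real (Im (P3 * cnj Q)) = P1 * cnj P1 + of_real eps * (P2 * cnj P2)" using assms by simp
  also have "\<dots> = of_real ((cmod P1)\<^sup>2 + eps * (cmod P2)\<^sup>2)"
    by (simp only: of_real_add of_real_mult complex_norm_square)
  finally have "Im (P3 * cnj Q) = (cmod P1)\<^sup>2 + eps * (cmod P2)\<^sup>2" by (simp only: of_real_eq_iff)
  from Im_divide_eq[OF this] show ?thesis
    by (simp add: heisenberg3_def norm_divide power_divide add_divide_distrib)
qed

text \<open>Substituting \<open>w = \<i>v\<close> turns the normal forms into quotients with real coefficients, up to a factor
  \<open>\<i>\<close> in the last component, and the source hyperquadric into \<open>v + v\<^sup>* = 2zz\<^sup>*\<close>. The mapping property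
  then becomes a polynomial identity in independent variables \<open>z, Z, v\<close>, with \<open>V = 2zZ - v\<close>.\<close>

lemma quotient_heisenberg3_real:
  assumes "2 * (P1 * cnj P1 + of_real eps * (P2 * cnj P2)) = p * cnj Q + cnj p * Q" "P3 = \<i> * p"
  shows "vector [P1 / Q, P2 / Q, P3 / Q] \<in> heisenberg3 eps"
proof (rule quotient_heisenberg3)
  have "P3 * cnj Q - Q * cnj P3 = \<i> * (p * cnj Q + cnj p * Q)"
    unfolding assms(2) by (simp add: algebra_simps)
  then show "P3 * cnj Q - Q * cnj P3 = 2 * \<i> * (P1 * cnj P1 + of_real eps * (P2 * cnj P2))"
    by (simp only: assms(1)[symmetric] mult.left_commute mult.assoc)
qed

lemma heisenberg2_real_form:
  assumes "x \<in> heisenberg2"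
  obtains v where "x $ 2 = \<i> * v" "cnj v = 2 * (x $ 1 * cnj (x $ 1)) - v"
proof (rule that[of "- \<i> * x $ 2"])
  show "x $ 2 = \<i> * (- \<i> * x $ 2)" by simp
  have "Im (x $ 2) = (Re (x $ 1))\<^sup>2 + (Im (x $ 1))\<^sup>2"
    using assms by (simp add: heisenberg2_def cmod_power2)
  then show "cnj (- \<i> * x $ 2) = 2 * (x $ 1 * cnj (x $ 1)) - (- \<i> * x $ 2)"
    by (simp add: complex_eq_iff power2_eq_square)
qed

(*CUT*)
lemma G2_identity:
  fixes z Z v s e :: complex
  assumes "e = 1 \<or> e = -1" and V: "V = 2 * (z * Z) - v"
  shows "2 * ((4 * z - 4 * e * s * z^2 - (e - s^2) * z * v - s * v^2) * (4 * Z - 4 * e * s * Z^2 - (e - s^2) * Z * V - s * V^2)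
    + e * ((4 * z^2 - s^2 * v^2) * (4 * Z^2 - s^2 * V^2))) =
    ((v * (4 - 4 * e * s * z + (e + s^2) * v)) * (4 - 4 * e * s * Z + (e + s^2) * V + 2 * s * Z * V + e * s^2 * V^2)
    + (V * (4 - 4 * e * s * Z + (e + s^2) * V)) * (4 - 4 * e * s * z + (e + s^2) * v + 2 * s * z * v + e * s^2 * v^2))"
  using assms(1)
proof
  assume e: "e = 1" show ?thesis unfolding V e by algebra
next
  assume e: "e = -1" show ?thesis unfolding V e by algebra
qed

lemma G3_identity:
  fixes z Z v s e :: complex
  assumes "e = 1 \<or> e = -1" and V: "V = 2 * (z * Z) - v"
  shows "2 * ((256 * e * z - 96 * z * v - 64 * e * s * v^2 + 64 * z^3 - 64 * e * s * z^2 * v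
                 + 3 * (3 * e - 16 * s^2) * z * v^2 + 4 * s * v^3) *
         (256 * e * Z - 96 * Z * V - 64 * e * s * V^2 + 64 * Z^3 - 64 * e * s * Z^2 * V
                 + 3 * (3 * e - 16 * s^2) * Z * V^2 + 4 * s * V^3)
   + e * ((256 * e * z^2 + 16 * v^2 + 256 * s * z^3 - 16 * z^2 * v + 16 * e * s * z * v^2 - e * v^3) *
      (256 * e * Z^2 + 16 * V^2 + 256 * s * Z^3 - 16 * Z^2 * V + 16 * e * s * Z * V^2 - e * V^3))) =
   ((v * (256 * e + 32 * v + 64 * z^2 + 64 * e * s * z * v + (e + 16 * s^2) * v^2)) *
    (256 * e + 32 * V + 64 * Z^2 + 192 * e * s * Z * V + (17 * e + 144 * s^2) * V^2
                - 32 * e * Z^2 * V - 24 * s * Z * V^2 + V^3)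
   + (V * (256 * e + 32 * V + 64 * Z^2 + 64 * e * s * Z * V + (e + 16 * s^2) * V^2)) *
    (256 * e + 32 * v + 64 * z^2 + 192 * e * s * z * v + (17 * e + 144 * s^2) * v^2
                - 32 * e * z^2 * v - 24 * s * z * v^2 + v^3))"
  using assms(1)
proof
  assume e: "e = 1" show ?thesis unfolding V e by algebra
next
  assume e: "e = -1" show ?thesis unfolding V e by algebra
qed

lemma G2_map_heisenberg:
  assumes "eps = 1 \<or> eps = -1"
  shows "x \<in> heisenberg2 \<Longrightarrow> G2_map eps s x \<in> heisenberg3 eps"
proof -
  assume "x \<in> heisenberg2"
  then obtain v where v: "x $ 2 = \<i> * v" "cnj v = 2 * (x $ 1 * cnj (x $ 1)) - v"
    by (rule heisenberg2_real_form)
  have e: "complex_of_real eps = 1 \<or> complex_of_real eps = -1" using assms by auto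
  define z where "z = x $ 1"
  define V where "V = cnj v"
  have V: "V = 2 * (z * cnj z) - v" using v by (simp add: V_def z_def)
  show ?thesis unfolding G2_map_def Let_def
    by (rule quotient_heisenberg3_real[where p = "v * (4 - 4 * of_real eps * s * z + (of_real eps + s^2) * v)"])
       (use G2_identity[OF e V, of "of_real s"] in \<open>simp_all add: v(1) z_def[symmetric] V_def[symmetric] power_mult_distrib
         algebra_simps\<close>)
qed

lemma G3_map_heisenberg:
  assumes "eps = 1 \<or> eps = -1"
  shows "x \<in> heisenberg2 \<Longrightarrow> G3_map eps s x \<in> heisenberg3 eps"
proof -
  assume "x \<in> heisenberg2"
  then obtain v where v: "x $ 2 = \<i> * v" "cnj v = 2 * (x $ 1 * cnj (x $ 1)) - v"
    by (rule heisenberg2_real_form)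
  have e: "complex_of_real eps = 1 \<or> complex_of_real eps = -1" using assms by auto
  define z S E where "z = x $ 1" and "S = complex_of_real s" and "E = complex_of_real eps"
  define n1 where "n1 = (\<lambda>z v. 256 * E * z - 96 * z * v - 64 * E * S * v^2 + 64 * z^3 - 64 * E * S * z^2 * v
                 + 3 * (3 * E - 16 * S^2) * z * v^2 + 4 * S * v^3)"
  define n2 where "n2 = (\<lambda>z v. 256 * E * z^2 + 16 * v^2 + 256 * S * z^3 - 16 * z^2 * v
                 + 16 * E * S * z * v^2 - E * v^3)"
  define n3 where "n3 = (\<lambda>z v. v * (256 * E + 32 * v + 64 * z^2 + 64 * E * S * z * v + (E + 16 * S^2) * v^2))"
  define q where "q = (\<lambda>z v. 256 * E + 32 * v + 64 * z^2 + 192 * E * S * z * v + (17 * E + 144 * S^2) * v^2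
                - 32 * E * z^2 * v - 24 * S * z * v^2 + v^3)"
  have cn: "cnj (n1 z v) = n1 (cnj z) (cnj v)" "cnj (n2 z v) = n2 (cnj z) (cnj v)"
    "cnj (n3 z v) = n3 (cnj z) (cnj v)" "cnj (q z v) = q (cnj z) (cnj v)"
    by (simp_all add: n1_def n2_def n3_def q_def S_def E_def)
  have G: "G3_map eps s x = vector [n1 z v / q z v, n2 z v / q z v, (\<i> * n3 z v) / q z v]"
  proof -
    have "q z v = 256 * E - 32 * \<i> * x $ 2 + 64 * x $ 1^2 - 192 * \<i> * E * S * x $ 1 * x $ 2
        - (17 * E + 144 * S^2) * x $ 2^2 + 32 * \<i> * E * x $ 1^2 * x $ 2 + 24 * S * x $ 1 * x $ 2^2 + \<i> * x $ 2^3"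
      "n1 z v = 256 * E * x $ 1 + 96 * \<i> * x $ 1 * x $ 2 + 64 * E * S * x $ 2^2 + 64 * x $ 1^3
        + 64 * \<i> * E * S * x $ 1^2 * x $ 2 - 3 * (3 * E - 16 * S^2) * x $ 1 * x $ 2^2 + 4 * \<i> * S * x $ 2^3"
      "n2 z v = 256 * E * x $ 1^2 - 16 * x $ 2^2 + 256 * S * x $ 1^3 + 16 * \<i> * x $ 1^2 * x $ 2
        - 16 * E * S * x $ 1 * x $ 2^2 - \<i> * E * x $ 2^3"
      "\<i> * n3 z v = x $ 2 * (256 * E - 32 * \<i> * x $ 2 + 64 * x $ 1^2 - 64 * \<i> * E * S * x $ 1 * x $ 2
        - (E + 16 * S^2) * x $ 2^2)"
      by (simp_all add: q_def n1_def n2_def n3_def v(1) z_def power_mult_distrib power3_eq_cube[of \<i>]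
          algebra_simps)
    then show ?thesis by (simp only: G3_map_def Let_def S_def E_def)
  qed
  show ?thesis unfolding G
  proof (rule quotient_heisenberg3_real[OF _ refl])
    have V: "cnj v = 2 * (z * cnj z) - v" using v by (simp add: z_def)
    show "2 * (n1 z v * cnj (n1 z v) + of_real eps * (n2 z v * cnj (n2 z v))) =
      n3 z v * cnj (q z v) + cnj (n3 z v) * q z v"
      unfolding cn using G3_identity[OF e[folded E_def] V, of S]
      by (simp only: n1_def n2_def n3_def q_def E_def)
  qed
qed

section \<open>Parametrizing the orbits\<close>

text \<open>The normal form with parameters \<open>(s, b)\<close>. The two cases overlap only for \<open>\<epsilon> = -1\<close>, \<open>s = 1/2\<close>, where
  the two normal forms are the same germ.\<close>

definition slice_map :: "real \<Rightarrow> real \<Rightarrow> real \<Rightarrow> complex^2 \<Rightarrow> complex^3" where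
  "slice_map eps s b = (if b = s\<^sup>2 / 4 then G2_map eps s else G3_map eps s)"

definition slice_params :: "real \<Rightarrow> (real \<times> real) set" where
  "slice_params eps = {(s, b). s > 0 \<and> (b = s\<^sup>2 / 4 \<or> b = - eps / 16)}"

lemma germ_rel_slice_map: "eps \<noteq> 0 \<Longrightarrow> germ_rel (slice_map eps s b) (slice_map eps s b)"
  by (simp add: slice_map_def germ_rel_G2_map germ_rel_G3_map)

text \<open>Numerators and denominator of \<open>G3\<close> are those of \<open>G2\<close> times the linear factor \<open>- 64 + 32z + 4\<i>w\<close>.
  Without this coincidence \<open>jet0\<close> would not separate the two germs.\<close>

lemma G2_eq_G3_at_half: "abs_germ (G2_map (-1) (1 / 2)) = abs_germ (G3_map (-1) (1 / 2))"
proof (rule abs_germ_eqI)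
  define f :: "complex^2 \<Rightarrow> complex" where "f = (\<lambda>x. - 64 + 32 * x $ 1 + 4 * \<i> * x $ 2)"
  have "scalar_holo_at f 0" unfolding f_def by (intro scalar_holo_at_intros)
  moreover have "f 0 \<noteq> 0" by (simp add: f_def)
  ultimately have "\<forall>\<^sub>F x in nhds 0. f x \<noteq> 0" by (rule scalar_holo_at_imp_ev_nonzero)
  then show "\<forall>\<^sub>F x in nhds 0. G2_map (-1) (1 / 2) x = G3_map (-1) (1 / 2) x"
  proof eventually_elim
    case (elim x)
    have c: "a = f x * a' \<Longrightarrow> b = f x * b' \<Longrightarrow> a' / b' = a / b" for a b a' b' using elim by simp
    show ?case unfolding G2_map_def G3_map_def Let_def
      by (simp only: vec_eq_iff forall_3 vector_3, intro conjI; rule c)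
         (simp_all add: f_def power2_eq_square power3_eq_cube field_simps)
  qed
qed (simp_all add: germ_rel_G2_map germ_rel_G3_map)

lemma slice_params_overlap:
  fixes eps s :: real
  assumes "eps = 1 \<or> eps = -1" "s > 0" "- eps / 16 = s\<^sup>2 / 4"
  shows "eps = -1" "s = 1 / 2"
proof -
  have s: "s\<^sup>2 = - eps / 4" using assms(3) by simp
  then have "eps \<noteq> 1" using zero_le_power2[of s] by auto
  then show "eps = -1" using assms(1) by simp
  then have "s\<^sup>2 = (1 / 2)\<^sup>2" using s by (simp add: power2_eq_square)
  then show "s = 1 / 2" using assms(2) by (simp add: power2_eq_iff_nonneg)
qed

lemma normal_forms_eq:
  assumes "eps = 1 \<or> eps = -1"
  shows "normal_forms eps = (\<lambda>(s, b). abs_germ (slice_map eps s b)) ` slice_params eps"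
proof (intro equalityI subsetI)
  fix H assume "H \<in> normal_forms eps"
  then consider s where "s > 0" "H = abs_germ (G2_map eps s)" | s where "s > 0" "H = abs_germ (G3_map eps s)"
    by (auto simp: normal_forms_def)
  then show "H \<in> (\<lambda>(s, b). abs_germ (slice_map eps s b)) ` slice_params eps"
  proof cases
    case 1
    then show ?thesis
      by (intro image_eqI[of _ _ "(s, s\<^sup>2 / 4)"]) (auto simp: slice_map_def slice_params_def)
  next
    case 2
    have "H = abs_germ (slice_map eps s (- eps / 16))"
    proof (cases "- eps / 16 = s\<^sup>2 / 4")
      case True
      note v = slice_params_overlap[OF assms 2(1) True]
      show ?thesis unfolding 2(2) slice_map_def v
        using G2_eq_G3_at_half by (simp add: power2_eq_square)
    qed (use 2 in \<open>simp add: slice_map_def\<close>)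
    then show ?thesis
      using 2 by (intro image_eqI[of _ _ "(s, - eps / 16)"]) (auto simp: slice_params_def)
  qed
next
  fix H assume "H \<in> (\<lambda>(s, b). abs_germ (slice_map eps s b)) ` slice_params eps"
  then show "H \<in> normal_forms eps"
    by (auto simp: normal_forms_def slice_params_def slice_map_def)
qed

lemma has_jet_source:
  "has_jet (\<lambda>x. sigma_map p x $ 1) (fst (source_jets p))" "has_jet (\<lambda>x. sigma_map p x $ 2) (snd (source_jets p))"
proof -
  obtain l r u c where p: "p = (l, r, u, c)" by (cases p)
  show "has_jet (\<lambda>x. sigma_map p x $ 1) (fst (source_jets p))" "has_jet (\<lambda>x. sigma_map p x $ 2) (snd (source_jets p))"
    using has_jet_sigma_map[where l = l and r = r and u = u and c = c]
    by (simp_all add: p source_jets_def Let_def)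
qed

lemma has_jet_slice_map:
  assumes "eps = 1 \<or> eps = -1" "(s, b) \<in> slice_params eps"
  shows "has_jet (\<lambda>x. slice_map eps s b (sigma_map p x) $ i)
    (model_jet eps s b i (fst (source_jets p)) (snd (source_jets p)))"
proof -
  obtain l r u c where p: "p = (l, r, u, c)" by (cases p)
  note y = has_jet_source[of p]
  obtain a1 a2 a3 a4 a5 a6 b2 b4 b5 b6 where s: "fst (source_jets p) = TJ 0 a1 a2 a3 a4 a5 a6"
     "snd (source_jets p) = TJ 0 0 b2 0 b4 b5 b6"
    by (simp add: p source_jets_def Let_def)
  note y' = y[unfolded s]
  show ?thesis
  proof (cases "b = s\<^sup>2 / 4")
    case True
    show ?thesis unfolding slice_map_def s if_P[OF True]
      using has_jet_G2[OF y' assms(1), of s i] by (simp only: True)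
  next
    case False
    then have "b = - eps / 16" using assms(2) by (simp add: slice_params_def)
    then show ?thesis unfolding slice_map_def s if_not_P[OF False]
      using has_jet_G3[OF y' assms(1), of s i] by (simp only:)
  qed
qed

text \<open>All elements of \<open>frakF\<close>, with the source isotropy written as a right factor instead of the
  inverse of one. The model map has the same truncated jets and is a single
  rational family, although the underlying map changes its formula between the two branches of \<open>slice_params\<close>.\<close>

definition param_germ :: "real \<Rightarrow> params \<times> params' \<times> (real \<times> real) \<Rightarrow> (2, 3) germ" where
  "param_germ eps = (\<lambda>(p, q, (s, b)). germ_comp (sigma' eps q) (germ_comp (abs_germ (slice_map eps s b)) (sigma p)))"

definition param_map :: "real \<Rightarrow> params \<times> params' \<times> (real \<times> real) \<Rightarrow> complex^2 \<Rightarrow> complex^3" where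
  "param_map eps = (\<lambda>(p, q, (s, b)) x. sigma'_map eps q (slice_map eps s b (sigma_map p x)))"

definition model_map :: "real \<Rightarrow> params \<times> params' \<times> (real \<times> real) \<Rightarrow> complex^2 \<Rightarrow> complex^3" where
  "model_map eps = (\<lambda>(p, q, (s, b)) x. sigma'_map eps q (G_model eps s b (sigma_map p x)))"

abbreviation "all_params eps \<equiv> Defs.Gamma \<times> Gamma' eps \<times> slice_params eps"

lemma germ_rel_param_map:
  assumes "eps \<noteq> 0" shows "germ_rel (param_map eps P) (param_map eps P)"
proof (cases P)
  case (fields p q s b)
  have "param_map eps P = sigma'_map eps q \<circ> (slice_map eps s b \<circ> sigma_map p)"
    by (simp add: fields param_map_def fun_eq_iff)
  then show ?thesis
    by (simp add: germ_rel_comp germ_rel_sigma'_map germ_rel_sigma_map germ_rel_slice_map assms)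
qed

lemma param_germ_eq:
  assumes "eps \<noteq> 0" shows "param_germ eps P = abs_germ (param_map eps P)"
proof (cases P)
  case (fields p q s b)
  have "param_map eps P = sigma'_map eps q \<circ> (slice_map eps s b \<circ> sigma_map p)"
    by (simp add: fields param_map_def fun_eq_iff)
  then show ?thesis
    by (simp add: fields param_germ_def sigma_def sigma'_def germ_comp_abs_germ germ_rel_comp
        germ_rel_sigma'_map germ_rel_sigma_map germ_rel_slice_map assms)
qed

lemma param_germ_recover:
  assumes eps: "eps = 1 \<or> eps = -1" and P: "P \<in> all_params eps"
  shows "jet0 (param_germ eps P) \<in> recover_domain eps" "recover eps (jet0 (param_germ eps P)) = P"
    "germ_partial (param_germ eps P) 3 [2] \<in> \<real>"
proof -
  obtain l r u c l' r' u' a' c' s b where P': "P = ((l, r, u, c), (l', r', u', a', c'), (s, b))"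
    by (cases P) auto
  have dom: "l > 0" "l' > 0" "s > 0" "cmod u = 1" "cmod u' = 1"
    "(cmod (a' $ 1))\<^sup>2 + eps * (cmod (a' $ 2))\<^sup>2 = 1" "(s, b) \<in> slice_params eps"
    using P by (auto simp: P' Gamma_def Gamma'_def slice_params_def)
  have eps0: "eps \<noteq> 0" using eps by auto
  obtain X1 X2 X3 where X:
    "has_jet (\<lambda>x. param_map eps P x $ 1) (jconst (l' * u' * a' $ 1) * X1 - jconst (l' * eps * u' * a' $ 2) * X2)"
    "has_jet (\<lambda>x. param_map eps P x $ 2) (jconst (l' * cnj (a' $ 2)) * X1 + jconst (l' * cnj (a' $ 1)) * X2)"
    "has_jet (\<lambda>x. param_map eps P x $ 3) (jconst (l'\<^sup>2) * X3)"
    and eqs: "jet_of (jconst (l' * u' * a' $ 1) * X1 - jconst (l' * eps * u' * a' $ 2) * X2)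
      (jconst (l' * cnj (a' $ 2)) * X1 + jconst (l' * cnj (a' $ 1)) * X2) (jconst (l'\<^sup>2) * X3) \<in> recover_domain eps"
      "recover eps (jet_of (jconst (l' * u' * a' $ 1) * X1 - jconst (l' * eps * u' * a' $ 2) * X2)
      (jconst (l' * cnj (a' $ 2)) * X1 + jconst (l' * cnj (a' $ 1)) * X2) (jconst (l'\<^sup>2) * X3)) = P"
      "j01 X3 = l\<^sup>2"
  proof (rule composite_jet_equations[OF has_jet_slice_map[OF eps dom(7)], where l = l and r = r and u = u and c = c and l' = l'
        and r' = r' and u' = u' and a' = a' and c' = c'], goal_cases)
    case (1 X1 X2 X3)
    \<comment> \<open>The indices select the equations in the order of the assumptions of the recovery lemma.\<close>
    note J = recover_composite_jet[OF dom(1-6) 1(8,9,11-13,14-19) refl refl refl]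
    show ?case
    proof (rule that[of X1 X2 X3])
      show "j01 X3 = l\<^sup>2" by (rule 1(13))
    qed (use J 1(2-4) in \<open>simp_all add: P' param_map_def\<close>)
  qed
  define T where "T = (\<lambda>k::3. if k = 1 then jconst (l' * u' * a' $ 1) * X1 - jconst (l' * eps * u' * a' $ 2) * X2
    else if k = 2 then jconst (l' * cnj (a' $ 2)) * X1 + jconst (l' * cnj (a' $ 1)) * X2 else jconst (l'\<^sup>2) * X3)"
  have T: "trunc_jet (\<lambda>x. param_map eps P x $ k) = T k" for k
    using exhaust_3[of k] X by (auto simp: T_def has_jet_def)
  have J: "jet0 (param_germ eps P) = jet_of (T 1) (T 2) (T 3)"
    unfolding param_germ_eq[OF eps0] by (rule jet0_abs_germ[OF germ_rel_param_map[OF eps0] T])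
  show "jet0 (param_germ eps P) \<in> recover_domain eps" "recover eps (jet0 (param_germ eps P)) = P"
    unfolding J using eqs by (simp_all add: T_def)
  have "germ_partial (param_germ eps P) 3 [2] = j01 (T 3)"
    unfolding param_germ_eq[OF eps0] germ_partial.abs_eq[OF germ_rel_param_map[OF eps0]] T[symmetric]
    by (simp add: trunc_jet_def)
  also have "\<dots> = of_real (l'\<^sup>2 * l\<^sup>2)" by (simp add: T_def jconst_def tjet_ops eqs)
  finally show "germ_partial (param_germ eps P) 3 [2] \<in> \<real>" by simp
qed

lemma param_germ_class_F:
  assumes eps: "eps = 1 \<or> eps = -1" and P: "P \<in> all_params eps"
  shows "param_germ eps P \<in> class_F eps"
proof -
  obtain p q s b where P': "P = (p, q, (s, b))" by (cases P) auto
  have eps0: "eps \<noteq> 0" using eps by auto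
  have pq: "p \<in> Gamma" "q \<in> Gamma' eps" using P by (auto simp: P')
  have "x \<in> heisenberg2 \<Longrightarrow> param_map eps P x \<in> heisenberg3 eps" for x
    using sigma_map_heisenberg[OF pq(1)] sigma'_map_heisenberg[OF pq(2)]
      G2_map_heisenberg[OF eps] G3_map_heisenberg[OF eps]
    by (simp add: P' param_map_def slice_map_def)
  then have "maps_into (param_germ eps P) heisenberg2 (heisenberg3 eps)"
    unfolding param_germ_eq[OF eps0] maps_into_abs_germ[OF germ_rel_param_map[OF eps0]] by simp
  moreover have "Re (germ_partial (param_germ eps P) 3 [2]) > 0"
     "germ_partial (param_germ eps P) 1 [1] * germ_partial (param_germ eps P) 2 [1,1]
           - germ_partial (param_germ eps P) 2 [1] * germ_partial (param_germ eps P) 1 [1,1] \<noteq> 0"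
    using param_germ_recover(1)[OF eps P]
    by (auto simp: recover_domain_def rec_g_def rec_D_def jet0_def Let_def jf10_def jH01_def jf20_def)
  ultimately show ?thesis
    using param_germ_recover(3)[OF eps P] by (simp add: class_F_def)
qed

text \<open>The truncated jet of a composite with \<open>\<sigma>'\<close> on the left is a function of the jets of the inner
  components, which allows replacing normal forms by their model.\<close>

lemma trunc_jet_sigma'_map_cong:
  assumes "\<And>k. has_jet (\<lambda>x. H x $ k) (F k)" "\<And>k. has_jet (\<lambda>x. H' x $ k) (F k)" "\<And>k. j00 (F k) = 0"
  shows "trunc_jet (\<lambda>x. sigma'_map eps q (H x) $ k) = trunc_jet (\<lambda>x. sigma'_map eps q (H' x) $ k)"
proof -
  obtain l r u a c where q: "q = (l, r, u, a, c)" by (cases q)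
  define D where "D = sigma'_den eps q (F 1) (F 2) (F 3)"
  have "j00 D = 1" by (simp add: D_def q sigma'_den_def jconst_def tjet_ops assms(3))
  then have N: "(N * jinv D) * D = N" for N by (simp only: mult.assoc jinv mult_1_right)
  note J = has_jet_sigma'_map[where F = F and eps = eps and l = l and r = r and u = u and a = a and c = c,
      OF _ assms(3), folded q, folded D_def, OF _ N N N]
  show ?thesis using exhaust_3[of k] J[OF assms(1)] J[OF assms(2)] by (auto simp: has_jet_def)
qed

lemma trunc_jet_model_map:
  assumes eps: "eps = 1 \<or> eps = -1" and P: "P \<in> all_params eps"
  shows "trunc_jet (\<lambda>x. param_map eps P x $ k) = trunc_jet (\<lambda>x. model_map eps P x $ k)"
proof -
  obtain p q s b where P': "P = (p, q, (s, b))" by (cases P) auto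
  obtain l r u c where p: "p = (l, r, u, c)" by (cases p)
  note y = has_jet_source[of p]
  have "(s, b) \<in> slice_params eps" using P by (simp add: P')
  note 1 = has_jet_slice_map[OF eps this, of p] and 2 = has_jet_G_model[OF y, of eps s b]
  have "j00 (model_jet eps s b i (fst (source_jets p)) (snd (source_jets p))) = 0" for i
    by (simp add: model_jet_def p source_jets_def Let_def jconst_def tjet_ops)
  from trunc_jet_sigma'_map_cong[OF 1 2 this] show ?thesis by (simp add: P' param_map_def model_map_def)
qed

section \<open>A homeomorphism between parameters and maps\<close>

lemmas rational_family_intros = rational_family_const rational_family_nth rational_family_add
  rational_family_diff rational_family_uminus rational_family_mult rational_family_power

lemma rational_family_sigma_map:
  assumes "continuous_on S f" shows "rational_family S (\<lambda>P x. sigma_map (f P) x $ i)"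
proof -
  have den: "rational_family S (\<lambda>P x. sigma_den (f P) x)"
    unfolding sigma_den_def split_beta
    by (rule rational_family_intros | intro continuous_intros assms)+
  have nz: "sigma_den p 0 \<noteq> 0" for p by (simp add: sigma_den_def split_beta)
  have eqs: "sigma_map p x $ 1 = of_real (fst p) * fst (snd (snd p)) * (x $ 1 + snd (snd (snd p)) * x $ 2) / sigma_den p x"
     "sigma_map p x $ 2 = (of_real (fst p))\<^sup>2 * x $ 2 / sigma_den p x" for p x
    by (cases p; simp add: sigma_map_eq)+
  have "rational_family S (\<lambda>P x. sigma_map (f P) x $ 1)"
    unfolding eqs
    by (rule rational_family_divide[OF _ den nz], (rule rational_family_intros | intro continuous_intros assms)+)
  moreover have "rational_family S (\<lambda>P x. sigma_map (f P) x $ 2)"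
    unfolding eqs
    by (rule rational_family_divide[OF _ den nz], (rule rational_family_intros | intro continuous_intros assms)+)
  ultimately show ?thesis using exhaust_2[of i] by auto
qed

lemma rational_family_G_model:
  assumes y: "\<And>i. rational_family S (\<lambda>P x. y P x $ i)" and st: "continuous_on S s" "continuous_on S b"
  shows "rational_family S (\<lambda>P x. G_model eps (s P) (b P) (y P x) $ k)"
proof -
  have "rational_family S (\<lambda>P x. G_model eps (s P) (b P) (y P x) $ 1)"
    unfolding G_model_def Let_def vector_3
    by (rule y rational_family_intros | intro continuous_intros st | simp)+
  moreover have "rational_family S (\<lambda>P x. G_model eps (s P) (b P) (y P x) $ 2)"
    unfolding G_model_def Let_def vector_3
    by (rule y rational_family_intros | intro continuous_intros st | simp)+
  moreover have "rational_family S (\<lambda>P x. G_model eps (s P) (b P) (y P x) $ 3)"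
    unfolding G_model_def Let_def vector_3 by (rule y)
  ultimately show ?thesis using exhaust_3[of k] by auto
qed

lemma rational_family_sigma'_map:
  assumes y: "\<And>i. rational_family S (\<lambda>P x. y P x $ i)" and y0: "\<And>P. P \<in> S \<Longrightarrow> y P 0 = 0"
    and q: "continuous_on S q"
  shows "rational_family S (\<lambda>P x. sigma'_map eps (q P) (y P x) $ k)"
proof -
  define den where "den = (\<lambda>(l::real, r::real, u::complex, a::complex^2, c::complex^2) (x::complex^3).
    1 - 2 * \<i> * (cnj (c $ 1) * x $ 1 + of_real eps * cnj (c $ 2) * x $ 2)
        + (of_real r - \<i> * of_real ((cmod (c $ 1))\<^sup>2 + eps * (cmod (c $ 2))\<^sup>2)) * x $ 3)"
  have den: "rational_family S (\<lambda>P x. den (q P) (y P x))"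
    unfolding den_def split_beta
    by (rule y rational_family_intros | intro continuous_intros q)+
  have nz: "den (q P) (y P 0) \<noteq> 0" if "P \<in> S" for P using y0[OF that] by (simp add: den_def split_beta)
  define l u a c where "l = (\<lambda>q::params'. complex_of_real (fst q))" and "u = (\<lambda>q::params'. fst (snd (snd q)))"
    and "a = (\<lambda>q::params'. fst (snd (snd (snd q))))" and "c = (\<lambda>q::params'. snd (snd (snd (snd q))))"
  have cont: "continuous_on S (\<lambda>P. l (q P))" "continuous_on S (\<lambda>P. u (q P))" "continuous_on S (\<lambda>P. a (q P))"
    "continuous_on S (\<lambda>P. c (q P))"
    unfolding l_def u_def a_def c_def by (intro continuous_intros q)+
  have eqs: "sigma'_map eps p x $ 1 = (l p * u p * a p $ 1 * (x $ 1 + c p $ 1 * x $ 3)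
         - l p * of_real eps * u p * a p $ 2 * (x $ 2 + c p $ 2 * x $ 3)) / den p x"
     "sigma'_map eps p x $ 2 = (l p * cnj (a p $ 2) * (x $ 1 + c p $ 1 * x $ 3)
         + l p * cnj (a p $ 1) * (x $ 2 + c p $ 2 * x $ 3)) / den p x"
     "sigma'_map eps p x $ 3 = (l p)\<^sup>2 * x $ 3 / den p x" for p x
    by (cases p; simp add: sigma'_map_explicit den_def Let_def l_def u_def a_def c_def)+
  have "rational_family S (\<lambda>P x. sigma'_map eps (q P) (y P x) $ 1)"
    unfolding eqs
    by (rule rational_family_divide[OF _ den nz], (rule y rational_family_intros | intro continuous_intros cont | assumption)+)
  moreover have "rational_family S (\<lambda>P x. sigma'_map eps (q P) (y P x) $ 2)"
    unfolding eqs
    by (rule rational_family_divide[OF _ den nz], (rule y rational_family_intros | intro continuous_intros cont | assumption)+)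
  moreover have "rational_family S (\<lambda>P x. sigma'_map eps (q P) (y P x) $ 3)"
    unfolding eqs
    by (rule rational_family_divide[OF _ den nz], (rule y rational_family_intros | intro continuous_intros cont | assumption)+)
  ultimately show ?thesis using exhaust_3[of k] by auto
qed

lemma rational_family_model_map: "rational_family UNIV (\<lambda>P x. model_map eps P x $ k)"
proof -
  have "rational_family UNIV (\<lambda>P x. sigma'_map eps (fst (snd P))
      (G_model eps (fst (snd (snd P))) (snd (snd (snd P))) (sigma_map (fst P) x)) $ k)"
    by (intro rational_family_sigma'_map rational_family_G_model rational_family_sigma_map continuous_intros)
       (simp add: sigma_map_def Let_def split_beta G_model_def vec_eq_iff forall_3 vector_2)
  then show ?thesis by (simp add: model_map_def split_beta)
qed

lemma continuous_on_jet0_param_germ: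
  assumes eps: "eps = 1 \<or> eps = -1"
  shows "continuous_on (all_params eps) (\<lambda>P. jet0 (param_germ eps P))"
proof -
  define T where "T = (\<lambda>k P. trunc_jet (\<lambda>x. model_map eps P x $ k))"
  have c: "continuous_on (all_params eps) (\<lambda>P. fold complex_partial d (\<lambda>x. model_map eps P x $ k) 0)" for d k
    by (rule continuous_on_subset[OF rational_family_at0[OF rational_family_fold_partial[OF rational_family_model_map]]])
       simp
  have T: "continuous_on (all_params eps) (\<lambda>P. j10 (T k P))" "continuous_on (all_params eps) (\<lambda>P. j01 (T k P))"
    "continuous_on (all_params eps) (\<lambda>P. j20 (T k P))" "continuous_on (all_params eps) (\<lambda>P. j11 (T k P))"
    "continuous_on (all_params eps) (\<lambda>P. j02 (T k P))" "continuous_on (all_params eps) (\<lambda>P. j21 (T k P))" for k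
    unfolding T_def trunc_jet_def tjet.sel by (intro continuous_intros c; simp)+
  have "continuous_on (all_params eps) (\<lambda>P. jet_of (T 1 P) (T 2 P) (T 3 P))"
    unfolding jet_of_def
    by (intro continuous_on_Pair continuous_on_vector2 continuous_on_vector3 continuous_on_mult continuous_on_const T)
  moreover have "jet0 (param_germ eps P) = jet_of (T 1 P) (T 2 P) (T 3 P)" if "P \<in> all_params eps" for P
  proof -
    have "eps \<noteq> 0" using eps by auto
    from jet0_abs_germ[OF germ_rel_param_map[OF this], of P, OF trunc_jet_model_map[OF eps that]]
    show ?thesis unfolding param_germ_eq[OF \<open>eps \<noteq> 0\<close>] T_def .
  qed
  ultimately show ?thesis by (simp cong: continuous_on_cong)
qed

lemma frakF_eq:
  assumes eps: "eps = 1 \<or> eps = -1"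
  shows "frakF eps = param_germ eps ` all_params eps"
proof (intro equalityI subsetI)
  interpret I: group Iso2 by (rule group_Iso2)
  fix H assume "H \<in> frakF eps"
  then obtain G \<phi> \<phi>' where H: "H = germ_comp \<phi>' (germ_comp G (inv\<^bsub>Iso2\<^esub> \<phi>))"
    "G \<in> normal_forms eps" "\<phi> \<in> carrier Iso2" "\<phi>' \<in> carrier (Iso3 eps)"
    by (auto simp: frakF_def isotropy_group_def)
  obtain p where p: "p \<in> Gamma" "\<phi> = sigma p" using H(3) unfolding Iso2_simps by blast
  obtain q where q: "q \<in> Gamma' eps" "\<phi>' = sigma' eps q" using H(4) unfolding Iso3_simps by blast
  obtain s b where sb: "(s, b) \<in> slice_params eps" "G = abs_germ (slice_map eps s b)"
    using H(2) unfolding normal_forms_eq[OF eps] by auto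
  have "H = param_germ eps (sigma_inv p, q, (s, b))"
    unfolding H(1) p(2) inv_Iso2[OF p(1)] q(2) sb(2) by (simp add: param_germ_def)
  then show "H \<in> param_germ eps ` all_params eps"
    using sb q sigma_inv_closed[OF p(1)] by blast
next
  interpret I: group Iso2 by (rule group_Iso2)
  fix H assume "H \<in> param_germ eps ` all_params eps"
  then obtain p q s b where P: "p \<in> Gamma" "q \<in> Gamma' eps" "(s, b) \<in> slice_params eps"
    "H = param_germ eps (p, q, (s, b))" by auto
  have i: "sigma p \<in> carrier Iso2" using P by (simp add: Iso2_simps)
  have "H = germ_comp (sigma' eps q) (germ_comp (abs_germ (slice_map eps s b)) (inv\<^bsub>Iso2\<^esub> (inv\<^bsub>Iso2\<^esub> sigma p)))"
    using P i by (simp add: param_germ_def)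
  moreover have "(inv\<^bsub>Iso2\<^esub> sigma p, sigma' eps q) \<in> carrier (isotropy_group eps)"
    using P i by (simp add: isotropy_group_def Iso3_simps)
  moreover have "abs_germ (slice_map eps s b) \<in> normal_forms eps"
    unfolding normal_forms_eq[OF eps] using P(3) by (intro image_eqI[of _ _ "(s, b)"]) auto
  ultimately show "H \<in> frakF eps" unfolding frakF_def by blast
qed

lemma topspace_frakF:
  assumes "eps = 1 \<or> eps = -1" shows "topspace (topology_frakF eps) = frakF eps"
  using param_germ_class_F[OF assms]
  by (auto simp: topology_frakF_def topology_F_def topspace_pullback_topology frakF_eq[OF assms])

text \<open>Continuity in one direction holds since the jet is a rational family in the parameters, in the
  other since \<open>recover\<close> is continuous. In particular \<open>jet0\<close> is injective on \<open>frakF\<close>.\<close>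

lemma homeomorphic_maps_param_germ:
  assumes eps: "eps = 1 \<or> eps = -1"
  shows "homeomorphic_maps (top_of_set (all_params eps)) (topology_frakF eps)
    (param_germ eps) (\<lambda>H. recover eps (jet0 H))"
  unfolding homeomorphic_maps_def
proof (intro conjI ballI)
  show "continuous_map (top_of_set (all_params eps)) (topology_frakF eps) (param_germ eps)"
    unfolding topology_frakF_def topology_F_def continuous_map_in_subtopology
  proof (intro conjI continuous_map_pullback')
    show "continuous_map (top_of_set (all_params eps)) euclidean (jet0 \<circ> param_germ eps)"
      using continuous_on_jet0_param_germ[OF eps] by (simp add: comp_def)
  qed (use param_germ_class_F[OF eps] frakF_eq[OF eps] in auto)
  have "continuous_map (topology_frakF eps) euclidean (id \<circ> jet0)"
    unfolding topology_frakF_def topology_F_def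
    by (intro continuous_map_from_subtopology continuous_map_pullback) simp
  then have "continuous_map (topology_frakF eps) (top_of_set (recover_domain eps)) jet0"
    using param_germ_recover(1)[OF eps]
    by (auto simp: continuous_map_in_subtopology topspace_frakF[OF eps] frakF_eq[OF eps])
  moreover have "continuous_map (top_of_set (recover_domain eps)) euclidean (recover eps)"
    using continuous_on_recover by simp
  ultimately have "continuous_map (topology_frakF eps) euclidean (recover eps \<circ> jet0)"
    by (rule continuous_map_compose)
  then show "continuous_map (topology_frakF eps) (top_of_set (all_params eps)) (\<lambda>H. recover eps (jet0 H))"
    using param_germ_recover(2)[OF eps]
    by (auto simp: continuous_map_in_subtopology topspace_frakF[OF eps] frakF_eq[OF eps] comp_def)
qed (use param_germ_recover(2)[OF eps] in \<open>auto simp: topspace_frakF[OF eps] frakF_eq[OF eps]\<close>)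

lemma homeomorphic_maps_pullback_inv_into:
  assumes "inj_on f S"
  shows "homeomorphic_maps (top_of_set S) (pullback_topology (f ` S) (inv_into S f) (top_of_set S)) f (inv_into S f)"
proof -
  have ts: "topspace (pullback_topology (f ` S) (inv_into S f) (top_of_set S)) = f ` S"
    by (auto simp: topspace_pullback_topology inv_into_into)
  have "continuous_map (top_of_set S) (top_of_set S) (inv_into S f \<circ> f)"
    by (rule continuous_map_eq[OF continuous_map_id]) (simp add: inv_into_f_f[OF assms])
  then have "continuous_map (top_of_set S) (pullback_topology (f ` S) (inv_into S f) (top_of_set S)) f"
    by (rule continuous_map_pullback') auto
  moreover have "continuous_map (pullback_topology (f ` S) (inv_into S f) (top_of_set S)) (top_of_set S) (id \<circ> inv_into S f)"
    by (intro continuous_map_pullback continuous_map_id)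
  ultimately show ?thesis
    unfolding homeomorphic_maps_def ts using assms by (auto simp: inv_into_f_f f_inv_into_f)
qed

lemma param_germ_eqD:
  assumes "eps = 1 \<or> eps = -1" "P \<in> all_params eps" "P' \<in> all_params eps" "param_germ eps P = param_germ eps P'"
  shows "P = P'"
  by (metis param_germ_recover(2)[OF assms(1,2)] param_germ_recover(2)[OF assms(1,3)] assms(4))

lemma slice_params_nonempty: "(1, 1 / 4) \<in> slice_params eps"
  by (simp add: slice_params_def)

text \<open>An isotropy determines its parameters because a composite containing it does. The companion
  factors, the identity and the normal form with \<open>s = 1\<close>, \<open>b = 1/4\<close>, are an arbitrary choice.\<close>

lemma inj_on_sigma: "inj_on sigma Gamma"
proof (rule inj_onI)
  fix p p' assume p: "p \<in> Gamma" "p' \<in> Gamma" "sigma p = sigma p'"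
  have "(p, (1, 0, 1, vector [1, 0], 0) :: params', (1 :: real, 1 / 4 :: real)) =
      (p', (1, 0, 1, vector [1, 0], 0) :: params', (1 :: real, 1 / 4 :: real))"
    by (rule param_germ_eqD[of 1])
       (use p slice_params_nonempty sigma'_one(2) in \<open>simp_all add: param_germ_def\<close>)
  then show "p = p'" by simp
qed

lemma inj_on_sigma':
  assumes "eps = 1 \<or> eps = -1" shows "inj_on (sigma' eps) (Gamma' eps)"
proof (rule inj_onI)
  fix p p' assume p: "p \<in> Gamma' eps" "p' \<in> Gamma' eps" "sigma' eps p = sigma' eps p'"
  have "((1, 0, 1, 0) :: params, p, (1 :: real, 1 / 4 :: real)) =
      ((1, 0, 1, 0) :: params, p', (1 :: real, 1 / 4 :: real))"
    by (rule param_germ_eqD[OF assms])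
       (use p slice_params_nonempty sigma_one(2) in \<open>simp_all add: param_germ_def\<close>)
  then show "p = p'" by simp
qed

section \<open>Translation actions are free and proper\<close>

text \<open>The image of a closed set \<open>C\<close> is the part of the preimage of \<open>C\<close> under the left inverse on which the two maps \<open>f \<circ> g\<close> and
  \<open>id\<close> agree, and such coincidence sets are closed in a Hausdorff space.\<close>

lemma section_imp_proper_map:
  assumes f: "continuous_map X Y f" and g: "continuous_map Y X g"
    and gf: "\<And>x. x \<in> topspace X \<Longrightarrow> g (f x) = x" and Y: "Hausdorff_space Y"
  shows "proper_map X Y f"
proof (rule closed_injective_imp_proper_map)
  show "inj_on f (topspace X)" by (metis gf inj_onI)
  show "closed_map X Y f"
    unfolding closed_map_def
  proof (intro allI impI)
    fix C assume C: "closedin X C"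
    have "f ` C = {y \<in> topspace Y. (f \<circ> g) y = id y} \<inter> {y \<in> topspace Y. g y \<in> C}"
    proof (intro equalityI subsetI)
      fix y assume "y \<in> f ` C"
      then obtain x where x: "x \<in> C" "y = f x" by blast
      then have "x \<in> topspace X" using C closedin_subset by blast
      with x f gf show "y \<in> {y \<in> topspace Y. (f \<circ> g) y = id y} \<inter> {y \<in> topspace Y. g y \<in> C}"
        by (auto dest: continuous_map_funspace)
    next
      fix y assume "y \<in> {y \<in> topspace Y. (f \<circ> g) y = id y} \<inter> {y \<in> topspace Y. g y \<in> C}"
      then show "y \<in> f ` C" by (auto intro: rev_image_eqI)
    qed
    moreover have "closedin Y {y \<in> topspace Y. (f \<circ> g) y = id y}"
      by (intro closedin_continuous_maps_eq[OF Y] continuous_map_compose[OF g f] continuous_map_id)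
    moreover have "closedin Y {y \<in> topspace Y. g y \<in> C}"
      using C g by (rule closedin_continuous_map_preimage[rotated])
    ultimately show "closedin Y (f ` C)" by (simp only: closedin_Int)
  qed
qed

text \<open>If \<open>X\<close> is identified with \<open>G \<times> T\<close> such that the action is left translation in \<open>G\<close>, with \<open>\<beta>\<close> the
  projection to \<open>G\<close>, then \<open>\<beta>(gx) = g\<beta>(x)\<close>. So \<open>g = \<beta>(gx)\<beta>(x)\<^sup>-\<^sup>1\<close> depends continuously on
  \<open>(x, gx)\<close>, which gives freeness and a continuous left inverse of the shear map.\<close>

lemma trivial_bundle_action:
  assumes G: "group G" and TG: "topspace TG = carrier G"
    and mult: "continuous_map (prod_topology TG TG) TG (\<lambda>(g, h). g \<otimes>\<^bsub>G\<^esub> h)"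
    and inv: "continuous_map TG TG (\<lambda>g. inv\<^bsub>G\<^esub> g)"
    and X: "Hausdorff_space X"
    and ED: "homeomorphic_maps (prod_topology TG T) X E D"
    and act: "\<And>g h t. g \<in> carrier G \<Longrightarrow> h \<in> carrier G \<Longrightarrow> t \<in> topspace T \<Longrightarrow>
      act g (E (h, t)) = E (g \<otimes>\<^bsub>G\<^esub> h, t)"
  shows "\<And>g x. g \<in> carrier G \<Longrightarrow> x \<in> topspace X \<Longrightarrow> act g x = x \<Longrightarrow> g = \<one>\<^bsub>G\<^esub>"
    and "continuous_map (prod_topology TG X) (prod_topology X X) (\<lambda>(g, x). (x, act g x))"
    and "proper_map (prod_topology TG X) (prod_topology X X) (\<lambda>(g, x). (x, act g x))"
proof -
  interpret G: group G by (rule G)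
  have E: "continuous_map (prod_topology TG T) X E" and D: "continuous_map X (prod_topology TG T) D"
    and DE: "\<And>h t. h \<in> carrier G \<Longrightarrow> t \<in> topspace T \<Longrightarrow> D (E (h, t)) = (h, t)"
    and ED': "\<And>x. x \<in> topspace X \<Longrightarrow> E (D x) = x"
    using ED by (auto simp: homeomorphic_maps_def TG)
  have D1: "fst (D x) \<in> carrier G" and D2: "snd (D x) \<in> topspace T" if "x \<in> topspace X" for x
    using funcset_mem[OF continuous_map_funspace[OF D] that] by (auto simp: TG mem_Times_iff)
  have act': "act g x = E (g \<otimes>\<^bsub>G\<^esub> fst (D x), snd (D x))" if "g \<in> carrier G" "x \<in> topspace X" for g x
    using act[OF that(1) D1[OF that(2)] D2[OF that(2)]] ED'[OF that(2)] by simp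
  have Dact: "D (act g x) = (g \<otimes>\<^bsub>G\<^esub> fst (D x), snd (D x))" if "g \<in> carrier G" "x \<in> topspace X" for g x
    using that by (simp add: act' DE D1 D2)
  have fD: "continuous_map X TG (\<lambda>x. fst (D x))" and sD: "continuous_map X T (\<lambda>x. snd (D x))"
    using continuous_map_compose[OF D continuous_map_fst] continuous_map_compose[OF D continuous_map_snd]
    by (simp_all add: comp_def)
  have mult': "continuous_map Z TG (\<lambda>z. a z \<otimes>\<^bsub>G\<^esub> b z)" if "continuous_map Z TG a" "continuous_map Z TG b" for Z :: "'z topology" and a b
    using continuous_map_compose[OF continuous_map_pairedI[OF that] mult] by (simp add: comp_def)
  have c: "continuous_map (prod_topology TG X) X (\<lambda>(g, x). act g x)"
  proof (rule continuous_map_eq)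
    show "continuous_map (prod_topology TG X) X (\<lambda>z. E (fst z \<otimes>\<^bsub>G\<^esub> fst (D (snd z)), snd (D (snd z))))"
    proof -
      have "continuous_map (prod_topology TG X) (prod_topology TG T)
          (\<lambda>z. (fst z \<otimes>\<^bsub>G\<^esub> fst (D (snd z)), snd (D (snd z))))"
        by (intro continuous_map_pairedI mult' continuous_map_fst
            continuous_map_compose[OF continuous_map_snd fD, unfolded comp_def]
            continuous_map_compose[OF continuous_map_snd sD, unfolded comp_def])
      from continuous_map_compose[OF this E] show ?thesis by (simp add: comp_def)
    qed
  qed (auto simp: act' TG)
  show cont: "continuous_map (prod_topology TG X) (prod_topology X X) (\<lambda>(g, x). (x, act g x))"
  proof -
    have eq: "(\<lambda>(g, x). (x, act g x)) = (\<lambda>z. (snd z, (\<lambda>(g, x). act g x) z))"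
      by (rule ext) (simp add: case_prod_beta)
    show ?thesis unfolding eq by (rule continuous_map_pairedI[OF continuous_map_snd c])
  qed
  show "g = \<one>\<^bsub>G\<^esub>" if "g \<in> carrier G" "x \<in> topspace X" "act g x = x" for g x
  proof -
    have "fst (D x) = g \<otimes>\<^bsub>G\<^esub> fst (D x)" using arg_cong[OF Dact[OF that(1,2)], of fst] that(3) by simp
    then show ?thesis using G.r_cancel_one[OF D1[OF that(2)] that(1)] by simp
  qed
  \<comment> \<open>The left inverse \<open>(x, y) \<mapsto> (\<beta>(y)\<beta>(x)\<^sup>-\<^sup>1, x)\<close> with \<open>\<beta> = fst \<circ> D\<close>.\<close>
  define k where "k = (\<lambda>(x, y). (fst (D y) \<otimes>\<^bsub>G\<^esub> inv\<^bsub>G\<^esub> fst (D x), x))"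
  show "proper_map (prod_topology TG X) (prod_topology X X) (\<lambda>(g, x). (x, act g x))"
  proof (rule section_imp_proper_map[OF cont])
    show "continuous_map (prod_topology X X) (prod_topology TG X) k"
      unfolding k_def split_beta
      by (intro continuous_map_pairedI mult' continuous_map_fst
          continuous_map_compose[OF continuous_map_snd fD, unfolded comp_def]
          continuous_map_compose[OF continuous_map_compose[OF continuous_map_fst fD] inv, unfolded comp_def])
    show "k ((\<lambda>(g, x). (x, act g x)) z) = z" if "z \<in> topspace (prod_topology TG X)" for z
      using that by (auto simp: k_def Dact D1 TG G.m_assoc)
    show "Hausdorff_space (prod_topology X X)" using X by (simp add: Hausdorff_space_prod_topology)
  qed
qed

section \<open>The isotropy group as a topological group\<close>

text \<open>The topology of the isotropy groups is transported from their parameter sets, so continuity of the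
  group operations can be checked on parameters.\<close>

lemma transfer_binary_continuous:
  assumes h: "homeomorphic_maps (top_of_set S) X f g"
    and c: "continuous_on (S \<times> S) (\<lambda>(p, q). m p q)" and cl: "\<And>p q. p \<in> S \<Longrightarrow> q \<in> S \<Longrightarrow> m p q \<in> S"
    and m: "\<And>p q. p \<in> S \<Longrightarrow> q \<in> S \<Longrightarrow> f (m p q) = op (f p) (f q)"
  shows "continuous_map (prod_topology X X) X (\<lambda>(x, y). op x y)"
proof (rule continuous_map_eq)
  have f: "continuous_map (top_of_set S) X f" and g: "continuous_map X (top_of_set S) g"
    and fg: "\<And>x. x \<in> topspace X \<Longrightarrow> f (g x) = x"
    using h by (auto simp: homeomorphic_maps_def)
  have gS: "g x \<in> S" if "x \<in> topspace X" for x using continuous_map_funspace[OF g] that by auto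
  have "continuous_map (top_of_set (S \<times> S)) (top_of_set S) (\<lambda>(p, q). m p q)"
    using c cl by (auto simp: continuous_map_in_subtopology)
  then have m': "continuous_map (prod_topology (top_of_set S) (top_of_set S)) (top_of_set S) (\<lambda>(p, q). m p q)"
    using subtopology_Times[of euclidean euclidean S S] by simp
  have "continuous_map (prod_topology X X) (prod_topology (top_of_set S) (top_of_set S)) (\<lambda>z. (g (fst z), g (snd z)))"
    using continuous_map_compose[OF continuous_map_fst g] continuous_map_compose[OF continuous_map_snd g]
    by (intro continuous_map_pairedI) (simp_all add: comp_def)
  from continuous_map_compose[OF continuous_map_compose[OF this m'] f]
  show "continuous_map (prod_topology X X) X (\<lambda>z. f (m (g (fst z)) (g (snd z))))" by (simp add: comp_def)
  show "f (m (g (fst z)) (g (snd z))) = (\<lambda>(x, y). op x y) z" if "z \<in> topspace (prod_topology X X)" for z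
    using that by (auto simp: m gS fg)
qed

lemma transfer_unary_continuous:
  assumes h: "homeomorphic_maps (top_of_set S) X f g"
    and c: "continuous_on S i" and cl: "\<And>p. p \<in> S \<Longrightarrow> i p \<in> S"
    and i: "\<And>p. p \<in> S \<Longrightarrow> f (i p) = op (f p)"
  shows "continuous_map X X op"
proof (rule continuous_map_eq)
  have f: "continuous_map (top_of_set S) X f" and g: "continuous_map X (top_of_set S) g"
    and fg: "\<And>x. x \<in> topspace X \<Longrightarrow> f (g x) = x"
    using h by (auto simp: homeomorphic_maps_def)
  have gS: "g x \<in> S" if "x \<in> topspace X" for x using continuous_map_funspace[OF g] that by auto
  have "continuous_map (top_of_set S) (top_of_set S) i"
    using c cl by (auto simp: continuous_map_in_subtopology)
  from continuous_map_compose[OF continuous_map_compose[OF g this] f]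
  show "continuous_map X X (\<lambda>x. f (i (g x)))" by (simp add: comp_def)
  show "f (i (g x)) = op x" if "x \<in> topspace X" for x
    using that by (simp add: i gS fg)
qed

lemma continuous_on_sigma_mult: "continuous_on S (\<lambda>(p, q). sigma_mult p q)"
  unfolding sigma_mult_def split_beta by (intro continuous_intros)

lemma continuous_on_sigma_inv: "continuous_on Gamma sigma_inv"
  unfolding sigma_inv_def split_beta by (intro continuous_intros) (auto simp: Gamma_def)

lemma continuous_on_Uinv:
  "continuous_on S u \<Longrightarrow> continuous_on S a \<Longrightarrow> continuous_on S x \<Longrightarrow> continuous_on S (\<lambda>p. Uinv eps (u p) (a p) (x p))"
  unfolding Uinv_def by (intro continuous_on_vector2 continuous_intros)

lemma continuous_on_Umap:
  "continuous_on S u \<Longrightarrow> continuous_on S a \<Longrightarrow> continuous_on S x \<Longrightarrow> continuous_on S (\<lambda>p. Umap eps (u p) (a p) (x p))"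
  unfolding Umap_def by (intro continuous_on_vector2 continuous_intros)

lemma continuous_on_herm:
  "continuous_on S x \<Longrightarrow> continuous_on S y \<Longrightarrow> continuous_on S (\<lambda>p. herm eps (x p) (y p))"
  unfolding herm_def by (intro continuous_intros)

lemma continuous_on_vec_smult:
  fixes x :: "'a::topological_space \<Rightarrow> complex^2"
  shows "continuous_on S k \<Longrightarrow> continuous_on S x \<Longrightarrow> continuous_on S (\<lambda>p. k p *s x p)"
  unfolding vector_scalar_mult_def by (intro continuous_intros continuous_on_vec_lambda)

lemma continuous_on_sigma'_mult: "continuous_on S (\<lambda>(p, q). sigma'_mult eps p q)"
  unfolding sigma'_mult_def split_beta
  by (intro continuous_intros continuous_on_vector2 continuous_on_herm continuous_on_vec_smult continuous_on_Uinv)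

lemma continuous_on_sigma'_inv: "continuous_on (Gamma' eps) (sigma'_inv eps)"
  unfolding sigma'_inv_def split_beta
  by (intro continuous_intros continuous_on_vector2 continuous_on_vec_smult continuous_on_Umap)
     (auto simp: Gamma'_def)

definition iso2_topology :: "(2, 2) germ topology" where
  "iso2_topology = pullback_topology (sigma ` Gamma) (inv_into Gamma sigma) (top_of_set Gamma)"

definition iso3_topology :: "real \<Rightarrow> (3, 3) germ topology" where
  "iso3_topology eps = pullback_topology (sigma' eps ` Gamma' eps) (inv_into (Gamma' eps) (sigma' eps))
          (top_of_set (Gamma' eps))"

lemma topology_isotropy_eq: "topology_isotropy eps = prod_topology iso2_topology (iso3_topology eps)"
  by (simp add: topology_isotropy_def iso2_topology_def iso3_topology_def)

lemma homeomorphic_maps_sigma: "homeomorphic_maps (top_of_set Gamma) iso2_topology sigma (inv_into Gamma sigma)"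
  unfolding iso2_topology_def by (rule homeomorphic_maps_pullback_inv_into[OF inj_on_sigma])

lemma homeomorphic_maps_sigma':
  "eps = 1 \<or> eps = -1 \<Longrightarrow>
    homeomorphic_maps (top_of_set (Gamma' eps)) (iso3_topology eps) (sigma' eps) (inv_into (Gamma' eps) (sigma' eps))"
  unfolding iso3_topology_def by (rule homeomorphic_maps_pullback_inv_into[OF inj_on_sigma'])

lemma topspace_iso2_topology: "topspace iso2_topology = carrier Iso2"
  by (auto simp: iso2_topology_def topspace_pullback_topology inv_into_into Iso2_simps)

lemma topspace_iso3_topology: "topspace (iso3_topology eps) = carrier (Iso3 eps)"
  by (auto simp: iso3_topology_def topspace_pullback_topology inv_into_into Iso3_simps)

lemma continuous_Iso2_operations:
  "continuous_map (prod_topology iso2_topology iso2_topology) iso2_topology (\<lambda>(x, y). x \<otimes>\<^bsub>Iso2\<^esub> y)"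
  "continuous_map iso2_topology iso2_topology (\<lambda>x. inv\<^bsub>Iso2\<^esub> x)"
  by (rule transfer_binary_continuous[OF homeomorphic_maps_sigma continuous_on_sigma_mult sigma_mult_closed])
     (simp_all add: sigma_mult Iso2_simps,
      rule transfer_unary_continuous[OF homeomorphic_maps_sigma continuous_on_sigma_inv sigma_inv_closed],
      simp_all add: inv_Iso2)

lemma continuous_Iso3_operations:
  assumes "eps = 1 \<or> eps = -1"
  shows "continuous_map (prod_topology (iso3_topology eps) (iso3_topology eps)) (iso3_topology eps) (\<lambda>(x, y). x \<otimes>\<^bsub>Iso3 eps\<^esub> y)"
  "continuous_map (iso3_topology eps) (iso3_topology eps) (\<lambda>x. inv\<^bsub>Iso3 eps\<^esub> x)"
  by (rule transfer_binary_continuous[OF homeomorphic_maps_sigma'[OF assms] continuous_on_sigma'_mult sigma'_mult_closed])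
     (simp_all add: sigma'_mult Iso3_simps,
      rule transfer_unary_continuous[OF homeomorphic_maps_sigma'[OF assms] continuous_on_sigma'_inv sigma'_inv_closed],
      simp_all add: inv_Iso3)

lemma group_isotropy: "group (isotropy_group eps)"
  unfolding isotropy_group_def by (rule DirProd_group[OF group_Iso2 group_Iso3])

lemma isotropy_topological_group:
  assumes "eps = 1 \<or> eps = -1"
  shows "topspace (topology_isotropy eps) = carrier (isotropy_group eps)"
    "continuous_map (prod_topology (topology_isotropy eps) (topology_isotropy eps)) (topology_isotropy eps)
      (\<lambda>(x, y). x \<otimes>\<^bsub>isotropy_group eps\<^esub> y)"
    "continuous_map (topology_isotropy eps) (topology_isotropy eps) (\<lambda>x. inv\<^bsub>isotropy_group eps\<^esub> x)"
proof -
  show "topspace (topology_isotropy eps) = carrier (isotropy_group eps)"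
    by (simp add: topology_isotropy_eq topspace_iso2_topology topspace_iso3_topology isotropy_group_def)
  have c: "continuous_map (prod_topology (prod_topology A B) (prod_topology A B)) A (\<lambda>z. fst (fst z))"
    "continuous_map (prod_topology (prod_topology A B) (prod_topology A B)) A (\<lambda>z. fst (snd z))"
    "continuous_map (prod_topology (prod_topology A B) (prod_topology A B)) B (\<lambda>z. snd (fst z))"
    "continuous_map (prod_topology (prod_topology A B) (prod_topology A B)) B (\<lambda>z. snd (snd z))"
    for A :: "'x topology" and B :: "'y topology"
    by (simp_all add: continuous_map_compose[OF continuous_map_fst continuous_map_fst, unfolded comp_def]
        continuous_map_compose[OF continuous_map_snd continuous_map_fst, unfolded comp_def]
        continuous_map_compose[OF continuous_map_fst continuous_map_snd, unfolded comp_def]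
        continuous_map_compose[OF continuous_map_snd continuous_map_snd, unfolded comp_def])
  show "continuous_map (prod_topology (topology_isotropy eps) (topology_isotropy eps)) (topology_isotropy eps)
      (\<lambda>(x, y). x \<otimes>\<^bsub>isotropy_group eps\<^esub> y)"
    unfolding topology_isotropy_eq isotropy_group_def split_beta mult_DirProd'
    using continuous_map_compose[OF continuous_map_pairedI[OF c(1,2)] continuous_Iso2_operations(1)]
      continuous_map_compose[OF continuous_map_pairedI[OF c(3,4)] continuous_Iso3_operations(1)[OF assms]]
    by (intro continuous_map_pairedI) (simp_all add: comp_def)
  show "continuous_map (topology_isotropy eps) (topology_isotropy eps) (\<lambda>x. inv\<^bsub>isotropy_group eps\<^esub> x)"
    unfolding topology_isotropy_eq isotropy_group_def
  proof (rule continuous_map_eq)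
    show "continuous_map (prod_topology iso2_topology (iso3_topology eps)) (prod_topology iso2_topology (iso3_topology eps))
       (\<lambda>x. (inv\<^bsub>Iso2\<^esub> (fst x), inv\<^bsub>Iso3 eps\<^esub> (snd x)))"
      using continuous_map_compose[OF continuous_map_fst continuous_Iso2_operations(2)]
        continuous_map_compose[OF continuous_map_snd continuous_Iso3_operations(2)[OF assms]]
      by (intro continuous_map_pairedI) (simp_all add: comp_def)
  qed (auto simp: topspace_iso2_topology topspace_iso3_topology inv_DirProd[OF group_Iso2 group_Iso3])
qed

section \<open>The bundle structure of the orbits\<close>

definition slice_germ :: "real \<Rightarrow> real \<times> real \<Rightarrow> (2, 3) germ" where
  "slice_germ eps = (\<lambda>(s, b). abs_germ (slice_map eps s b))"

definition bundle_map ::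
    "real \<Rightarrow> ((2, 2) germ \<times> (3, 3) germ) \<times> (real \<times> real) \<Rightarrow> (2, 3) germ" where
  "bundle_map eps = (\<lambda>((\<phi>, \<phi>'), t). germ_comp \<phi>' (germ_comp (slice_germ eps t) (inv\<^bsub>Iso2\<^esub> \<phi>)))"

definition bundle_inv ::
    "real \<Rightarrow> (2, 3) germ \<Rightarrow> ((2, 2) germ \<times> (3, 3) germ) \<times> (real \<times> real)" where
  "bundle_inv eps H = (case recover eps (jet0 H) of (p, q, t) \<Rightarrow> ((inv\<^bsub>Iso2\<^esub> (sigma p), sigma' eps q), t))"

lemma top_of_set_Times: "top_of_set (S \<times> T) = prod_topology (top_of_set S) (top_of_set T)"
  by (metis subtopology_Times prod_topology_euclidean)

text \<open>This is the homeomorphism with the parameters, composed with inversion of the source isotropy.\<close>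

lemma homeomorphic_maps_bundle:
  assumes eps: "eps = 1 \<or> eps = -1"
  shows "homeomorphic_maps (prod_topology (topology_isotropy eps) (top_of_set (slice_params eps)))
    (topology_frakF eps) (bundle_map eps) (bundle_inv eps)"
proof -
  interpret I: group Iso2 by (rule group_Iso2)
  let ?Q = "top_of_set (slice_params eps)"
  let ?i = "inv_into Gamma sigma" and ?i' = "inv_into (Gamma' eps) (sigma' eps)"
  define A where "A = (\<lambda>z. (?i (inv\<^bsub>Iso2\<^esub> (fst (fst z))), ?i' (snd (fst z)), snd z :: real \<times> real))"
  define B where "B = (\<lambda>P. ((inv\<^bsub>Iso2\<^esub> (sigma (fst P)), sigma' eps (fst (snd P))), snd (snd P) :: real \<times> real))"
  have s: "continuous_map (top_of_set Gamma) iso2_topology sigma" "continuous_map iso2_topology (top_of_set Gamma) ?i"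
    "continuous_map (top_of_set (Gamma' eps)) (iso3_topology eps) (sigma' eps)"
    "continuous_map (iso3_topology eps) (top_of_set (Gamma' eps)) ?i'"
    using homeomorphic_maps_sigma homeomorphic_maps_sigma'[OF eps] by (auto simp: homeomorphic_maps_def)
  have inv_eqs: "?i (sigma p) = p" if "p \<in> Gamma" for p using inv_into_f_f[OF inj_on_sigma that] .
  have inv_eqs': "?i' (sigma' eps q) = q" if "q \<in> Gamma' eps" for q
    using inv_into_f_f[OF inj_on_sigma'[OF eps] that] .
  have mem: "?i x \<in> Gamma" "sigma (?i x) = x" if "x \<in> carrier Iso2" for x
    using that by (auto simp: Iso2_simps inv_eqs)
  have mem': "?i' x \<in> Gamma' eps" "sigma' eps (?i' x) = x" if "x \<in> carrier (Iso3 eps)" for x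
    using that by (auto simp: Iso3_simps inv_eqs')
  have carr: "sigma p \<in> carrier Iso2" if "p \<in> Gamma" for p using that by (simp add: Iso2_simps)
  have "homeomorphic_maps (prod_topology (topology_isotropy eps) ?Q) (top_of_set (all_params eps)) A B"
    unfolding homeomorphic_maps_def
  proof (intro conjI ballI)
    show "continuous_map (prod_topology (topology_isotropy eps) ?Q) (top_of_set (all_params eps)) A"
      unfolding A_def top_of_set_Times topology_isotropy_eq
      by (intro continuous_map_pairedI continuous_map_snd
          continuous_map_compose[OF continuous_map_compose[OF continuous_map_compose[OF continuous_map_fst continuous_map_fst]
            continuous_Iso2_operations(2)] s(2), unfolded comp_def]
          continuous_map_compose[OF continuous_map_compose[OF continuous_map_fst continuous_map_snd] s(4), unfolded comp_def])
    show "continuous_map (top_of_set (all_params eps)) (prod_topology (topology_isotropy eps) ?Q) B"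
      unfolding B_def top_of_set_Times topology_isotropy_eq
      by (intro continuous_map_pairedI continuous_map_snd
          continuous_map_compose[OF continuous_map_compose[OF continuous_map_fst s(1)] continuous_Iso2_operations(2), unfolded comp_def]
          continuous_map_compose[OF continuous_map_compose[OF continuous_map_snd continuous_map_fst] s(3), unfolded comp_def]
          continuous_map_compose[OF continuous_map_snd continuous_map_snd, unfolded comp_def])
    show "B (A z) = z" if "z \<in> topspace (prod_topology (topology_isotropy eps) ?Q)" for z
      using that by (auto simp: A_def B_def isotropy_topological_group(1)[OF eps] isotropy_group_def mem mem')
    show "A (B P) = P" if "P \<in> topspace (top_of_set (all_params eps))" for P
      using that by (auto simp: A_def B_def carr inv_eqs inv_eqs')
  qed
  from homeomorphic_maps_compose[OF conjI[OF this homeomorphic_maps_param_germ[OF eps]]]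
  have h: "homeomorphic_maps (prod_topology (topology_isotropy eps) ?Q) (topology_frakF eps)
    (param_germ eps \<circ> A) (B \<circ> (\<lambda>H. recover eps (jet0 H)))"
    .
  show ?thesis
  proof (rule homeomorphic_maps_eq[OF h])
    show "(param_germ eps \<circ> A) z = bundle_map eps z" if "z \<in> topspace (prod_topology (topology_isotropy eps) ?Q)" for z
      using that by (auto simp: A_def param_germ_def bundle_map_def slice_germ_def
          isotropy_topological_group(1)[OF eps] isotropy_group_def mem mem')
    show "(B \<circ> (\<lambda>H. recover eps (jet0 H))) H = bundle_inv eps H" for H
      by (simp add: B_def bundle_inv_def split_beta)
  qed
qed

lemma bundle_map_onto:
  assumes "eps = 1 \<or> eps = -1" "H \<in> frakF eps"
  obtains h t where "h \<in> carrier (isotropy_group eps)" "t \<in> slice_params eps" "H = bundle_map eps (h, t)"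
proof -
  have c: "continuous_map (topology_frakF eps) (prod_topology (topology_isotropy eps) (top_of_set (slice_params eps)))
      (bundle_inv eps)" and b: "bundle_map eps (bundle_inv eps H) = H"
    using homeomorphic_maps_bundle[OF assms(1)] assms(2) by (simp_all add: homeomorphic_maps_def topspace_frakF[OF assms(1)])
  obtain h t where ht: "bundle_inv eps H = (h, t)" by (cases "bundle_inv eps H")
  have "(h, t) \<in> carrier (isotropy_group eps) \<times> slice_params eps"
    using funcset_mem[OF continuous_map_funspace[OF c], of H] assms(2)
    by (simp add: ht topspace_frakF[OF assms(1)] isotropy_topological_group(1)[OF assms(1)])
  moreover have "H = bundle_map eps (h, t)" using b by (simp only: ht)
  ultimately show thesis by (intro that[of h t]) (simp_all only: mem_Times_iff fst_conv snd_conv)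
qed

lemma bundle_map_in_frakF:
  assumes "eps = 1 \<or> eps = -1" "h \<in> carrier (isotropy_group eps)" "t \<in> slice_params eps"
  shows "bundle_map eps (h, t) \<in> frakF eps"
proof -
  have "continuous_map (prod_topology (topology_isotropy eps) (top_of_set (slice_params eps)))
      (topology_frakF eps) (bundle_map eps)"
    using homeomorphic_maps_bundle[OF assms(1)] by (simp add: homeomorphic_maps_def)
  from funcset_mem[OF continuous_map_funspace[OF this], of "(h, t)"] show ?thesis
    using assms by (simp add: topspace_frakF isotropy_topological_group(1))
qed

lemma N_map_bundle_map:
  assumes eps: "eps = 1 \<or> eps = -1" and g: "g \<in> carrier (isotropy_group eps)"
    and h: "h \<in> carrier (isotropy_group eps)" and t: "t \<in> slice_params eps"
  shows "N_map eps g (bundle_map eps (h, t)) = bundle_map eps (g \<otimes>\<^bsub>isotropy_group eps\<^esub> h, t)"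
proof -
  interpret I: group Iso2 by (rule group_Iso2)
  obtain \<phi> \<phi>' where G: "g = (\<phi>, \<phi>')" "\<phi> \<in> carrier Iso2" using g by (auto simp: isotropy_group_def)
  obtain \<psi> \<psi>' where H: "h = (\<psi>, \<psi>')" "\<psi> \<in> carrier Iso2" using h by (auto simp: isotropy_group_def)
  have "inv\<^bsub>Iso2\<^esub> (germ_comp \<phi> \<psi>) = germ_comp (inv\<^bsub>Iso2\<^esub> \<psi>) (inv\<^bsub>Iso2\<^esub> \<phi>)"
    using I.inv_mult_group[OF G(2) H(2)] by (simp add: Iso2_simps)
  then show ?thesis
    using bundle_map_in_frakF[OF eps h t]
    by (simp add: N_map_def G(1) H(1) bundle_map_def isotropy_group_def germ_comp_assoc Iso2_simps(2) Iso3_simps(2))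
qed

lemma group_action_N_map:
  assumes eps: "eps = 1 \<or> eps = -1"
  shows "group_action (isotropy_group eps) (frakF eps) (N_map eps)"
proof -
  interpret G: group "isotropy_group eps" by (rule group_isotropy)
  have closed: "N_map eps g H \<in> frakF eps" if g: "g \<in> carrier (isotropy_group eps)" and H: "H \<in> frakF eps" for g H
  proof -
    obtain k t where k: "k \<in> carrier (isotropy_group eps)" "t \<in> slice_params eps" "H = bundle_map eps (k, t)"
      by (rule bundle_map_onto[OF eps H])
    show ?thesis unfolding k(3) N_map_bundle_map[OF eps g k(1,2)]
      by (rule bundle_map_in_frakF[OF eps G.m_closed[OF g k(1)] k(2)])
  qed
  have mult: "N_map eps g (N_map eps h H) = N_map eps (g \<otimes>\<^bsub>isotropy_group eps\<^esub> h) H"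
    if g: "g \<in> carrier (isotropy_group eps)" and h: "h \<in> carrier (isotropy_group eps)" and H: "H \<in> frakF eps" for g h H
  proof -
    obtain k t where k: "k \<in> carrier (isotropy_group eps)" "t \<in> slice_params eps" "H = bundle_map eps (k, t)"
      by (rule bundle_map_onto[OF eps H])
    show ?thesis
      unfolding k(3) N_map_bundle_map[OF eps h k(1,2)] N_map_bundle_map[OF eps g G.m_closed[OF h k(1)] k(2)]
        N_map_bundle_map[OF eps G.m_closed[OF g h] k(1,2)] G.m_assoc[OF g h k(1)] ..
  qed
  have one: "N_map eps \<one>\<^bsub>isotropy_group eps\<^esub> H = H" if H: "H \<in> frakF eps" for H
  proof -
    obtain k t where k: "k \<in> carrier (isotropy_group eps)" "t \<in> slice_params eps" "H = bundle_map eps (k, t)"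
      by (rule bundle_map_onto[OF eps H])
    show ?thesis unfolding k(3) N_map_bundle_map[OF eps G.one_closed k(1,2)] G.l_one[OF k(1)] ..
  qed
  have ext: "N_map eps g \<in> extensional (frakF eps)" for g by (cases g) (simp add: N_map_def)
  have bij: "N_map eps g \<in> Bij (frakF eps)" if g: "g \<in> carrier (isotropy_group eps)" for g
    unfolding Bij_def
  proof (intro IntI CollectI ext)
    have i: "inv\<^bsub>isotropy_group eps\<^esub> g \<in> carrier (isotropy_group eps)" using g by simp
    show "bij_betw (N_map eps g) (frakF eps) (frakF eps)"
      by (rule bij_betw_byWitness[where f' = "N_map eps (inv\<^bsub>isotropy_group eps\<^esub> g)"])
         (use closed[OF g] closed[OF i] mult[OF g i] mult[OF i g] one g in auto)
  qed
  have "N_map eps (g \<otimes>\<^bsub>isotropy_group eps\<^esub> h) = compose (frakF eps) (N_map eps g) (N_map eps h)"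
    if "g \<in> carrier (isotropy_group eps)" "h \<in> carrier (isotropy_group eps)" for g h
    using ext by (intro extensionalityI[of _ "frakF eps"]) (auto simp: compose_eq mult[OF that])
  then have "N_map eps \<in> hom (isotropy_group eps) (BijGroup (frakF eps))"
    using bij by (auto simp: hom_def BijGroup_def)
  then show ?thesis
    unfolding group_action_def group_hom_def group_hom_axioms_def
    using group_isotropy group_BijGroup by blast
qed

theorem theorem1p3:
  fixes \<epsilon> :: real
  assumes "\<epsilon> = 1 \<or> \<epsilon> = -1"
  shows "group_action (isotropy_group \<epsilon>) (frakF \<epsilon>) (N_map \<epsilon>) \<and>
    (\<forall>H\<in>frakF \<epsilon>. stabilizer (isotropy_group \<epsilon>) (N_map \<epsilon>) H = {\<one>\<^bsub>isotropy_group \<epsilon>\<^esub>}) \<and>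
    continuous_map (prod_topology (topology_isotropy \<epsilon>) (topology_frakF \<epsilon>))
      (prod_topology (topology_frakF \<epsilon>) (topology_frakF \<epsilon>))
      (\<lambda>(\<Phi>, H). (H, N_map \<epsilon> \<Phi> H)) \<and>
    proper_map (prod_topology (topology_isotropy \<epsilon>) (topology_frakF \<epsilon>))
      (prod_topology (topology_frakF \<epsilon>) (topology_frakF \<epsilon>))
      (\<lambda>(\<Phi>, H). (H, N_map \<epsilon> \<Phi> H))"
proof (intro conjI ballI)
  interpret A: group_action "isotropy_group \<epsilon>" "frakF \<epsilon>" "N_map \<epsilon>"
    by (rule group_action_N_map[OF assms])
  show "group_action (isotropy_group \<epsilon>) (frakF \<epsilon>) (N_map \<epsilon>)" by (rule group_action_N_map[OF assms])
  have "top_of_set (all_params \<epsilon>) homeomorphic_space topology_frakF \<epsilon>"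
    using homeomorphic_maps_param_germ[OF assms] unfolding homeomorphic_space_def by blast
  then have haus: "Hausdorff_space (topology_frakF \<epsilon>)"
    by (rule homeomorphic_Hausdorff_space[THEN iffD1])
       (rule Hausdorff_space_subtopology[OF Hausdorff_space_euclidean])
  note B = trivial_bundle_action[OF group_isotropy isotropy_topological_group[OF assms] haus
      homeomorphic_maps_bundle[OF assms], of "N_map \<epsilon>"]
  have act: "N_map \<epsilon> g (bundle_map \<epsilon> (h, t)) = bundle_map \<epsilon> (g \<otimes>\<^bsub>isotropy_group \<epsilon>\<^esub> h, t)"
    if "g \<in> carrier (isotropy_group \<epsilon>)" "h \<in> carrier (isotropy_group \<epsilon>)"
      "t \<in> topspace (top_of_set (slice_params \<epsilon>))" for g h t
    using N_map_bundle_map[OF assms] that by simp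
  show "stabilizer (isotropy_group \<epsilon>) (N_map \<epsilon>) H = {\<one>\<^bsub>isotropy_group \<epsilon>\<^esub>}" if "H \<in> frakF \<epsilon>" for H
  proof -
    have "N_map \<epsilon> \<one>\<^bsub>isotropy_group \<epsilon>\<^esub> H = H" using fun_cong[OF A.id_eq_one, of H] that by simp
    then show ?thesis
      using B(1)[OF act] that group.is_monoid[OF group_isotropy] topspace_frakF[OF assms]
      by (auto simp: stabilizer_def monoid.one_closed)
  qed
  show "continuous_map (prod_topology (topology_isotropy \<epsilon>) (topology_frakF \<epsilon>))
      (prod_topology (topology_frakF \<epsilon>) (topology_frakF \<epsilon>)) (\<lambda>(\<Phi>, H). (H, N_map \<epsilon> \<Phi> H))"
    by (rule B(2)[OF act])
  show "proper_map (prod_topology (topology_isotropy \<epsilon>) (topology_frakF \<epsilon>))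
      (prod_topology (topology_frakF \<epsilon>) (topology_frakF \<epsilon>)) (\<lambda>(\<Phi>, H). (H, N_map \<epsilon> \<Phi> H))"
    by (rule B(3)[OF act])
qed

end
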